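(* Let $\mathcal T_{q,t}$ be an equivalence class for $\sim_{q,t}$ on $\mathrm{Std}_{d,n}$ and let $\boldsymbol k=\mathrm{res}(\mathcal T_{q,t})$. Then in the Yokonuma–Hecke algebra $\mathcal Y_{d,n}(q)$ over $\Bbbk$, $$E_{\mathcal T_{q,t}}=e(\boldsymbol k).$$
   Context: **Yokonuma–Hecke algebra.** $n,d$ are positive integers, $\Bbbk$ is a field with $d$ coprime to $\mathrm{char}\,\Bbbk$ containing a primitive $d$-th root of unity $\xi$, and $q\in\Bbbk^\times$, $q\ne1$. For a commutative domain $R\ni d^{-1}$ and a unit $v\in R^\times$, $\mathcal Y^R_{d,n}(v)$ is the $R$-algebra generated by $g_1,\dots,g_{n-1},t_1,\dots,t_n$ with relations $t_a^d=1$; $t_at_b=t_bt_a$; $t_ag_b=g_bt_{\sigma_b(a)}$; $g_a^2=v+(v-1)e_ag_a$; $g_ag_bg_a=g_bg_ag_b$ if $|a-b|=1$; $g_ag_b=g_bg_a$ if $|a-b|>1$, where $\sigma_b=(b,b+1)$ and $e_a=\frac1d\sum_{r=0}^{d-1}t_a^rt_{a+1}^{-r}$. Put $X_1=1$, $X_{a+1}=v^{-1}g_aX_ag_a$; and $L_a=X_a$ for $1\le a\le n$, $L_a=t_{a-n}$ for $n+1\le a\le2n$. These elements commute. $\mathcal Y_{d,n}(q)=\mathcal Y^{\Bbbk}_{d,n}(q)$. **Idempotents $e(\boldsymbol k)$.** Let $e=\min\{m\ge1:1+q+\dots+q^{m-1}=0\}$ ($e=0$ if none), $I=\mathbb Z/e\mathbb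 Z$, $J=\mathbb Z/d\mathbb Z$, $\mathcal K_n=(I\times J)^n$. For $\boldsymbol k=((i_1,j_1),\dots,(i_n,j_n))\in\mathcal K_n$, $e(\boldsymbol k)$ denotes the (possibly zero) simultaneous generalized eigenspace projector: the $e(\boldsymbol k)\in\mathcal Y_{d,n}(q)$ are the orthogonal idempotents with sum $1$ such that $e(\boldsymbol k)\mathcal Y_{d,n}(q)=\{x:(X_a-q^{i_a})^Nx=(t_a-\xi^{j_a})x=0\ \text{for all }a,\ N\gg0\}$. **Tableaux.** A $d$-multipartition of $n$ is a $d$-tuple of partitions of total size $n$; nodes of its Young diagram are labelled $(r,c,p)$ (row, column, component). $\mathrm{Std}_{d,n}$ is the set of standard multitableaux of $d$-multipartitions of $n$ (bijective fillings by $1,\dots,n$, increasing along rows and down columns of each component). For $\mathbf t\in\mathrm{Std}_{d,n}$ the content is $c_{\mathbf t}(a)=q^{c-r}$ if $1\le a\le n$ and $a$ is in node $(r,c,p)$, and $c_{\mathbf t}(a)=\xi^p$ if $n+1\le a\le2n$ and $a-n$ is in component $p$. $\hat c_{\mathbf t}(a)$ is defined in the same way with $q$ replaced by an indeterminate $\hat q$. **Classes.** $\mathbf s\sim_{q,t}\mathbf t$ iff $c_{\mathbf s}(a)=c_{\mathbf t}(a)$ for all $1\le a\le2n$. For a class $\mathcal T_{q,t}$ and $\mathbf t\in\mathcal T_{q,t}$ there are unique $i_a\in I$, $j_a\in J$ with $c_{\mathbf t}(a)=q^{i_a}$, $c_{\mathbf t}(n+a)=\xi^{j_a}$ ($1\le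 a\le n$); $\mathrm{res}(\mathcal T_{q,t})=((i_1,j_1),\dots,(i_n,j_n))$. **Class idempotents.** In $\mathcal Y^{\Bbbk(\hat q)}_{d,n}(\hat q)$ put $$E_{\mathbf t}=\prod_{a=1}^{2n}\ \prod_{c\in\mathcal C(a),\,c\ne\hat c_{\mathbf t}(a)}\frac{L_a-c}{\hat c_{\mathbf t}(a)-c},\qquad \mathcal C(a)=\{\hat c_{\mathbf u}(a):\mathbf u\in\mathrm{Std}_{d,n}\},$$ and $\hat E_{\mathcal T_{q,t}}=\sum_{\mathbf t\in\mathcal T_{q,t}}E_{\mathbf t}$. Let $\mathcal O=\Bbbk[\hat q,\hat q^{-1}]_{(\hat q-q)}$ (localization at the prime ideal $(\hat q-q)$), a discrete valuation ring with residue field $\Bbbk$. It is known that $\hat E_{\mathcal T_{q,t}}\in\mathcal Y^{\mathcal O}_{d,n}(\hat q)$; $E_{\mathcal T_{q,t}}\in\mathcal Y_{d,n}(q)$ is its reduction modulo $(\hat q-q)\mathcal O$. *)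

theory Defs
  imports
    "HOL-Library.FuncSet"
    "HOL-Library.Poly_Mapping"
    "HOL-Combinatorics.Transposition"
    "HOL-Computational_Algebra.Polynomial"
    "HOL-Computational_Algebra.Fraction_Field"
    "HOL-Algebra.QuotRing"
    "HOL-Algebra.FiniteProduct"
begin

section \<open>Free algebras\<close>

text \<open>
  Lists form the free monoid, so \<open>'g list \<Rightarrow>\<^sub>0 'r\<close> carries the multiplication of the free
  algebra (monoid algebra of words).
\<close>

instantiation list :: (type) monoid_add
begin

definition zero_list :: "'a list" where "zero_list = []"

definition plus_list :: "'a list \<Rightarrow> 'a list \<Rightarrow> 'a list" where "plus_list xs ys = xs @ ys"

instance
  by standard (simp_all add: zero_list_def plus_list_def)

end

text \<open>
  The coefficient ring is a subring \<open>S\<close> of a field, so that a localisation of a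
  polynomial ring and its fraction field can be treated alike; \<open>X\<close> is the set of generators.
\<close>

definition free_algebra :: "'r::comm_ring_1 set \<Rightarrow> 'g set \<Rightarrow> ('g list \<Rightarrow>\<^sub>0 'r) ring" where
  "free_algebra S X =
     \<lparr>carrier = {f. Poly_Mapping.keys f \<subseteq> lists X \<and> (\<forall>w. Poly_Mapping.lookup f w \<in> S)},
      mult = (*), one = 1, zero = 0, add = (+)\<rparr>"

definition const :: "'r::comm_ring_1 \<Rightarrow> ('g list \<Rightarrow>\<^sub>0 'r)" where
  "const c = Poly_Mapping.single [] c"

definition var :: "'g \<Rightarrow> ('g list \<Rightarrow>\<^sub>0 'r::comm_ring_1)" where
  "var x = Poly_Mapping.single [x] 1"


section \<open>The Yokonuma--Hecke algebra\<close>

datatype yh_gen = Braid nat | Framing nat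

definition yh_gens :: "nat \<Rightarrow> yh_gen set" where
  "yh_gens n = Braid ` {1..<n} \<union> Framing ` {1..n}"

abbreviation free_g :: "nat \<Rightarrow> (yh_gen list \<Rightarrow>\<^sub>0 'r::field)" where
  "free_g b \<equiv> var (Braid b)"

abbreviation free_t :: "nat \<Rightarrow> (yh_gen list \<Rightarrow>\<^sub>0 'r::field)" where
  "free_t a \<equiv> var (Framing a)"

text \<open>The inverse of \<open>t\<^sub>a\<close> is represented by \<open>t\<^sub>a\<close> to the power \<open>d - 1\<close>, since \<open>t\<^sub>a ^ d = 1\<close>.\<close>

definition free_e :: "nat \<Rightarrow> nat \<Rightarrow> (yh_gen list \<Rightarrow>\<^sub>0 'r::field)" where
  "free_e d a = const (1 / of_nat d) * (\<Sum>r<d. free_t a ^ r * (free_t (a + 1) ^ (d - 1)) ^ r)"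

inductive yh_rel :: "nat \<Rightarrow> nat \<Rightarrow> 'r::field \<Rightarrow>
    (yh_gen list \<Rightarrow>\<^sub>0 'r) \<Rightarrow> (yh_gen list \<Rightarrow>\<^sub>0 'r) \<Rightarrow> bool" for d n v where
  t_order: "a \<in> {1..n} \<Longrightarrow> yh_rel d n v (free_t a ^ d) 1"
| t_commute: "a \<in> {1..n} \<Longrightarrow> b \<in> {1..n} \<Longrightarrow>
    yh_rel d n v (free_t a * free_t b) (free_t b * free_t a)"
| t_g: "a \<in> {1..n} \<Longrightarrow> b \<in> {1..<n} \<Longrightarrow>
    yh_rel d n v (free_t a * free_g b) (free_g b * free_t (transpose b (b + 1) a))"
| quadratic: "a \<in> {1..<n} \<Longrightarrow>
    yh_rel d n v (free_g a ^ 2) (const v + const (v - 1) * free_e d a * free_g a)"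
| braid: "a \<in> {1..<n} \<Longrightarrow> b \<in> {1..<n} \<Longrightarrow> \<bar>int a - int b\<bar> = 1 \<Longrightarrow>
    yh_rel d n v (free_g a * free_g b * free_g a) (free_g b * free_g a * free_g b)"
| g_commute: "a \<in> {1..<n} \<Longrightarrow> b \<in> {1..<n} \<Longrightarrow> \<bar>int a - int b\<bar> > 1 \<Longrightarrow>
    yh_rel d n v (free_g a * free_g b) (free_g b * free_g a)"

definition yh_ideal :: "'r::field set \<Rightarrow> nat \<Rightarrow> nat \<Rightarrow> 'r \<Rightarrow> (yh_gen list \<Rightarrow>\<^sub>0 'r) set" where
  "yh_ideal S d n v = genideal (free_algebra S (yh_gens n)) {x - y | x y. yh_rel d n v x y}"

definition YH :: "'r::field set \<Rightarrow> nat \<Rightarrow> nat \<Rightarrow> 'r \<Rightarrow> (yh_gen list \<Rightarrow>\<^sub>0 'r) set ring" where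
  "YH S d n v = free_algebra S (yh_gens n) Quot yh_ideal S d n v"

definition yh_class ::
    "'r::field set \<Rightarrow> nat \<Rightarrow> nat \<Rightarrow> 'r \<Rightarrow> (yh_gen list \<Rightarrow>\<^sub>0 'r) \<Rightarrow> (yh_gen list \<Rightarrow>\<^sub>0 'r) set" where
  "yh_class S d n v f = yh_ideal S d n v +>\<^bsub>free_algebra S (yh_gens n)\<^esub> f"

definition yh_scalar where "yh_scalar S d n v c = yh_class S d n v (const c)"

definition yh_g where "yh_g S d n v b = yh_class S d n v (free_g b)"

definition yh_t where "yh_t S d n v a = yh_class S d n v (free_t a)"

text \<open>The value at index 0 is irrelevant (indices start at 1).\<close>

fun yh_X where
  "yh_X S d n v 0 = \<one>\<^bsub>YH S d n v\<^esub>"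
| "yh_X S d n v (Suc 0) = \<one>\<^bsub>YH S d n v\<^esub>"
| "yh_X S d n v (Suc (Suc a)) =
     yh_scalar S d n v (inverse v) \<otimes>\<^bsub>YH S d n v\<^esub> yh_g S d n v (Suc a)
       \<otimes>\<^bsub>YH S d n v\<^esub> yh_X S d n v (Suc a) \<otimes>\<^bsub>YH S d n v\<^esub> yh_g S d n v (Suc a)"

definition yh_L where
  "yh_L S d n v a = (if a \<le> n then yh_X S d n v a else yh_t S d n v (a - n))"

text \<open>
  The map \<open>YH S d n v \<rightarrow> YH S' d n v'\<close> induced by a ring homomorphism \<open>\<phi> : S \<rightarrow> S'\<close> with
  \<open>\<phi> v = v'\<close>: apply \<open>\<phi>\<close> to the coefficients of representatives.
\<close>

definition yh_base_change :: "('r::field \<Rightarrow> 's::field) \<Rightarrow> 's set \<Rightarrow> nat \<Rightarrow> nat \<Rightarrow> 's \<Rightarrow>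
    (yh_gen list \<Rightarrow>\<^sub>0 'r) set \<Rightarrow> (yh_gen list \<Rightarrow>\<^sub>0 's) set" where
  "yh_base_change \<phi> S' d n v' A = (\<Union>f\<in>A. yh_class S' d n v' (Poly_Mapping.map \<phi> f))"


section \<open>Simultaneous generalised eigenspace projectors\<close>

definition primitive_root_of_unity :: "nat \<Rightarrow> 'k::field \<Rightarrow> bool" where
  "primitive_root_of_unity d \<xi> \<longleftrightarrow> \<xi> ^ d = 1 \<and> (\<forall>m. 0 < m \<and> m < d \<longrightarrow> \<xi> ^ m \<noteq> 1)"

definition quantum_char :: "'k::field \<Rightarrow> nat" where
  "quantum_char q =
     (if \<exists>m\<ge>1. (\<Sum>i<m. q ^ i) = 0 then LEAST m. m \<ge> 1 \<and> (\<Sum>i<m. q ^ i) = 0 else 0)"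

text \<open>
  The quotient of the integers by \<open>m\<close> is represented by canonical representatives: \<open>{0..<m}\<close>
  if \<open>m > 0\<close>, and all integers if \<open>m = 0\<close>, since \<open>i mod 0 = i\<close>.
\<close>

definition int_residues :: "nat \<Rightarrow> int set" where
  "int_residues m = {i. i mod int m = i}"

definition weights :: "'k::field \<Rightarrow> nat \<Rightarrow> nat \<Rightarrow> (nat \<Rightarrow> int \<times> int) set" where
  "weights q d n = ({1..n} \<rightarrow>\<^sub>E int_residues (quantum_char q) \<times> int_residues d)"

definition weight_space ::
    "'k::field \<Rightarrow> 'k \<Rightarrow> nat \<Rightarrow> nat \<Rightarrow> (nat \<Rightarrow> int \<times> int) \<Rightarrow> (yh_gen list \<Rightarrow>\<^sub>0 'k) set set" where
  "weight_space q \<xi> d n k = (let Y = YH UNIV d n q in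
     {x \<in> carrier Y. \<exists>N\<^sub>0. \<forall>N\<ge>N\<^sub>0. \<forall>a\<in>{1..n}.
        (yh_X UNIV d n q a \<ominus>\<^bsub>Y\<^esub> yh_scalar UNIV d n q (q powi fst (k a))) [^]\<^bsub>Y\<^esub> (N::nat) \<otimes>\<^bsub>Y\<^esub> x
          = \<zero>\<^bsub>Y\<^esub> \<and>
        (yh_t UNIV d n q a \<ominus>\<^bsub>Y\<^esub> yh_scalar UNIV d n q (\<xi> powi snd (k a))) \<otimes>\<^bsub>Y\<^esub> x = \<zero>\<^bsub>Y\<^esub>})"

text \<open>The set of weights is infinite if \<open>quantum_char q = 0\<close>; all but finitely many projectors vanish.\<close>

definition weight_idempotent_family :: "'k::field \<Rightarrow> 'k \<Rightarrow> nat \<Rightarrow> nat \<Rightarrow>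
    ((nat \<Rightarrow> int \<times> int) \<Rightarrow> (yh_gen list \<Rightarrow>\<^sub>0 'k) set) \<Rightarrow> bool" where
  "weight_idempotent_family q \<xi> d n e \<longleftrightarrow> (let Y = YH UNIV d n q; K = weights q d n in
     e \<in> K \<rightarrow>\<^sub>E carrier Y \<and>
     (\<forall>k\<in>K. \<forall>l\<in>K. e k \<otimes>\<^bsub>Y\<^esub> e l = (if k = l then e k else \<zero>\<^bsub>Y\<^esub>)) \<and>
     finite {k\<in>K. e k \<noteq> \<zero>\<^bsub>Y\<^esub>} \<and>
     finsum Y e {k\<in>K. e k \<noteq> \<zero>\<^bsub>Y\<^esub>} = \<one>\<^bsub>Y\<^esub> \<and>
     (\<forall>k\<in>K. (\<lambda>y. e k \<otimes>\<^bsub>Y\<^esub> y) ` carrier Y = weight_space q \<xi> d n k))"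

definition weight_idempotent ::
    "'k::field \<Rightarrow> 'k \<Rightarrow> nat \<Rightarrow> nat \<Rightarrow> (nat \<Rightarrow> int \<times> int) \<Rightarrow> (yh_gen list \<Rightarrow>\<^sub>0 'k) set" where
  "weight_idempotent q \<xi> d n = (THE e. weight_idempotent_family q \<xi> d n e)"


section \<open>Standard multitableaux\<close>

definition multipartition :: "nat \<Rightarrow> nat \<Rightarrow> nat list list \<Rightarrow> bool" where
  "multipartition d n \<Lambda> \<longleftrightarrow> length \<Lambda> = d \<and>
     (\<forall>\<mu>\<in>set \<Lambda>. sorted_wrt (\<ge>) \<mu> \<and> 0 \<notin> set \<mu>) \<and> sum_list (map sum_list \<Lambda>) = n"

text \<open>Nodes are triples (row, column, component), all three counted from 1.\<close>

definition diagram :: "nat list list \<Rightarrow> (nat \<times> nat \<times> nat) set" where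
  "diagram \<Lambda> = {(r, c, p). p \<in> {1..length \<Lambda>} \<and> r \<in> {1..length (\<Lambda> ! (p - 1))} \<and>
                           c \<in> {1..\<Lambda> ! (p - 1) ! (r - 1)}}"

text \<open>A multitableau is a pair of its shape and its filling.\<close>

type_synonym multitableau = "nat list list \<times> (nat \<times> nat \<times> nat \<Rightarrow> nat)"

definition Std :: "nat \<Rightarrow> nat \<Rightarrow> multitableau set" where
  "Std d n = {(\<Lambda>, f). multipartition d n \<Lambda> \<and> f \<in> extensional (diagram \<Lambda>) \<and>
     bij_betw f (diagram \<Lambda>) {1..n} \<and>
     (\<forall>r c c' p. (r, c, p) \<in> diagram \<Lambda> \<and> (r, c', p) \<in> diagram \<Lambda> \<and> c < c' \<longrightarrow>
        f (r, c, p) < f (r, c', p)) \<and>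
     (\<forall>r r' c p. (r, c, p) \<in> diagram \<Lambda> \<and> (r', c, p) \<in> diagram \<Lambda> \<and> r < r' \<longrightarrow>
        f (r, c, p) < f (r', c, p))}"

definition node_of :: "multitableau \<Rightarrow> nat \<Rightarrow> nat \<times> nat \<times> nat" where
  "node_of t a = inv_into (diagram (fst t)) (snd t) a"

definition content :: "nat \<Rightarrow> 'f::field \<Rightarrow> 'f \<Rightarrow> multitableau \<Rightarrow> nat \<Rightarrow> 'f" where
  "content n v z t a =
     (if a \<le> n then (case node_of t a of (r, c, p) \<Rightarrow> v powi (int c - int r))
      else (case node_of t (a - n) of (r, c, p) \<Rightarrow> z ^ p))"

definition content_equiv ::
    "'k::field \<Rightarrow> 'k \<Rightarrow> nat \<Rightarrow> nat \<Rightarrow> (multitableau \<times> multitableau) set" where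
  "content_equiv q \<xi> d n = {(s, t). s \<in> Std d n \<and> t \<in> Std d n \<and>
     (\<forall>a\<in>{1..2 * n}. content n q \<xi> s a = content n q \<xi> t a)}"

definition res ::
    "'k::field \<Rightarrow> 'k \<Rightarrow> nat \<Rightarrow> nat \<Rightarrow> multitableau set \<Rightarrow> (nat \<Rightarrow> int \<times> int)" where
  "res q \<xi> d n T = (THE k. k \<in> weights q d n \<and> (\<forall>t\<in>T. \<forall>a\<in>{1..n}.
     content n q \<xi> t a = q powi fst (k a) \<and> content n q \<xi> t (n + a) = \<xi> powi snd (k a)))"


section \<open>The discrete valuation ring and its residue map\<close>

definition fract_const :: "'k::field \<Rightarrow> 'k poly fract" where
  "fract_const c = Fraction_Field.Fract [:c:] 1"

definition qhat :: "'k::field poly fract" where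
  "qhat = Fraction_Field.Fract [:0, 1:] 1"

definition laurent :: "'k::field poly fract set" where
  "laurent = {Fraction_Field.Fract p 1 / qhat ^ m | p m. True}"

definition laurent_prime :: "'k::field \<Rightarrow> 'k poly fract set" where
  "laurent_prime q = {(qhat - fract_const q) * x | x. x \<in> laurent}"

definition local_ring :: "'k::field \<Rightarrow> 'k poly fract set" where
  "local_ring q = {x / y | x y. x \<in> laurent \<and> y \<in> laurent - laurent_prime q}"

text \<open>
  The residue field is identified with the ground field: the residue of \<open>x\<close> is the unique
  constant congruent to \<open>x\<close> modulo the maximal ideal.
\<close>

definition residue_map :: "'k::field \<Rightarrow> 'k poly fract \<Rightarrow> 'k" where
  "residue_map q x = (THE c. \<exists>y\<in>local_ring q. x - fract_const c = (qhat - fract_const q) * y)"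


section \<open>Class idempotents\<close>

definition generic_content :: "nat \<Rightarrow> 'k::field \<Rightarrow> multitableau \<Rightarrow> nat \<Rightarrow> 'k poly fract" where
  "generic_content n \<xi> t a = content n qhat (fract_const \<xi>) t a"

text \<open>
  \<^const>\<open>finprod\<close> is applied to pairwise commuting factors; for these its defining fold is
  independent of the order although the ambient ring is not commutative.
\<close>

definition generic_idempotent ::
    "'k::field \<Rightarrow> nat \<Rightarrow> nat \<Rightarrow> multitableau \<Rightarrow> (yh_gen list \<Rightarrow>\<^sub>0 'k poly fract) set" where
  "generic_idempotent \<xi> d n t = (let Y = YH UNIV d n qhat in
     finprod Y (\<lambda>a. finprod Y
         (\<lambda>c. yh_scalar UNIV d n qhat (1 / (generic_content n \<xi> t a - c)) \<otimes>\<^bsub>Y\<^esub>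
              (yh_L UNIV d n qhat a \<ominus>\<^bsub>Y\<^esub> yh_scalar UNIV d n qhat c))
         {c. c \<in> (\<lambda>u. generic_content n \<xi> u a) ` Std d n \<and> c \<noteq> generic_content n \<xi> t a})
       {1..2 * n})"

definition generic_class_idempotent ::
    "'k::field \<Rightarrow> nat \<Rightarrow> nat \<Rightarrow> multitableau set \<Rightarrow> (yh_gen list \<Rightarrow>\<^sub>0 'k poly fract) set" where
  "generic_class_idempotent \<xi> d n T = finsum (YH UNIV d n qhat) (generic_idempotent \<xi> d n) T"

text \<open>
  The generic class idempotent is lifted along the canonical (injective) map from the algebra
  over the valuation ring to the one over its fraction field; the lift is then reduced.
\<close>

definition integral_class_idempotent ::
    "'k::field \<Rightarrow> 'k \<Rightarrow> nat \<Rightarrow> nat \<Rightarrow> multitableau set \<Rightarrow> (yh_gen list \<Rightarrow>\<^sub>0 'k poly fract) set" where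
  "integral_class_idempotent q \<xi> d n T =
     (THE x. x \<in> carrier (YH (local_ring q) d n qhat) \<and>
        yh_base_change id UNIV d n qhat x = generic_class_idempotent \<xi> d n T)"

definition class_idempotent ::
    "'k::field \<Rightarrow> 'k \<Rightarrow> nat \<Rightarrow> nat \<Rightarrow> multitableau set \<Rightarrow> (yh_gen list \<Rightarrow>\<^sub>0 'k) set" where
  "class_idempotent q \<xi> d n T =
     yh_base_change (residue_map q) UNIV d n q (integral_class_idempotent q \<xi> d n T)"

end

theory Submission
  imports Defs "HOL-Library.Function_Algebras"
begin

text \<open>
  The idempotents \<open>e(k)\<close> are the only family of orthogonal idempotents with sum 1 such that \<open>e(k)\<close>
  generates the right ideal of simultaneous generalized eigenvectors of weight \<open>k\<close>
  (\<open>idempotent_family_unique\<close>). So it suffices to show that the reduced class idempotents, completed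
  by 0 for the weights that are not residues of a class, form such a family. Over the field of rational
  functions everything follows from one fact: a faithful module is spanned by
  simultaneous eigenvectors of the \<open>L\<^sub>a\<close>, and their systems of eigenvalues are the content vectors of the
  standard multitableaux. Given this, \<open>E\<^sub>t\<close> acts as the projector onto the eigenspace of \<open>t\<close>, and any
  identity between polynomials in the \<open>L\<^sub>a\<close> can be checked on content vectors. An identity with
  coefficients in the valuation ring also holds over that ring, provided its algebra has no torsion, and
  can then be reduced. In this way orthogonality, the sum 1 and the nilpotency of
  \<open>L\<^sub>a - c\<close> on the class idempotent descend to the ground field, where generalized eigenspaces for
  different eigenvalues meet in 0 (\<open>class_family_image\<close>).

  Absence of torsion and the spectral decomposition are both obtained on a tensor space. The algebra
  over each coefficient ring is spanned by normal forms, and these are linearly independent because they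
  act on words with increasing letters by permuting the letters; so the representation is faithful
  (\<open>rep_faithful\<close>). This gives the embedding of the algebra over the valuation ring
  into the one over the fraction field, and allows the decomposition to be proved for the
  vectors of tensor space.

  For the decomposition, the intertwiners between \<open>X\<^sub>b\<close> and \<open>X\<^sub>b\<^sub>+\<^sub>1\<close> show that the set of systems of
  eigenvalues is stable under admissible swaps and avoids two local patterns. By the argument of
  Okounkov and Vershik (\<open>neighbours_between\<close>, \<open>neighbour_before\<close>) each diagonal of such a sequence
  alternates with the next one, and sequences of this kind are the same thing as standard multitableaux
  (\<open>balanced_Std\<close>, \<open>Std_determined_by_letters\<close>). Semisimplicity of \<open>X\<^sub>m\<^sub>+\<^sub>1\<close> follows by induction from that of
  \<open>X\<^sub>m\<close> (\<open>semisimple_Suc\<close>): a Jordan block can be moved to \<open>X\<^sub>m\<close> by an intertwiner, unless the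
  contents are neighbours, where it would yield a Jordan block of the braid generator.

  That the class idempotents have coefficients in the valuation ring is seen by writing them as
  polynomials in one interpolation product whose denominators are units (\<open>integral_lift\<close>).
\<close>

section \<open>The presented algebra over a coefficient ring\<close>

lemma poly_mapping_sum_singles:
  "f = (\<Sum>u\<in>Poly_Mapping.keys f. Poly_Mapping.single u (Poly_Mapping.lookup f u))"
  by (rule poly_mapping_eqI) (auto simp: lookup_sum lookup_single when_def in_keys_iff)

lemma times_sum_singles:
  fixes f g :: "'a::monoid_add \<Rightarrow>\<^sub>0 'r::comm_ring_1"
  shows "f * g = (\<Sum>u\<in>Poly_Mapping.keys f. \<Sum>w\<in>Poly_Mapping.keys g.
           Poly_Mapping.single (u + w) (Poly_Mapping.lookup f u * Poly_Mapping.lookup g w))"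
  by (subst poly_mapping_sum_singles[of f], subst poly_mapping_sum_singles[of g])
     (simp add: sum_distrib_left sum_distrib_right mult_single sum.swap[of _ "Poly_Mapping.keys g"])

lemma const_simps:
  "const 0 = 0" "const 1 = 1" "const (a + b) = const a + const b" "const (a - b) = const a - const b"
  "const (- a) = - const a" "const (a * b) = const a * const b"
  by (simp_all add: const_def single_add single_diff mult_single plus_list_def single_uminus)
     (simp flip: zero_list_def)

lemma const_commute: "const c * f = f * const (c :: 'r::comm_ring_1)"
proof -
  have "const c * f = (\<Sum>u\<in>Poly_Mapping.keys f. const c * Poly_Mapping.single u (Poly_Mapping.lookup f u))"
    by (subst poly_mapping_sum_singles[of f]) (simp add: sum_distrib_left)
  also have "\<dots> = (\<Sum>u\<in>Poly_Mapping.keys f. Poly_Mapping.single u (Poly_Mapping.lookup f u) * const c)"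
    by (simp add: const_def mult_single plus_list_def mult.commute)
  also have "\<dots> = f * const c"
    by (subst (3) poly_mapping_sum_singles[of f]) (simp add: sum_distrib_right)
  finally show ?thesis .
qed

lemma single_Nil: "Poly_Mapping.single [] c = const c"
  by (simp add: const_def)

text \<open>
  The coefficient rings that occur are the ground field, the field of rational functions and the
  valuation ring inside the latter; one set of hypotheses covers all three. Working with a subring of
  a field lets the algebras over the valuation ring and over its fraction field share one free algebra
  and one representation.
\<close>

locale yh_coeffs =
  fixes S :: "'r::field set" and d n :: nat and v \<xi> :: 'r
  assumes S_0: "0 \<in> S" and S_1: "1 \<in> S"
    and S_add: "\<And>a b. a \<in> S \<Longrightarrow> b \<in> S \<Longrightarrow> a + b \<in> S"
    and S_mult: "\<And>a b. a \<in> S \<Longrightarrow> b \<in> S \<Longrightarrow> a * b \<in> S"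
    and S_uminus: "\<And>a. a \<in> S \<Longrightarrow> - a \<in> S"
    and v_S: "v \<in> S" and v_inv_S: "inverse v \<in> S" and v_nz: "v \<noteq> 0"
    and d_pos: "0 < d" and d_nz: "of_nat d \<noteq> (0::'r)" and d_inv_S: "1 / of_nat d \<in> S"
    and xi_S: "\<xi> \<in> S" and xi_prim: "primitive_root_of_unity d \<xi>"
begin

lemma S_diff: "a \<in> S \<Longrightarrow> b \<in> S \<Longrightarrow> a - b \<in> S"
  using S_add[of a "- b"] S_uminus[of b] by simp

lemma S_power: "a \<in> S \<Longrightarrow> a ^ m \<in> S"
  by (induction m) (auto simp: S_1 S_mult)

abbreviation A where "A \<equiv> free_algebra S (yh_gens n)"
abbreviation \<I> where "\<I> \<equiv> yh_ideal S d n v"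
abbreviation Y where "Y \<equiv> YH S d n v"
abbreviation cls where "cls \<equiv> yh_class S d n v"

lemma A_simps [simp]:
  "mult A = (*)" "one A = 1" "zero A = 0" "add A = (+)"
  by (simp_all add: free_algebra_def)

lemma in_A_iff:
  "f \<in> carrier A \<longleftrightarrow>
     Poly_Mapping.keys f \<subseteq> lists (yh_gens n) \<and> (\<forall>w. Poly_Mapping.lookup f w \<in> S)"
  by (simp add: free_algebra_def)

lemma A_single: "w \<in> lists (yh_gens n) \<Longrightarrow> c \<in> S \<Longrightarrow> Poly_Mapping.single w c \<in> carrier A"
  by (auto simp: in_A_iff lookup_single when_def S_0)

lemma A_const [intro, simp]: "c \<in> S \<Longrightarrow> const c \<in> carrier A"
  unfolding const_def by (rule A_single) auto

lemma A_var [intro, simp]: "x \<in> yh_gens n \<Longrightarrow> var x \<in> carrier A"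
  unfolding var_def by (rule A_single) (auto simp: S_1)

lemma A_0 [intro, simp]: "0 \<in> carrier A"
  by (simp add: in_A_iff S_0)

lemma A_1 [intro, simp]: "1 \<in> carrier A"
  using A_const[OF S_1] by (simp add: const_simps)

lemma A_add [intro, simp]: "f \<in> carrier A \<Longrightarrow> g \<in> carrier A \<Longrightarrow> f + g \<in> carrier A"
  using keys_add[of f g] unfolding in_A_iff lookup_add by (blast intro: S_add)

lemma A_uminus [intro, simp]: "f \<in> carrier A \<Longrightarrow> - f \<in> carrier A"
  by (auto simp: in_A_iff S_uminus in_keys_iff subset_iff)

lemma A_diff [intro, simp]: "f \<in> carrier A \<Longrightarrow> g \<in> carrier A \<Longrightarrow> f - g \<in> carrier A"
  using A_add[of f "- g"] by simp

lemma A_sum [intro, simp]: "(\<And>i. i \<in> I \<Longrightarrow> f i \<in> carrier A) \<Longrightarrow> sum f I \<in> carrier A"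
  by (induction I rule: infinite_finite_induct) auto

lemma A_mult [intro, simp]: "f \<in> carrier A \<Longrightarrow> g \<in> carrier A \<Longrightarrow> f * g \<in> carrier A"
  by (subst times_sum_singles, intro A_sum A_single)
     (auto simp: in_A_iff plus_list_def S_mult in_keys_iff subset_iff)

lemma A_power [intro, simp]: "f \<in> carrier A \<Longrightarrow> f ^ m \<in> carrier A"
  by (induction m) auto

lemma A_prod_list [intro, simp]: "(\<And>f. f \<in> set fs \<Longrightarrow> f \<in> carrier A) \<Longrightarrow> prod_list fs \<in> carrier A"
  by (induction fs) auto

text \<open>
  Words are built up on the right because the normal forms below are closed under right
  multiplication by generators.
\<close>

lemma A_induct [consumes 1, case_names zero add const var]:
  assumes "f \<in> carrier A"
    and "P 0" and "\<And>f g. f \<in> carrier A \<Longrightarrow> g \<in> carrier A \<Longrightarrow> P f \<Longrightarrow> P g \<Longrightarrow> P (f + g)"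
    and "\<And>c. c \<in> S \<Longrightarrow> P (const c)"
    and "\<And>x f. x \<in> yh_gens n \<Longrightarrow> f \<in> carrier A \<Longrightarrow> P f \<Longrightarrow> P (f * var x)"
  shows "P f"
proof -
  have single: "P (Poly_Mapping.single w c)" if "w \<in> lists (yh_gens n)" "c \<in> S" for w c
    using that
  proof (induction w rule: rev_induct)
    case Nil
    then show ?case using assms(4) by (simp add: single_Nil)
  next
    case (snoc x w)
    have "Poly_Mapping.single (w @ [x]) c = Poly_Mapping.single w c * var x"
      by (simp add: var_def mult_single plus_list_def)
    then show ?case using snoc assms(5) by (simp add: A_single)
  qed
  have "P (\<Sum>u\<in>U. Poly_Mapping.single u (Poly_Mapping.lookup f u)) \<and>
      (\<Sum>u\<in>U. Poly_Mapping.single u (Poly_Mapping.lookup f u)) \<in> carrier A"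
    if "finite U" "U \<subseteq> Poly_Mapping.keys f" for U
    using that assms(1)
    by (induction U rule: finite_induct)
       (auto simp: assms(2) in_A_iff[of f] simp del: in_lists_conv_set intro!: assms(3) single A_single A_add)
  from this[of "Poly_Mapping.keys f"] show ?thesis
    using poly_mapping_sum_singles[of f] by simp
qed

lemma ring_A: "ring A"
proof (rule ringI)
  show "abelian_group A"
  proof (rule abelian_groupI)
    show "\<exists>y\<in>carrier A. y \<oplus>\<^bsub>A\<^esub> x = \<zero>\<^bsub>A\<^esub>" if "x \<in> carrier A" for x
      using A_uminus[OF that] by (intro bexI[of _ "- x"]) simp_all
  qed (auto simp: add.assoc add.commute)
  show "Group.monoid A"
    by (rule monoidI) (auto simp: mult.assoc)
qed (auto simp: algebra_simps)

sublocale A: ring A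
  by (rule ring_A)

lemma A_minus [simp]: "f \<in> carrier A \<Longrightarrow> g \<in> carrier A \<Longrightarrow> f \<ominus>\<^bsub>A\<^esub> g = f - g"
proof -
  assume "f \<in> carrier A" "g \<in> carrier A"
  then have "\<ominus>\<^bsub>A\<^esub> g = - g"
    by (intro A.minus_equality) auto
  then show ?thesis by (simp add: a_minus_def)
qed

lemma Braid_gens: "Braid b \<in> yh_gens n \<longleftrightarrow> b \<in> {1..<n}"
  and Framing_gens: "Framing a \<in> yh_gens n \<longleftrightarrow> a \<in> {1..n}"
  by (auto simp: yh_gens_def)

lemma A_g [intro, simp]: "b \<in> {1..<n} \<Longrightarrow> free_g b \<in> carrier A"
  and A_t [intro, simp]: "a \<in> {1..n} \<Longrightarrow> free_t a \<in> carrier A"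
  by (simp_all add: Braid_gens Framing_gens)

lemma A_e [intro, simp]: "a \<in> {1..<n} \<Longrightarrow> free_e d a \<in> carrier A"
  unfolding free_e_def using d_inv_S by (intro A_mult A_sum A_power A_const A_t) auto

lemma transpose_range: "a \<in> {1..n} \<Longrightarrow> b \<in> {1..<n} \<Longrightarrow> transpose b (b + 1) a \<in> {1..n}"
  by (auto simp: transpose_def)

lemma yh_rel_A: "yh_rel d n v x y \<Longrightarrow> x \<in> carrier A \<and> y \<in> carrier A"
proof (induction rule: yh_rel.induct)
  case (t_g a b)
  then show ?case using transpose_range[of a b] by auto
next
  case (quadratic a)
  then show ?case by (intro conjI A_power A_add A_mult A_const A_e A_g) (auto simp: v_S S_1 S_diff)
qed auto

sublocale \<I>: ideal \<I> A
  unfolding yh_ideal_def using yh_rel_A by (intro A.genideal_ideal) auto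

sublocale Y: ring Y
  unfolding YH_def by (rule \<I>.quotient_is_ring)

lemma carrier_Y: "carrier Y = cls ` carrier A"
  by (auto simp: YH_def FactRing_def yh_class_def A_RCOSETS_def')

lemma cls_closed [intro, simp]: "f \<in> carrier A \<Longrightarrow> cls f \<in> carrier Y"
  by (auto simp: carrier_Y)

lemma cls_ring_hom: "ring_hom_ring A Y cls"
  using \<I>.rcos_ring_hom_ring by (simp add: YH_def yh_class_def[abs_def])

sublocale cls: ring_hom_ring A Y cls
  by (rule cls_ring_hom)

lemma cls_0: "cls 0 = \<zero>\<^bsub>Y\<^esub>" and cls_1: "cls 1 = \<one>\<^bsub>Y\<^esub>"
  using cls.hom_zero cls.hom_one by simp_all

lemma cls_add: "f \<in> carrier A \<Longrightarrow> g \<in> carrier A \<Longrightarrow> cls (f + g) = cls f \<oplus>\<^bsub>Y\<^esub> cls g"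
  and cls_mult: "f \<in> carrier A \<Longrightarrow> g \<in> carrier A \<Longrightarrow> cls (f * g) = cls f \<otimes>\<^bsub>Y\<^esub> cls g"
  using cls.hom_add[of f g] cls.hom_mult[of f g] by simp_all

lemma cls_diff: "f \<in> carrier A \<Longrightarrow> g \<in> carrier A \<Longrightarrow> cls (f - g) = cls f \<ominus>\<^bsub>Y\<^esub> cls g"
  using cls_add[of f "- g"] cls.hom_a_inv[of g] A.minus_equality[of "- g" g]
  by (simp add: a_minus_def)

lemma cls_power: "f \<in> carrier A \<Longrightarrow> cls (f ^ m) = cls f [^]\<^bsub>Y\<^esub> (m::nat)"
  by (induction m) (simp_all add: cls_1 cls_mult power_Suc2 del: power_Suc)

lemma cls_sum: "finite I \<Longrightarrow> (\<And>i. i \<in> I \<Longrightarrow> f i \<in> carrier A) \<Longrightarrow>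
    cls (sum f I) = finsum Y (\<lambda>i. cls (f i)) I"
  by (induction I rule: finite_induct) (auto simp: cls_0 cls_add Y.finsum_insert)

lemma cls_eq_iff: "f \<in> carrier A \<Longrightarrow> g \<in> carrier A \<Longrightarrow> cls f = cls g \<longleftrightarrow> f - g \<in> \<I>"
  using A.quotient_eq_iff_same_a_r_cos[OF \<I>.ideal_axioms, of f g] by (simp add: yh_class_def)

lemma cls_eqI_rel: "yh_rel d n v f g \<Longrightarrow> cls f = cls g"
proof -
  assume rel: "yh_rel d n v f g"
  have "{x - y |x y. yh_rel d n v x y} \<subseteq> carrier A"
    using yh_rel_A by auto
  from A.genideal_self[OF this] rel have "f - g \<in> \<I>"
    unfolding yh_ideal_def by auto
  then show ?thesis using yh_rel_A[OF rel] by (simp add: cls_eq_iff)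
qed

fun free_X :: "nat \<Rightarrow> (yh_gen list \<Rightarrow>\<^sub>0 'r)" where
  "free_X 0 = 1"
| "free_X (Suc 0) = 1"
| "free_X (Suc (Suc a)) =
     const (inverse v) * free_g (Suc a) * free_X (Suc a) * free_g (Suc a)"

lemma A_X [intro, simp]: "a \<le> n \<Longrightarrow> free_X a \<in> carrier A"
proof (induction a rule: free_X.induct)
  case (3 a)
  then show ?case unfolding free_X.simps by (intro A_mult A_const A_g v_inv_S) auto
qed auto

lemma yh_X_cls: "a \<le> n \<Longrightarrow> yh_X S d n v a = cls (free_X a)"
proof (induction a rule: free_X.induct)
  case (3 a)
  have c: "const (inverse v) \<in> carrier A" "free_g (Suc a) \<in> carrier A" "free_X (Suc a) \<in> carrier A"
    using 3 by (auto simp: v_inv_S)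
  show ?case using 3
    by (simp add: yh_scalar_def yh_g_def cls_mult[OF A_mult[OF A_mult[OF c(1,2)] c(3)] c(2)]
        cls_mult[OF A_mult[OF c(1,2)] c(3)] cls_mult[OF c(1,2)])
qed (simp_all add: cls_1)

definition free_L :: "nat \<Rightarrow> (yh_gen list \<Rightarrow>\<^sub>0 'r)" where
  "free_L a = (if a \<le> n then free_X a else free_t (a - n))"

lemma A_L [intro, simp]: "a \<in> {1..2 * n} \<Longrightarrow> free_L a \<in> carrier A"
  unfolding free_L_def by (cases "a \<le> n") (auto simp del: One_nat_def intro!: A_X A_t)

lemma yh_L_cls: "a \<le> 2 * n \<Longrightarrow> yh_L S d n v a = cls (free_L a)"
  by (auto simp: yh_L_def free_L_def yh_X_cls yh_t_def)

end

section \<open>A representation on tensor space\<close>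

text \<open>
  Tensor space has a basis of words \<open>w\<close> with letters in \<open>nat\<close>; the letter \<open>x\<close> has colour
  \<open>x mod d\<close>, on which \<open>t\<^sub>a\<close> acts by \<open>\<xi>\<^sup>x\<close>. The operators are written on coefficient functions
  \<open>F\<close>, for which all relations become pointwise identities in the field, and words are indexed by all
  of \<open>nat\<close>, so that no index can be out of range.
\<close>

definition swap_letters :: "nat \<Rightarrow> (nat \<Rightarrow> nat) \<Rightarrow> nat \<Rightarrow> nat" where
  "swap_letters b w = w(b := w (Suc b), Suc b := w b)"

definition tensor_t :: "'r::field \<Rightarrow> nat \<Rightarrow> ((nat \<Rightarrow> nat) \<Rightarrow> 'r) \<Rightarrow> (nat \<Rightarrow> nat) \<Rightarrow> 'r" where
  "tensor_t \<xi> a F w = \<xi> ^ w a * F w"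

text \<open>
  On words \<open>g\<^sub>b\<close> sends \<open>\<dots>xy\<dots>\<close> to \<open>\<dots>yx\<dots>\<close> if \<open>x < y\<close>, to \<open>v\<close> times itself if \<open>x = y\<close>, and
  to \<open>v (\<dots>yx\<dots>)\<close> plus, for equal colours, \<open>(v - 1) (\<dots>xy\<dots>)\<close> if \<open>x > y\<close>: the usual action of the
  Hecke algebra, with the correction term present only where \<open>e\<^sub>b\<close> acts as 1. The formula is the
  resulting action on coefficients.
\<close>

definition tensor_g :: "'r::field \<Rightarrow> 'r \<Rightarrow> nat \<Rightarrow> ((nat \<Rightarrow> nat) \<Rightarrow> 'r) \<Rightarrow> (nat \<Rightarrow> nat) \<Rightarrow> 'r" where
  "tensor_g v \<xi> b F w =
     (if w b = w (Suc b) then v * F w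
      else if w b < w (Suc b) then v * F (swap_letters b w)
      else F (swap_letters b w) + (if \<xi> ^ w b = \<xi> ^ w (Suc b) then (v - 1) * F w else 0))"

fun tensor_gen where
  "tensor_gen v \<xi> (Braid b) = tensor_g v \<xi> b"
| "tensor_gen v \<xi> (Framing a) = tensor_t \<xi> a"

definition tensor_word where
  "tensor_word v \<xi> u F = foldr (tensor_gen v \<xi>) u F"

definition tensor_rep ::
    "'r::field \<Rightarrow> 'r \<Rightarrow> (yh_gen list \<Rightarrow>\<^sub>0 'r) \<Rightarrow> ((nat \<Rightarrow> nat) \<Rightarrow> 'r) \<Rightarrow> (nat \<Rightarrow> nat) \<Rightarrow> 'r" where
  "tensor_rep v \<xi> f F w =
     (\<Sum>u\<in>Poly_Mapping.keys f. Poly_Mapping.lookup f u * tensor_word v \<xi> u F w)"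

lemma tensor_gen_linear:
  "tensor_gen v \<xi> x (F + H) = tensor_gen v \<xi> x F + tensor_gen v \<xi> x H"
  "tensor_gen v \<xi> x (\<lambda>w. c * F w) = (\<lambda>w. c * tensor_gen v \<xi> x F w)"
  by (cases x; force simp: tensor_g_def tensor_t_def fun_eq_iff algebra_simps)+

lemma tensor_word_linear:
  "tensor_word v \<xi> u (F + H) = tensor_word v \<xi> u F + tensor_word v \<xi> u H"
  "tensor_word v \<xi> u (\<lambda>w. c * F w) = (\<lambda>w. c * tensor_word v \<xi> u F w)"
  by (induction u) (simp_all add: tensor_word_def tensor_gen_linear)

lemma tensor_word_0: "tensor_word v \<xi> u 0 = 0"
  using tensor_word_linear(2)[of v \<xi> u 0 0] by (simp add: zero_fun_def)

lemma tensor_word_sum: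
  "tensor_word v \<xi> u (\<lambda>w. \<Sum>i\<in>I. F i w) = (\<lambda>w. \<Sum>i\<in>I. tensor_word v \<xi> u (F i) w)"
proof (induction I rule: infinite_finite_induct)
  case (insert i I)
  have "(\<lambda>w. \<Sum>i\<in>insert i I. F i w) = F i + (\<lambda>w. \<Sum>i\<in>I. F i w)"
    using insert by (simp add: fun_eq_iff)
  then show ?case using insert by (simp only: tensor_word_linear(1)) (simp add: fun_eq_iff)
qed (simp_all add: tensor_word_0 flip: zero_fun_def)

lemma tensor_word_append: "tensor_word v \<xi> (u @ u') F = tensor_word v \<xi> u (tensor_word v \<xi> u' F)"
  by (simp add: tensor_word_def)

lemma tensor_rep_superset:
  "finite U \<Longrightarrow> Poly_Mapping.keys f \<subseteq> U \<Longrightarrow>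
     tensor_rep v \<xi> f F w = (\<Sum>u\<in>U. Poly_Mapping.lookup f u * tensor_word v \<xi> u F w)"
  unfolding tensor_rep_def by (rule sum.mono_neutral_left) (auto simp: in_keys_iff)

lemma tensor_rep_add: "tensor_rep v \<xi> (f + g) F = tensor_rep v \<xi> f F + tensor_rep v \<xi> g F"
proof
  fix w
  let ?U = "Poly_Mapping.keys f \<union> Poly_Mapping.keys g"
  show "tensor_rep v \<xi> (f + g) F w = (tensor_rep v \<xi> f F + tensor_rep v \<xi> g F) w"
    using keys_add[of f g]
    by (simp add: tensor_rep_superset[of ?U] lookup_add algebra_simps sum.distrib)
qed

lemma tensor_rep_0: "tensor_rep v \<xi> 0 F = 0"
  by (simp add: tensor_rep_def fun_eq_iff)

lemma tensor_rep_uminus: "tensor_rep v \<xi> (- f) F = - tensor_rep v \<xi> f F"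
  using tensor_rep_add[of v \<xi> f "- f" F] by (simp add: tensor_rep_0 eq_neg_iff_add_eq_0 add.commute)

lemma tensor_rep_diff: "tensor_rep v \<xi> (f - g) F = tensor_rep v \<xi> f F - tensor_rep v \<xi> g F"
  using tensor_rep_add[of v \<xi> f "- g" F] by (simp add: tensor_rep_uminus)

lemma tensor_rep_sum: "tensor_rep v \<xi> (sum f I) F = (\<Sum>i\<in>I. tensor_rep v \<xi> (f i) F)"
  by (induction I rule: infinite_finite_induct) (simp_all add: tensor_rep_0 tensor_rep_add)

lemma tensor_rep_single:
  "tensor_rep v \<xi> (Poly_Mapping.single u c) F = (\<lambda>w. c * tensor_word v \<xi> u F w)"
  by (auto simp: tensor_rep_def fun_eq_iff)

lemma tensor_rep_const: "tensor_rep v \<xi> (const c) F = (\<lambda>w. c * F w)"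
  by (simp add: const_def tensor_rep_single tensor_word_def)

lemma tensor_rep_1: "tensor_rep v \<xi> 1 F = F"
  using tensor_rep_const[of v \<xi> 1 F] by (simp add: const_simps)

lemma tensor_rep_var: "tensor_rep v \<xi> (var x) F = tensor_gen v \<xi> x F"
  by (simp add: var_def tensor_rep_single tensor_word_def)

lemma sum_fun_apply: "(\<Sum>i\<in>I. F i) w = (\<Sum>i\<in>I. F i w)"
  for F :: "'i \<Rightarrow> 'w \<Rightarrow> 'a::comm_monoid_add"
  by (induction I rule: infinite_finite_induct) simp_all

lemma tensor_rep_mult: "tensor_rep v \<xi> (f * g) F = tensor_rep v \<xi> f (tensor_rep v \<xi> g F)"
proof
  fix w
  have "tensor_rep v \<xi> (f * g) F w =
      (\<Sum>u\<in>Poly_Mapping.keys f. \<Sum>u'\<in>Poly_Mapping.keys g. Poly_Mapping.lookup f u *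
         (Poly_Mapping.lookup g u' * tensor_word v \<xi> u (tensor_word v \<xi> u' F) w))"
    by (subst times_sum_singles)
       (simp add: tensor_rep_sum tensor_rep_single sum_fun_apply plus_list_def tensor_word_append
         mult.assoc)
  also have "\<dots> = tensor_rep v \<xi> f (tensor_rep v \<xi> g F) w"
    unfolding tensor_rep_def tensor_word_sum tensor_word_linear sum_distrib_left ..
  finally show "tensor_rep v \<xi> (f * g) F w = tensor_rep v \<xi> f (tensor_rep v \<xi> g F) w" .
qed

lemma tensor_rep_linear:
  "tensor_rep v \<xi> f (F + H) = tensor_rep v \<xi> f F + tensor_rep v \<xi> f H"
  "tensor_rep v \<xi> f (\<lambda>w. c * F w) = (\<lambda>w. c * tensor_rep v \<xi> f F w)"
  by (simp_all add: tensor_rep_def fun_eq_iff tensor_word_linear algebra_simps sum.distrib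
      sum_distrib_left)

lemma tensor_rep_arg_0: "tensor_rep v \<xi> f 0 = 0"
  by (simp add: tensor_rep_def fun_eq_iff tensor_word_0)

text \<open>
  The braid relation involves three adjacent letters only, so it is a statement about
  functions of three arguments, which is settled by comparing these in size.
\<close>

lemma tensor_braid:
  fixes v \<xi> :: "'r::field"
  shows "tensor_g v \<xi> a (tensor_g v \<xi> (Suc a) (tensor_g v \<xi> a F)) =
   tensor_g v \<xi> (Suc a) (tensor_g v \<xi> a (tensor_g v \<xi> (Suc a) F))"
proof
  fix w
  define W where "W x y z = w(a := x, Suc a := y, Suc (Suc a) := z)" for x y z :: nat
  have 1: "tensor_g v \<xi> a H (W x y z) =
      (if x = y then v * H (W x y z) else if x < y then v * H (W y x z)
       else H (W y x z) + (if \<xi> ^ x = \<xi> ^ y then (v - 1) * H (W x y z) else 0))" for H x y z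
    by (simp add: tensor_g_def swap_letters_def W_def fun_upd_twist)
  have 2: "tensor_g v \<xi> (Suc a) H (W x y z) =
      (if y = z then v * H (W x y z) else if y < z then v * H (W x z y)
       else H (W x z y) + (if \<xi> ^ y = \<xi> ^ z then (v - 1) * H (W x y z) else 0))" for H x y z
    by (simp add: tensor_g_def swap_letters_def W_def fun_upd_twist)
  have w: "w = W (w a) (w (Suc a)) (w (Suc (Suc a)))"
    by (simp add: W_def)
  show "tensor_g v \<xi> a (tensor_g v \<xi> (Suc a) (tensor_g v \<xi> a F)) w =
    tensor_g v \<xi> (Suc a) (tensor_g v \<xi> a (tensor_g v \<xi> (Suc a) F)) w"
    apply (subst (1 2) w)
    apply (cases "w a" "w (Suc a)" rule: linorder_cases;
           cases "w (Suc a)" "w (Suc (Suc a))" rule: linorder_cases;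
           cases "w a" "w (Suc (Suc a))" rule: linorder_cases)
    apply (simp_all add: 1 2)
    apply (auto simp: algebra_simps)
    done
qed

lemma tensor_g_commute:
  assumes "Suc a < b"
  shows "tensor_g v \<xi> a (tensor_g v \<xi> b F) = tensor_g v \<xi> b (tensor_g v \<xi> a F)"
proof -
  have swap: "swap_letters a (swap_letters b w) = swap_letters b (swap_letters a w)" for w
    using assms by (auto simp: swap_letters_def fun_eq_iff)
  have other: "swap_letters a w b = w b" "swap_letters a w (Suc b) = w (Suc b)"
    "swap_letters b w a = w a" "swap_letters b w (Suc a) = w (Suc a)" for w
    using assms by (simp_all add: swap_letters_def)
  show ?thesis
    by (rule ext) (simp add: tensor_g_def[of _ _ a] tensor_g_def[of _ _ b] other swap distrib_left mult.left_commute)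
qed

lemma tensor_t_g:
  "tensor_t \<xi> a (tensor_g v \<xi> b F) = tensor_g v \<xi> b (tensor_t \<xi> (transpose b (Suc b) a) F)"
proof
  fix w
  have letter: "swap_letters b w (transpose b (Suc b) a) = w a"
    by (simp add: swap_letters_def transpose_def)
  consider "a = b" | "a = Suc b" | "a \<noteq> b" "a \<noteq> Suc b" by blast
  then have "w b = w (Suc b) \<or> \<xi> ^ w b = \<xi> ^ w (Suc b) \<Longrightarrow> \<xi> ^ w (transpose b (Suc b) a) = \<xi> ^ w a"
    by cases auto
  then show "tensor_t \<xi> a (tensor_g v \<xi> b F) w = tensor_g v \<xi> b (tensor_t \<xi> (transpose b (Suc b) a) F) w"
    by (auto simp: tensor_t_def tensor_g_def letter algebra_simps)
qed

lemma primitive_root_power_inj: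
  assumes "primitive_root_of_unity d \<xi>" "0 < d" "\<xi> ^ i = \<xi> ^ j" "i < d" "j < d"
  shows "i = j"
proof -
  have xi: "\<xi> \<noteq> 0" using assms(1,2) by (auto simp: primitive_root_of_unity_def power_0_left)
  have *: False if "\<xi> ^ i = \<xi> ^ j" "i < j" "j < d" for i j
  proof -
    have "\<xi> ^ (j - i) = 1" using that xi by (simp add: power_diff)
    then show False using assms(1) that by (auto simp: primitive_root_of_unity_def)
  qed
  show ?thesis using *[of i j] *[of j i] assms(3-5) by (metis nat_neq_iff)
qed

lemma root_of_unity_sum:
  fixes z :: "'r::field"
  assumes "z ^ d = 1" "z \<noteq> 1"
  shows "(\<Sum>r<d. z ^ r) = 0"
  using assms geometric_sum[of z d] by simp

context yh_coeffs
begin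

abbreviation rep where "rep \<equiv> tensor_rep v \<xi>"

lemma xi_nz: "\<xi> \<noteq> 0"
  using xi_prim d_pos by (auto simp: primitive_root_of_unity_def power_0_left)

lemma xi_d: "\<xi> ^ d = 1"
  using xi_prim by (simp add: primitive_root_of_unity_def)

lemma xi_power_d: "(\<xi> ^ m) ^ d = 1"
proof -
  have "(\<xi> ^ m) ^ d = (\<xi> ^ d) ^ m"
    by (simp only: mult.commute flip: power_mult)
  then show ?thesis by (simp add: xi_d)
qed

lemma rep_diag_power:
  assumes "\<And>F. rep f F = (\<lambda>w. c w * F w)"
  shows "rep (f ^ m) F = (\<lambda>w. c w ^ m * F w)"
  by (induction m) (simp_all add: assms tensor_rep_1 tensor_rep_mult mult.assoc)

lemma rep_t: "rep (free_t a) F = (\<lambda>w. \<xi> ^ w a * F w)"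
  by (simp add: tensor_rep_var tensor_t_def fun_eq_iff)

lemmas rep_t_power = rep_diag_power[OF rep_t]

text \<open>
  On a word \<open>e\<^sub>a\<close> is the average of the powers of a \<open>d\<close>-th root of unity, which is 1 if the
  two colours agree and 0 otherwise.
\<close>

lemma rep_e: "rep (free_e d a) F = (\<lambda>w. if \<xi> ^ w a = \<xi> ^ w (Suc a) then F w else 0)"
proof
  fix w
  let ?z = "\<xi> ^ w a * (\<xi> ^ w (Suc a)) ^ (d - 1)"
  have y: "\<xi> ^ w (Suc a) * (\<xi> ^ w (Suc a)) ^ (d - 1) = 1"
    using xi_power_d[of "w (Suc a)"] d_pos by (cases d) simp_all
  have zd: "?z ^ d = 1"
  proof -
    have "?z = \<xi> ^ (w a + w (Suc a) * (d - 1))"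
      by (simp only: power_add power_mult)
    then show ?thesis by (simp only: xi_power_d)
  qed
  have z1: "?z = 1 \<longleftrightarrow> \<xi> ^ w a = \<xi> ^ w (Suc a)"
  proof
    assume "?z = 1"
    then have "\<xi> ^ w a * (\<xi> ^ w (Suc a)) ^ (d - 1) = \<xi> ^ w (Suc a) * (\<xi> ^ w (Suc a)) ^ (d - 1)"
      using y by (simp only:)
    then show "\<xi> ^ w a = \<xi> ^ w (Suc a)"
      using xi_nz by simp
  next
    assume "\<xi> ^ w a = \<xi> ^ w (Suc a)"
    then show "?z = 1" using y by (simp only:)
  qed
  have pw: "rep ((free_t (a + 1) ^ (d - 1)) ^ r) F = (\<lambda>w. ((\<xi> ^ w (Suc a)) ^ (d - 1)) ^ r * F w)" for r F
    using rep_diag_power[OF rep_t_power] by simp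
  have "rep (free_e d a) F w = 1 / of_nat d * (\<Sum>r<d. ?z ^ r) * F w"
    unfolding free_e_def
    by (simp add: tensor_rep_mult tensor_rep_const tensor_rep_sum sum_fun_apply pw rep_t_power
        sum_distrib_right power_mult_distrib mult.assoc del: One_nat_def)
  also have "\<dots> = (if \<xi> ^ w a = \<xi> ^ w (Suc a) then F w else 0)"
  proof (cases "?z = 1")
    case True
    then show ?thesis using z1 d_nz by simp
  next
    case False
    then show ?thesis using z1 root_of_unity_sum[OF zd] by simp
  qed
  finally show "rep (free_e d a) F w = (if \<xi> ^ w a = \<xi> ^ w (Suc a) then F w else 0)" .
qed

lemma rep_rel: "yh_rel d n v f g \<Longrightarrow> rep f F = rep g F"
proof (induction rule: yh_rel.induct)
  case (t_order a)
  then show ?case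
    by (simp add: rep_t_power tensor_rep_1 xi_power_d)
next
  case (t_commute a b)
  then show ?case
    by (simp add: tensor_rep_mult tensor_rep_var tensor_t_def fun_eq_iff mult.left_commute)
next
  case (t_g a b)
  then show ?case
    by (simp add: tensor_rep_mult tensor_rep_var tensor_t_g)
next
  case (quadratic a)
  show ?case
    unfolding power2_eq_square
    by (auto simp: tensor_rep_add tensor_rep_mult tensor_rep_const tensor_rep_var rep_e
        fun_eq_iff tensor_g_def swap_letters_def algebra_simps)
next
  case (braid a b)
  then consider "b = Suc a" | "a = Suc b" by fastforce
  then show ?case
    by cases (simp_all add: tensor_rep_mult tensor_rep_var tensor_braid)
next
  case (g_commute a b)
  then consider "Suc a < b" | "Suc b < a" by fastforce
  then show ?case
    by cases (simp_all add: tensor_rep_mult tensor_rep_var tensor_g_commute[of a b] tensor_g_commute[of b a])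
qed

lemma rep_ideal:
  assumes "f \<in> \<I>"
  shows "rep f F = 0"
proof -
  let ?N = "{f \<in> carrier A. \<forall>F. rep f F = 0}"
  have "ideal ?N A"
  proof (rule idealI[OF ring_A])
    show "subgroup ?N (add_monoid A)"
    proof (rule A.add.subgroupI)
      fix f assume "f \<in> ?N"
      moreover from this have "\<ominus>\<^bsub>A\<^esub> f = - f"
        by (intro A.minus_equality) auto
      ultimately show "\<ominus>\<^bsub>A\<^esub> f \<in> ?N"
        by (auto simp: tensor_rep_uminus)
    qed (auto simp: tensor_rep_add tensor_rep_0 intro!: exI[of _ 0])
  qed (auto simp: tensor_rep_mult tensor_rep_arg_0)
  moreover have "{x - y |x y. yh_rel d n v x y} \<subseteq> ?N"
    using yh_rel_A rep_rel by (auto simp: tensor_rep_diff)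
  ultimately have "\<I> \<subseteq> ?N"
    unfolding yh_ideal_def by (rule A.genideal_minimal)
  then show ?thesis using assms by auto
qed

end

section \<open>Faithfulness of the tensor space representation\<close>

context yh_coeffs
begin

text \<open>
  The argument takes place in the free algebra modulo the defining ideal rather than in the quotient
  ring: there associativity is an identity of a type-class ring and needs no membership conditions.
\<close>

definition eqv (infix "\<approx>" 50) where
  "f \<approx> g \<longleftrightarrow> f \<in> carrier A \<and> g \<in> carrier A \<and> cls f = cls g"

lemma eqv_refl [intro, simp]: "f \<in> carrier A \<Longrightarrow> f \<approx> f"
  and eqv_sym: "f \<approx> g \<Longrightarrow> g \<approx> f"
  and eqv_trans [trans]: "f \<approx> g \<Longrightarrow> g \<approx> h \<Longrightarrow> f \<approx> h"
  by (simp_all add: eqv_def)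

lemma eqvD: "f \<approx> g \<Longrightarrow> f \<in> carrier A" "f \<approx> g \<Longrightarrow> g \<in> carrier A"
  by (simp_all add: eqv_def)

lemma eqv_add: "f \<approx> g \<Longrightarrow> f' \<approx> g' \<Longrightarrow> f + f' \<approx> g + g'"
  by (simp add: eqv_def cls_add)

lemma eqv_mult: "f \<approx> g \<Longrightarrow> f' \<approx> g' \<Longrightarrow> f * f' \<approx> g * g'"
  by (simp add: eqv_def cls_mult)

lemma eqv_left: "h \<in> carrier A \<Longrightarrow> f \<approx> g \<Longrightarrow> h * f \<approx> h * g"
  and eqv_right: "h \<in> carrier A \<Longrightarrow> f \<approx> g \<Longrightarrow> f * h \<approx> g * h"
  by (simp_all add: eqv_mult)

lemma eqv_sum: "(\<And>i. i \<in> I \<Longrightarrow> f i \<approx> g i) \<Longrightarrow> sum f I \<approx> sum g I"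
  by (induction I rule: infinite_finite_induct) (auto intro: eqv_add)

lemma eqv_rel: "yh_rel d n v f g \<Longrightarrow> f \<approx> g"
  using yh_rel_A cls_eqI_rel by (auto simp: eqv_def)

lemma eqv_rep: "f \<approx> g \<Longrightarrow> rep f F = rep g F"
  using rep_ideal[of "f - g" F] cls_eq_iff[of f g] by (simp add: eqv_def tensor_rep_diff)

lemma g_t: "a \<in> {1..n} \<Longrightarrow> b \<in> {1..<n} \<Longrightarrow>
    free_g b * free_t a \<approx> free_t (transpose b (b + 1) a) * free_g b"
  using eqv_sym[OF eqv_rel[OF yh_rel.t_g[of "transpose b (b + 1) a" n b d v]]] transpose_range[of a b]
  by simp

lemma t_t: "a \<in> {1..n} \<Longrightarrow> b \<in> {1..n} \<Longrightarrow> free_t a * free_t b \<approx> free_t b * free_t a"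
  by (intro eqv_rel yh_rel.t_commute)

lemma xi_power_S: "\<xi> ^ m \<in> S"
  by (intro S_power xi_S)

text \<open>
  The projector onto the \<open>\<xi>\<^sup>j\<close>-eigenspace of \<open>t\<^sub>a\<close>; the power of \<open>\<xi>\<close> is \<open>\<xi>\<^sup>-\<^sup>j\<close>.
\<close>

definition eps :: "nat \<Rightarrow> nat \<Rightarrow> (yh_gen list \<Rightarrow>\<^sub>0 'r)" where
  "eps a j = const (1 / of_nat d) * (\<Sum>r<d. (const (\<xi> ^ ((d - 1) * j)) * free_t a) ^ r)"

lemma A_eps [intro, simp]: "a \<in> {1..n} \<Longrightarrow> eps a j \<in> carrier A"
  unfolding eps_def by (intro A_mult A_const A_sum A_power A_t d_inv_S xi_power_S)

lemma xi_inv_power: "\<xi> ^ ((d - 1) * j) * \<xi> ^ j = 1"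
proof -
  have "\<xi> ^ ((d - 1) * j) * \<xi> ^ j = (\<xi> ^ j) ^ d"
    using d_pos by (cases d) (simp_all add: mult.commute flip: power_mult power_add)
  then show ?thesis by (simp add: xi_power_d)
qed

lemma power_commuting_mult:
  fixes c t :: "'b::monoid_mult"
  assumes "c * t = t * c" 
  shows "(c * t) ^ m = c ^ m * t ^ m"
proof (induction m)
  case (Suc m)
  have "c ^ m * t = t * c ^ m" using assms by (rule power_commuting_commutes)
  then show ?case using Suc by (metis mult.assoc power_Suc)
qed simp

lemma geometric_shift: "(\<Sum>r<m. x ^ r) * x + 1 = (\<Sum>r<m. x ^ r) + x ^ m" for x :: "'b::ring_1"
  by (induction m) (simp_all add: distrib_right power_commutes)

lemma const_left_commute: "f * (const c * g) = const c * (f * g)" for c :: 'r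
  by (simp only: mult.assoc[symmetric] const_commute[of c f])

lemma const_power: "const c ^ m = const (c ^ m)"
  by (induction m) (simp_all add: const_simps)

lemma const_sum: "(\<Sum>j\<in>J. const (f j)) = const (sum f J)"
  by (induction J rule: infinite_finite_induct) (simp_all add: const_simps)

text \<open>
  With \<open>z = \<xi>\<^sup>-\<^sup>j t\<^sub>a\<close> one has \<open>z\<^sup>d = 1\<close>, so multiplication by \<open>z\<close> permutes the powers of \<open>z\<close> in
  the sum.
\<close>

lemma eps_t:
  assumes a: "a \<in> {1..n}"
  shows "eps a j * free_t a \<approx> const (\<xi> ^ j) * eps a j"
proof -
  let ?c = "\<xi> ^ ((d - 1) * j)"
  let ?z = "const ?c * free_t a"
  have zA: "?z \<in> carrier A" using a by (auto simp: xi_power_S)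
  have "?z ^ d = const (?c ^ d) * free_t a ^ d"
    by (simp only: power_commuting_mult[OF const_commute] const_power)
  then have zd: "?z ^ d \<approx> 1"
    using eqv_rel[OF yh_rel.t_order[OF a, of d v]] by (simp add: xi_power_d const_simps)
  have "(\<Sum>r<d. ?z ^ r) * ?z + 1 = (\<Sum>r<d. ?z ^ r) + ?z ^ d"
    by (rule geometric_shift)
  moreover have "\<dots> \<approx> (\<Sum>r<d. ?z ^ r) + 1"
    by (intro eqv_add eqv_refl A_sum A_power zA zd)
  ultimately have "(\<Sum>r<d. ?z ^ r) * ?z + 1 \<approx> (\<Sum>r<d. ?z ^ r) + 1" by simp
  from eqv_add[OF this eqv_refl[OF A_uminus[OF A_1]]]
  have "(\<Sum>r<d. ?z ^ r) * ?z \<approx> (\<Sum>r<d. ?z ^ r)" by simp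
  from eqv_left[OF A_const[OF d_inv_S] this] have "eps a j * ?z \<approx> eps a j"
    by (simp add: eps_def mult.assoc)
  from eqv_left[OF A_const[OF xi_power_S] this]
  have *: "const (\<xi> ^ j) * (eps a j * ?z) \<approx> const (\<xi> ^ j) * eps a j" .
  have "const (\<xi> ^ j) * (eps a j * ?z) = const (\<xi> ^ j) * const ?c * (eps a j * free_t a)"
    by (simp only: const_left_commute[of "eps a j"] mult.assoc)
  also have "\<dots> = eps a j * free_t a"
    using xi_inv_power[of j]
    by (simp add: const_simps mult.commute[of "\<xi> ^ j"] del: One_nat_def flip: const_simps(6))
  finally show ?thesis using * by simp
qed

lemma commutes_sum: "x \<in> carrier A \<Longrightarrow> (\<And>i. i \<in> I \<Longrightarrow> f i * x \<approx> x * f i) \<Longrightarrow> sum f I * x \<approx> x * sum f I"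
  unfolding sum_distrib_left sum_distrib_right by (rule eqv_sum)

lemma commutes_mult:
  assumes "x \<in> carrier A" "f * x \<approx> x * f" "g * x \<approx> x * g" "f \<in> carrier A" "g \<in> carrier A"
  shows "(f * g) * x \<approx> x * (f * g)"
proof -
  have "(f * g) * x \<approx> f * (x * g)" using assms by (simp add: mult.assoc eqv_left)
  also have "f * (x * g) \<approx> x * (f * g)" using eqv_right[OF assms(5,2)] by (simp add: mult.assoc)
  finally show ?thesis .
qed

lemma commutes_power:
  assumes "x \<in> carrier A" "f * x \<approx> x * f" "f \<in> carrier A"
  shows "f ^ m * x \<approx> x * f ^ m"
  by (induction m) (auto intro: commutes_mult assms)

lemma commutes_const: "x \<in> carrier A \<Longrightarrow> c \<in> S \<Longrightarrow> const c * x \<approx> x * const c"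
  by (simp add: const_commute)

lemma eps_t_commute:
  assumes a: "a \<in> {1..n}" and b: "b \<in> {1..n}"
  shows "eps a j * free_t b \<approx> free_t b * eps a j"
  unfolding eps_def using assms
  by (intro commutes_mult commutes_sum commutes_power commutes_const t_t A_mult A_const A_sum
      A_power A_t d_inv_S xi_power_S)

definition eps_prod :: "(nat \<Rightarrow> nat) \<Rightarrow> nat list \<Rightarrow> (yh_gen list \<Rightarrow>\<^sub>0 'r)" where
  "eps_prod \<gamma> as = prod_list (map (\<lambda>a. eps a (\<gamma> a)) as)"

lemma A_eps_prod [intro, simp]: "set as \<subseteq> {1..n} \<Longrightarrow> eps_prod \<gamma> as \<in> carrier A"
  unfolding eps_prod_def by (intro A_prod_list) auto

lemma eps_prod_t_commute:
  "set as \<subseteq> {1..n} \<Longrightarrow> b \<in> {1..n} \<Longrightarrow> eps_prod \<gamma> as * free_t b \<approx> free_t b * eps_prod \<gamma> as"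
proof (induction as)
  case (Cons a as)
  have "eps a (\<gamma> a) * eps_prod \<gamma> as * free_t b \<approx> free_t b * (eps a (\<gamma> a) * eps_prod \<gamma> as)"
    using Cons by (intro commutes_mult eps_t_commute) auto
  then show ?case by (simp add: eps_prod_def)
qed (simp add: eps_prod_def)

lemma eps_prod_t:
  "set as \<subseteq> {1..n} \<Longrightarrow> b \<in> set as \<Longrightarrow> eps_prod \<gamma> as * free_t b \<approx> const (\<xi> ^ \<gamma> b) * eps_prod \<gamma> as"
proof (induction as)
  case (Cons a as)
  have cA: "const (\<xi> ^ \<gamma> b) \<in> carrier A" by (simp add: xi_power_S)
  have Pr: "eps_prod \<gamma> (a # as) = eps a (\<gamma> a) * eps_prod \<gamma> as"
    by (simp add: eps_prod_def)
  show ?case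
  proof (cases "b \<in> set as")
    case True
    have "eps a (\<gamma> a) * (eps_prod \<gamma> as * free_t b) \<approx> eps a (\<gamma> a) * (const (\<xi> ^ \<gamma> b) * eps_prod \<gamma> as)"
      using Cons True by (intro eqv_left) auto
    also have "eps a (\<gamma> a) * (const (\<xi> ^ \<gamma> b) * eps_prod \<gamma> as) = const (\<xi> ^ \<gamma> b) * eps_prod \<gamma> (a # as)"
      unfolding Pr by (rule const_left_commute)
    finally show ?thesis unfolding Pr by (simp add: mult.assoc)
  next
    case False
    then have ab: "a = b" using Cons by auto
    have "eps b (\<gamma> b) * (eps_prod \<gamma> as * free_t b) \<approx> eps b (\<gamma> b) * (free_t b * eps_prod \<gamma> as)"
      using Cons ab by (intro eqv_left eps_prod_t_commute) auto
    also have "\<dots> = eps b (\<gamma> b) * free_t b * eps_prod \<gamma> as" by (simp add: mult.assoc)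
    also have "\<dots> \<approx> const (\<xi> ^ \<gamma> b) * eps b (\<gamma> b) * eps_prod \<gamma> as"
      using Cons ab by (intro eqv_right eps_t) auto
    finally show ?thesis unfolding Pr using ab by (simp add: mult.assoc)
  qed
qed simp

lemma eps_sum: "(\<Sum>j<d. eps a j) = 1"
proof -
  have zr: "(const (\<xi> ^ ((d - 1) * j)) * free_t a) ^ r = const ((\<xi> ^ ((d - 1) * r)) ^ j) * free_t a ^ r" for j r
  proof -
    have "((d - 1) * j) * r = ((d - 1) * r) * j" by simp
    then show ?thesis
      by (simp only: power_commuting_mult[OF const_commute] const_power flip: power_mult)
  qed
  have sum0: "(\<Sum>j<d. (\<xi> ^ ((d - 1) * r)) ^ j) = (if r = 0 then of_nat d else 0)" if "r < d" for r
  proof (cases "r = 0")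
    case False
    have "\<xi> ^ ((d - 1) * r) \<noteq> 1"
    proof
      assume "\<xi> ^ ((d - 1) * r) = 1"
      then have "\<xi> ^ r = \<xi> ^ 0" using xi_inv_power[of r] by simp
      then show False using primitive_root_power_inj[OF xi_prim d_pos, of r 0] that False d_pos by simp
    qed
    then show ?thesis using root_of_unity_sum[OF xi_power_d] False by simp
  qed simp
  have "(\<Sum>j<d. eps a j) = const (1 / of_nat d) * (\<Sum>r<d. \<Sum>j<d. const ((\<xi> ^ ((d - 1) * r)) ^ j) * free_t a ^ r)"
    unfolding eps_def zr by (subst sum.swap) (simp add: sum_distrib_left)
  also have "\<dots> = const (1 / of_nat d) * (\<Sum>r<d. const (if r = 0 then of_nat d else 0) * free_t a ^ r)"
    by (intro arg_cong2[of _ _ _ _ times] refl sum.cong)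
       (simp add: sum0 const_sum del: One_nat_def flip: sum_distrib_right)
  also have "\<dots> = const (1 / of_nat d) * const (of_nat d)"
    using d_pos by (simp add: if_distrib[of const] const_simps(1) if_distrib[of "\<lambda>x. x * _"] sum.delta cong: if_cong)
  also have "\<dots> = 1" using d_nz by (simp flip: const_simps(2,6))
  finally show ?thesis .
qed

text \<open>
  Since the \<open>eps a j\<close> sum to 1 over \<open>j\<close>, an element vanishes as soon as all its left multiples by
  products of them do. This replaces the framing part of an element by scalars.
\<close>

lemma eqv_0_from_eps_prod:
  assumes "f \<in> carrier A" "set as \<subseteq> {1..n}" "distinct as"
    and "\<And>\<gamma>. (\<And>a. \<gamma> a < d) \<Longrightarrow> eps_prod \<gamma> as * f \<approx> 0"
  shows "f \<approx> 0"
  using assms(2-4)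
proof (induction as)
  case Nil
  then show ?case using d_pos by (auto simp: eps_prod_def dest: Nil(3)[of "\<lambda>_. 0"])
next
  case (Cons a as)
  show ?case
  proof (rule Cons.IH)
    fix \<gamma> :: "nat \<Rightarrow> nat" assume \<gamma>: "\<And>a. \<gamma> a < d"
    have "eps a j * (eps_prod \<gamma> as * f) \<approx> 0" if "j < d" for j
    proof -
      have "eps_prod (\<gamma>(a := j)) as = eps_prod \<gamma> as"
        unfolding eps_prod_def using Cons.prems(2) by (intro arg_cong[of _ _ prod_list] map_cong) auto
      moreover have "eps_prod (\<gamma>(a := j)) (a # as) * f \<approx> 0"
        using \<gamma> that by (intro Cons.prems(3)) auto
      ultimately show ?thesis by (simp add: eps_prod_def mult.assoc)
    qed
    then have "(\<Sum>j<d. eps a j * (eps_prod \<gamma> as * f)) \<approx> (\<Sum>j<d. 0)"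
      by (intro eqv_sum) auto
    then show "eps_prod \<gamma> as * f \<approx> 0"
      by (simp add: eps_sum flip: sum_distrib_right)
  qed (use Cons.prems in auto)
qed

text \<open>
  \<open>chain m i\<close> is \<open>g\<^sub>m g\<^sub>m\<^sub>-\<^sub>1 \<dots> g\<^sub>i\<close>, with \<open>chain m (m + 1) = 1\<close>: the shortest representatives of
  the right cosets of \<open>S\<^sub>m\<close> in \<open>S\<^sub>m\<^sub>+\<^sub>1\<close>. Multiplying through all \<open>m\<close> gives every
  permutation once, without any appeal to reduced words.
\<close>

definition chain :: "nat \<Rightarrow> nat \<Rightarrow> (yh_gen list \<Rightarrow>\<^sub>0 'r)" where
  "chain m i = prod_list (map free_g (rev [i..<Suc m]))"

lemma chain_Suc_self: "chain m (Suc m) = 1"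
  by (simp add: chain_def)

lemma chain_split: "i \<le> Suc j \<Longrightarrow> j \<le> m \<Longrightarrow> chain m i = chain m (Suc j) * chain j i"
proof -
  assume "i \<le> Suc j" "j \<le> m"
  then have "[i..<Suc m] = [i..<Suc j] @ [Suc j..<Suc m]"
    by (metis Suc_le_mono le_add_diff_inverse upt_add_eq_append)
  then show ?thesis by (simp only: chain_def rev_append map_append prod_list.append)
qed

lemma chain_self: "chain i i = free_g i"
  by (simp add: chain_def)

lemma chain_Suc: "i \<le> m \<Longrightarrow> chain m i = chain m (Suc i) * free_g i"
  using chain_split[of i i m] by (simp add: chain_self)

lemma A_chain [intro, simp]: "1 \<le> i \<Longrightarrow> m < n \<Longrightarrow> chain m i \<in> carrier A"
  unfolding chain_def by (intro A_prod_list) auto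

lemma chain_t:
  assumes "1 \<le> i" "i \<le> Suc m" "m < n" "a \<in> {1..n}"
  shows "\<exists>a'\<in>{1..n}. chain m i * free_t a \<approx> free_t a' * chain m i"
  using assms(2,1,3,4)
proof (induction i arbitrary: a rule: inc_induct)
  case base
  then show ?case by (auto simp: chain_Suc_self intro!: bexI[of _ a])
next
  case (step i)
  then have i: "i \<in> {1..<n}" by auto
  let ?b = "transpose i (i + 1) a"
  have b: "?b \<in> {1..n}" using transpose_range[of a i] i step by auto
  then obtain a' where a': "a' \<in> {1..n}" "chain m (Suc i) * free_t ?b \<approx> free_t a' * chain m (Suc i)"
    using step.IH[of ?b] step.prems by fastforce
  have "chain m (Suc i) * (free_g i * free_t a) \<approx> chain m (Suc i) * (free_t ?b * free_g i)"
    using step i by (intro eqv_left g_t) auto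
  also have "\<dots> = (chain m (Suc i) * free_t ?b) * free_g i" by (simp add: mult.assoc)
  also have "\<dots> \<approx> (free_t a' * chain m (Suc i)) * free_g i"
    using a' i by (intro eqv_right) auto
  finally show ?case using a' step by (auto simp: chain_Suc mult.assoc)
qed

lemma g_g_commute: "a \<in> {1..<n} \<Longrightarrow> b \<in> {1..<n} \<Longrightarrow> Suc a < b \<or> Suc b < a \<Longrightarrow>
    free_g a * free_g b \<approx> free_g b * free_g a"
  by (intro eqv_rel yh_rel.g_commute) auto

lemma chain_g_commute:
  assumes "j \<in> {1..<n}" "1 \<le> i" "m < n" "\<forall>b\<in>{i..m}. Suc b < j \<or> Suc j < b"
  shows "chain m i * free_g j \<approx> free_g j * chain m i"
proof -
  have "prod_list (map free_g xs) * free_g j \<approx> free_g j * prod_list (map free_g xs)"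
    if "set xs \<subseteq> {i..m}" for xs
    using that
  proof (induction xs)
    case (Cons b xs)
    have "free_g b * prod_list (map free_g xs) * free_g j \<approx> free_g j * (free_g b * prod_list (map free_g xs))"
      using Cons assms by (intro commutes_mult g_g_commute A_prod_list) auto
    then show ?case by simp
  qed (use assms in simp)
  from this[of "rev [i..<Suc m]"] show ?thesis
    unfolding chain_def by (simp add: atLeastLessThanSuc_atLeastAtMost del: upt_Suc)
qed

lemma chain_g_shift:
  assumes "1 \<le> i" "i < j" "j \<le> m" "m < n"
  shows "chain m i * free_g j \<approx> free_g (j - 1) * chain m i"
proof -
  define k where "k = j - 1"
  have j: "j = Suc k" "i \<le> k" "1 \<le> k" using assms by (auto simp: k_def)
  let ?u = "chain m (Suc j)" and ?w = "chain (k - 1) i"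
  have w: "?w \<in> carrier A" using assms j by auto
  have u: "?u \<in> carrier A" using assms by auto
  have gj: "free_g j \<in> carrier A" "free_g k \<in> carrier A" using assms j by auto
  have "chain k i = free_g k * ?w"
    using chain_split[of i "k - 1" k] j by (simp add: chain_self)
  then have ch: "chain m i = ?u * free_g j * free_g k * ?w"
    using chain_split[of i j m] chain_split[of i k j] assms j by (simp add: chain_self mult.assoc)
  have "?u * free_g j * free_g k * (?w * free_g j) \<approx> ?u * free_g j * free_g k * (free_g j * ?w)"
    using assms j u gj by (intro eqv_left chain_g_commute) auto
  also have "\<dots> = ?u * (free_g j * free_g k * free_g j) * ?w" by (simp add: mult.assoc)
  also have "\<dots> \<approx> ?u * (free_g k * free_g j * free_g k) * ?w"
    using assms j u w by (intro eqv_left eqv_right eqv_rel yh_rel.braid) auto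
  also have "\<dots> = (?u * free_g k) * (free_g j * free_g k * ?w)" by (simp add: mult.assoc)
  also have "\<dots> \<approx> (free_g k * ?u) * (free_g j * free_g k * ?w)"
    using assms j u w gj by (intro eqv_right chain_g_commute A_mult) auto
  finally show ?thesis unfolding ch by (simp add: k_def mult.assoc)
qed

definition eps_all :: "(nat \<Rightarrow> nat) \<Rightarrow> (yh_gen list \<Rightarrow>\<^sub>0 'r)" where
  "eps_all \<gamma> = eps_prod \<gamma> [1..<Suc n]"

lemma A_eps_all [intro, simp]: "eps_all \<gamma> \<in> carrier A"
  unfolding eps_all_def by (rule A_eps_prod) auto

lemma eps_all_t: "a \<in> {1..n} \<Longrightarrow> eps_all \<gamma> * free_t a \<approx> const (\<xi> ^ \<gamma> a) * eps_all \<gamma>"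
  unfolding eps_all_def by (rule eps_prod_t) auto

text \<open>
  For a fixed colouring \<open>\<gamma>\<close>, the combinations of \<open>1\<^sub>\<gamma> g\<^sub>w\<close> with \<open>w \<in> S\<^sub>m\<close>, modulo the ideal, where
  \<open>1\<^sub>\<gamma>\<close> is \<open>eps_all \<gamma>\<close>.
\<close>

fun normal_forms :: "(nat \<Rightarrow> nat) \<Rightarrow> nat \<Rightarrow> (yh_gen list \<Rightarrow>\<^sub>0 'r) set" where
  "normal_forms \<gamma> 0 = {f. \<exists>c\<in>S. f \<approx> const c * eps_all \<gamma>}"
| "normal_forms \<gamma> (Suc m) =
     {f. \<exists>p. (\<forall>i\<in>{1..Suc m}. p i \<in> normal_forms \<gamma> m) \<and> f \<approx> (\<Sum>i\<in>{1..Suc m}. p i * chain m i)}"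

lemma nf_A: "f \<in> normal_forms \<gamma> m \<Longrightarrow> f \<in> carrier A"
  by (cases m) (auto dest: eqvD)

lemma nf_eqv: "g \<in> normal_forms \<gamma> m \<Longrightarrow> f \<approx> g \<Longrightarrow> f \<in> normal_forms \<gamma> m"
  by (cases m) (auto intro: eqv_trans simp del: sum.cl_ivl_Suc)

lemma nf_add: "f \<in> normal_forms \<gamma> m \<Longrightarrow> g \<in> normal_forms \<gamma> m \<Longrightarrow> f + g \<in> normal_forms \<gamma> m"
proof (induction m arbitrary: f g)
  case 0
  then obtain c c' where "c \<in> S" "c' \<in> S" "f \<approx> const c * eps_all \<gamma>"
    "g \<approx> const c' * eps_all \<gamma>" by auto
  then show ?case using eqv_add
    by (auto intro!: bexI[of _ "c + c'"] S_add simp: const_simps distrib_right)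
next
  case (Suc m)
  then obtain p p' where "\<forall>i\<in>{1..Suc m}. p i \<in> normal_forms \<gamma> m" "\<forall>i\<in>{1..Suc m}. p' i \<in> normal_forms \<gamma> m"
    "f \<approx> (\<Sum>i\<in>{1..Suc m}. p i * chain m i)" "g \<approx> (\<Sum>i\<in>{1..Suc m}. p' i * chain m i)" by auto
  with Suc.IH eqv_add[OF this(3,4)] show ?case
    by (auto intro!: exI[of _ "\<lambda>i. p i + p' i"] simp: distrib_right sum.distrib simp del: sum.cl_ivl_Suc)
qed

lemma nf_0: "m \<le> n \<Longrightarrow> 0 \<in> normal_forms \<gamma> m"
proof (induction m)
  case 0
  then show ?case by (auto intro!: bexI[of _ 0] simp: S_0 const_simps)
next
  case (Suc m)
  then show ?case by (auto intro!: exI[of _ "\<lambda>_. 0"])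
qed

lemma nf_const: "c \<in> S \<Longrightarrow> f \<in> normal_forms \<gamma> m \<Longrightarrow> const c * f \<in> normal_forms \<gamma> m"
proof (induction m arbitrary: f)
  case 0
  then obtain c' where c': "c' \<in> S" "f \<approx> const c' * eps_all \<gamma>" by auto
  from eqv_left[OF A_const[OF 0(1)] this(2)]
  have "const c * f \<approx> const (c * c') * eps_all \<gamma>"
    by (simp add: const_simps mult.assoc)
  with c' 0(1) show ?case by (auto intro: S_mult)
next
  case (Suc m)
  then obtain p where p: "\<forall>i\<in>{1..Suc m}. p i \<in> normal_forms \<gamma> m" 
    "f \<approx> (\<Sum>i\<in>{1..Suc m}. p i * chain m i)" by auto
  from eqv_left[OF A_const[OF Suc.prems(1)] this(2)]
  have "const c * f \<approx> (\<Sum>i\<in>{1..Suc m}. (const c * p i) * chain m i)"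
    by (simp add: sum_distrib_left mult.assoc del: sum.cl_ivl_Suc)
  with p(1) Suc.IH Suc.prems(1) show ?case
    by (auto intro!: exI[of _ "\<lambda>i. const c * p i"] simp del: sum.cl_ivl_Suc)
qed

lemma nf_sum: "m \<le> n \<Longrightarrow> (\<And>i. i \<in> I \<Longrightarrow> f i \<in> normal_forms \<gamma> m) \<Longrightarrow> sum f I \<in> normal_forms \<gamma> m"
  by (induction I rule: infinite_finite_induct) (auto intro: nf_add nf_0)

lemma nf_chain:
  assumes "p \<in> normal_forms \<gamma> m" "i \<in> {1..Suc m}" "m < n"
  shows "p * chain m i \<in> normal_forms \<gamma> (Suc m)"
proof -
  have "(\<Sum>j\<in>{1..Suc m}. (if j = i then p else 0) * chain m j) =
      (\<Sum>j\<in>{1..Suc m}. if j = i then p * chain m j else 0)"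
    by (rule sum.cong) auto
  also have "\<dots> = p * chain m i" using assms by (subst sum.delta) auto
  finally have "p * chain m i \<approx> (\<Sum>j\<in>{1..Suc m}. (if j = i then p else 0) * chain m j)"
    using assms nf_A[OF assms(1)] by auto
  then show ?thesis using assms nf_0[of m]
    by (auto intro!: exI[of _ "\<lambda>j. if j = i then p else 0"] simp del: sum.cl_ivl_Suc)
qed

lemma nf_t: "m \<le> n \<Longrightarrow> p \<in> normal_forms \<gamma> m \<Longrightarrow> a \<in> {1..n} \<Longrightarrow> p * free_t a \<in> normal_forms \<gamma> m"
proof (induction m arbitrary: p a)
  case 0
  then obtain c where c: "c \<in> S" "p \<approx> const c * eps_all \<gamma>" by auto
  have "p * free_t a \<approx> const c * eps_all \<gamma> * free_t a"
    using c 0 by (intro eqv_right) auto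
  also have "\<dots> = const c * (eps_all \<gamma> * free_t a)" by (simp add: mult.assoc)
  also have "\<dots> \<approx> const c * (const (\<xi> ^ \<gamma> a) * eps_all \<gamma>)"
    using c 0 by (intro eqv_left eps_all_t) auto
  also have "\<dots> = const (c * \<xi> ^ \<gamma> a) * eps_all \<gamma>"
    by (simp add: const_simps mult.assoc)
  finally show ?case using c S_mult[OF c(1) xi_power_S] by auto
next
  case (Suc m)
  then obtain p' where p': "\<forall>i\<in>{1..Suc m}. p' i \<in> normal_forms \<gamma> m" 
    "p \<approx> (\<Sum>i\<in>{1..Suc m}. p' i * chain m i)" by auto
  have "p' i * chain m i * free_t a \<in> normal_forms \<gamma> (Suc m)" if i: "i \<in> {1..Suc m}" for i
  proof -
    obtain a' where a': "a' \<in> {1..n}" "chain m i * free_t a \<approx> free_t a' * chain m i"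
      using chain_t[of i m a] Suc.prems i by auto
    have "p' i * (chain m i * free_t a) \<approx> p' i * (free_t a' * chain m i)"
      using p' i a' nf_A by (intro eqv_left) blast+
    moreover have "p' i * free_t a' * chain m i \<in> normal_forms \<gamma> (Suc m)"
      using Suc p' i a' by (intro nf_chain Suc.IH) auto
    ultimately show ?thesis unfolding mult.assoc[symmetric] by (rule nf_eqv[rotated])
  qed
  then have "(\<Sum>i\<in>{1..Suc m}. p' i * chain m i * free_t a) \<in> normal_forms \<gamma> (Suc m)"
    using Suc.prems by (intro nf_sum) auto
  moreover have "p * free_t a \<approx> (\<Sum>i\<in>{1..Suc m}. p' i * chain m i * free_t a)"
    using eqv_right[OF A_t[OF Suc.prems(3)] p'(2)] by (simp only: sum_distrib_right)
  ultimately show ?case by (rule nf_eqv)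
qed

text \<open>
  Framing generators can be moved across a chain, hence so can the idempotents that occur in
  the quadratic relation.
\<close>

lemma nf_chain_e:
  assumes m: "m < n" and i: "i \<in> {1..Suc m}" and p: "p \<in> normal_forms \<gamma> m" and a: "a \<in> {1..<n}"
  shows "\<exists>p'\<in>normal_forms \<gamma> m. p * chain m i * free_e d a \<approx> p' * chain m i"
proof -
  define M where "M = {f \<in> carrier A. \<forall>p\<in>normal_forms \<gamma> m. \<exists>p'\<in>normal_forms \<gamma> m. p * chain m i * f \<approx> p' * chain m i}"
  have ch: "chain m i \<in> carrier A" using i m by auto
  have t: "free_t b \<in> M" if b: "b \<in> {1..n}" for b
  proof -
    obtain a' where a': "a' \<in> {1..n}" "chain m i * free_t b \<approx> free_t a' * chain m i"
      using chain_t[of i m b] i m b by auto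
    have "p * chain m i * free_t b \<approx> p * free_t a' * chain m i" if "p \<in> normal_forms \<gamma> m" for p
      using eqv_left[OF nf_A[OF that] a'(2)] by (simp add: mult.assoc)
    then show ?thesis unfolding M_def using nf_t m a' b by fastforce
  qed
  have one: "1 \<in> M" unfolding M_def using ch nf_A by fastforce
  have mult: "f * g \<in> M" if f: "f \<in> M" and g: "g \<in> M" for f g
  proof -
    have "\<exists>p'\<in>normal_forms \<gamma> m. p * chain m i * (f * g) \<approx> p' * chain m i" if p: "p \<in> normal_forms \<gamma> m" for p
    proof -
      obtain p1 where p1: "p1 \<in> normal_forms \<gamma> m" "p * chain m i * f \<approx> p1 * chain m i"
        using f p by (auto simp: M_def)
      obtain p2 where p2: "p2 \<in> normal_forms \<gamma> m" "p1 * chain m i * g \<approx> p2 * chain m i"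
        using g p1 by (auto simp: M_def)
      have "p * chain m i * (f * g) = p * chain m i * f * g" by (simp add: mult.assoc)
      also have "\<dots> \<approx> p1 * chain m i * g" using g by (intro eqv_right p1) (auto simp: M_def)
      also note p2(2)
      finally show ?thesis using p2(1) by auto
    qed
    then show ?thesis using f g by (auto simp: M_def)
  qed
  have power: "f ^ r \<in> M" if "f \<in> M" for f r
    by (induction r) (auto simp: one mult that)
  have add: "f + g \<in> M" if f: "f \<in> M" and g: "g \<in> M" for f g
  proof -
    have "\<exists>p'\<in>normal_forms \<gamma> m. p * chain m i * (f + g) \<approx> p' * chain m i" if p: "p \<in> normal_forms \<gamma> m" for p
    proof -
      obtain p1 where p1: "p1 \<in> normal_forms \<gamma> m" "p * chain m i * f \<approx> p1 * chain m i"
        using f p by (auto simp: M_def)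
      obtain p2 where p2: "p2 \<in> normal_forms \<gamma> m" "p * chain m i * g \<approx> p2 * chain m i"
        using g p by (auto simp: M_def)
      have "p * chain m i * (f + g) \<approx> (p1 + p2) * chain m i"
        using eqv_add[OF p1(2) p2(2)] by (simp add: distrib_left distrib_right)
      then show ?thesis using nf_add p1 p2 by blast
    qed
    then show ?thesis using f g by (auto simp: M_def)
  qed
  have zero: "0 \<in> M" unfolding M_def using nf_0 m by (auto intro!: bexI[of _ 0])
  have sum: "sum f R \<in> M" if "\<And>r. r \<in> R \<Longrightarrow> f r \<in> M" for f and R :: "nat set"
    using that by (induction R rule: infinite_finite_induct) (auto simp: zero add)
  have const: "const c \<in> M" if c: "c \<in> S" for c
  proof -
    have "p * chain m i * const c = (const c * p) * chain m i" for p
      by (simp add: const_commute[of c] mult.assoc)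
    then show ?thesis using c nf_const ch nf_A by (auto simp: M_def intro!: bexI[of _ "const c * _"])
  qed
  have "free_e d a \<in> M"
    unfolding free_e_def using a by (intro mult const sum power t d_inv_S) auto
  then show ?thesis using p by (auto simp: M_def)
qed

text \<open>
  A generator meeting \<open>chain m i\<close> from the right lengthens it, shortens it by the quadratic relation,
  passes through it with its index lowered by a braid relation, or commutes with it.
\<close>

lemma nf_chain_g:
  assumes m: "m < n" and i: "i \<in> {1..Suc m}" and p: "p \<in> normal_forms \<gamma> m" and j: "j \<in> {1..m}"
    and IH: "\<And>p j. p \<in> normal_forms \<gamma> m \<Longrightarrow> j \<in> {1..<m} \<Longrightarrow> p * free_g j \<in> normal_forms \<gamma> m"
  shows "p * chain m i * free_g j \<in> normal_forms \<gamma> (Suc m)"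
proof -
  have pA: "p \<in> carrier A" using p by (rule nf_A)
  consider "i = Suc j" | "i = j" | "i < j" | "Suc j < i" by linarith
  then show ?thesis
  proof cases
    case 1
    then have "p * chain m i * free_g j = p * chain m j"
      using j by (simp add: chain_Suc mult.assoc)
    then show ?thesis using nf_chain[OF p _ m, of j] j by simp
  next
    case 2
    have q: "free_g j * free_g j \<approx> const v + const (v - 1) * free_e d j * free_g j"
      using eqv_rel[OF yh_rel.quadratic[of j n d v]] j m by (simp add: power2_eq_square)
    have cA: "chain m (Suc j) \<in> carrier A" using m by auto
    have jn: "j \<in> {1..<n}" using j m by auto
    obtain p' where p': "p' \<in> normal_forms \<gamma> m" "p * chain m (Suc j) * free_e d j \<approx> p' * chain m (Suc j)"
      using nf_chain_e[OF m _ p jn, of "Suc j"] j by auto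
    have "p * chain m i * free_g j = p * chain m (Suc j) * (free_g j * free_g j)"
      using 2 j by (simp add: chain_Suc mult.assoc)
    also have "\<dots> \<approx> p * chain m (Suc j) * (const v + const (v - 1) * free_e d j * free_g j)"
      by (intro eqv_left q A_mult pA cA)
    also have "\<dots> = const v * (p * chain m (Suc j)) + const (v - 1) * (p * chain m (Suc j) * free_e d j * free_g j)"
    proof -
      have "p * chain m (Suc j) * const v = const v * (p * chain m (Suc j))"
        by (simp add: const_commute)
      moreover have "p * chain m (Suc j) * (const (v - 1) * free_e d j * free_g j) =
          const (v - 1) * (p * chain m (Suc j) * free_e d j * free_g j)"
        by (simp only: const_left_commute[of "p * chain m (Suc j)"] mult.assoc[of "const (v - 1)"])
          (simp only: mult.assoc)
      ultimately show ?thesis by (simp add: distrib_left)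
    qed
    also have "\<dots> \<approx> const v * (p * chain m (Suc j)) + const (v - 1) * (p' * chain m (Suc j) * free_g j)"
      by (rule eqv_add[OF eqv_refl eqv_left[OF _ eqv_right[OF _ p'(2)]]])
        (use pA cA jn v_S S_diff S_1 in auto)
    finally have eq: "p * chain m i * free_g j \<approx>
      const v * (p * chain m (Suc j)) + const (v - 1) * (p' * chain m j)"
      using j by (simp add: chain_Suc[of j m] mult.assoc)
    show ?thesis
      using j m by (intro nf_eqv[OF _ eq] nf_add nf_const nf_chain p p' v_S S_diff S_1) auto
  next
    case 3
    have "p * (chain m i * free_g j) \<approx> p * (free_g (j - 1) * chain m i)"
      using 3 i j m by (intro eqv_left chain_g_shift pA) auto
    moreover have "p * free_g (j - 1) * chain m i \<in> normal_forms \<gamma> (Suc m)"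
      using 3 i j m by (intro nf_chain IH p) auto
    ultimately show ?thesis unfolding mult.assoc[symmetric] by (rule nf_eqv[rotated])
  next
    case 4
    have "p * (chain m i * free_g j) \<approx> p * (free_g j * chain m i)"
      using 4 i j m by (intro eqv_left chain_g_commute pA) auto
    moreover have "p * free_g j * chain m i \<in> normal_forms \<gamma> (Suc m)"
      using 4 i j m by (intro nf_chain IH p) auto
    ultimately show ?thesis unfolding mult.assoc[symmetric] by (rule nf_eqv[rotated])
  qed
qed

lemma nf_g: "m \<le> n \<Longrightarrow> p \<in> normal_forms \<gamma> m \<Longrightarrow> j \<in> {1..<m} \<Longrightarrow> p * free_g j \<in> normal_forms \<gamma> m"
proof (induction m arbitrary: p j)
  case (Suc m)
  then obtain p' where p': "\<forall>i\<in>{1..Suc m}. p' i \<in> normal_forms \<gamma> m" 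
    "p \<approx> (\<Sum>i\<in>{1..Suc m}. p' i * chain m i)" by auto
  have "(\<Sum>i\<in>{1..Suc m}. p' i * chain m i * free_g j) \<in> normal_forms \<gamma> (Suc m)"
    using Suc p' by (intro nf_sum nf_chain_g) auto
  moreover have "p * free_g j \<approx> (\<Sum>i\<in>{1..Suc m}. p' i * chain m i * free_g j)"
    using eqv_right[OF A_g p'(2), of j] Suc.prems by (simp only: sum_distrib_right) auto
  ultimately show ?case by (rule nf_eqv)
qed simp

lemma nf_all:
  assumes "f \<in> carrier A"
  shows "eps_all \<gamma> * f \<in> normal_forms \<gamma> n"
proof -
  let ?e = "eps_all \<gamma>"
  have base: "const c * ?e \<in> normal_forms \<gamma> m" if "c \<in> S" "m \<le> n" for c m
    using that(2)
  proof (induction m)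
    case 0
    then show ?case using that by auto
  next
    case (Suc m)
    then show ?case using nf_chain[of "const c * ?e" \<gamma> m "Suc m"] by (simp add: chain_Suc_self)
  qed
  show ?thesis using assms
  proof (induction rule: A_induct)
    case zero
    then show ?case by (simp add: nf_0)
  next
    case (add f g)
    then show ?case by (simp add: distrib_left nf_add)
  next
    case (const c)
    then show ?case using base[of c n] by (simp add: const_commute)
  next
    case (var x f)
    then show ?case
      by (cases x) (auto simp: Braid_gens Framing_gens nf_g nf_t mult.assoc[symmetric])
  qed
qed


text \<open>
  Evaluation at the base word: its letters increase, so a chain acts on it without
  correction terms, and distinct chains put the largest letter in distinct positions.
\<close>

definition base_word :: "(nat \<Rightarrow> nat) \<Rightarrow> nat \<Rightarrow> nat" where
  "base_word \<gamma> a = a * d + \<gamma> a"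

definition move_down :: "nat \<Rightarrow> nat \<Rightarrow> (nat \<Rightarrow> nat) \<Rightarrow> nat \<Rightarrow> nat" where
  "move_down m i y = (\<lambda>a. if a = i then y (Suc m) else if i < a \<and> a \<le> Suc m then y (a - 1) else y a)"

definition move_up :: "nat \<Rightarrow> nat \<Rightarrow> (nat \<Rightarrow> nat) \<Rightarrow> nat \<Rightarrow> nat" where
  "move_up m i z = (\<lambda>a. if a = Suc m then z i else if i \<le> a \<and> a \<le> m then z (Suc a) else z a)"

lemma move_up_down: "i \<le> Suc m \<Longrightarrow> move_up m i (move_down m i y) = y"
  by (auto simp: move_up_def move_down_def fun_eq_iff)

lemma rep_eps: 
  "rep (eps a j) F w = (if \<xi> ^ w a = \<xi> ^ j then F w else 0)"
proof -
  let ?c = "\<xi> ^ ((d - 1) * j)"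
  let ?z = "?c * \<xi> ^ w a"
  have "rep (const ?c * free_t a) F = (\<lambda>w. (?c * \<xi> ^ w a) * F w)" for F
    by (simp add: tensor_rep_mult tensor_rep_const rep_t mult.assoc)
  note pw = rep_diag_power[OF this]
  have "rep (eps a j) F w = 1 / of_nat d * (\<Sum>r<d. ?z ^ r) * F w"
    unfolding eps_def
    by (simp add: tensor_rep_mult[of _ _ "const (1 / of_nat d)"] tensor_rep_const tensor_rep_sum
        sum_fun_apply pw sum_distrib_right del: One_nat_def)
  moreover have "?z ^ d = 1"
    by (simp add: power_mult_distrib xi_power_d del: One_nat_def)
  moreover have "?z = 1 \<longleftrightarrow> \<xi> ^ w a = \<xi> ^ j"
  proof -
    have "?c \<noteq> 0" using xi_nz by simp
    then have "?z = 1 \<longleftrightarrow> ?c * \<xi> ^ w a = ?c * \<xi> ^ j" by (simp only: xi_inv_power)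
    also have "\<dots> \<longleftrightarrow> \<xi> ^ w a = \<xi> ^ j" using \<open>?c \<noteq> 0\<close> by (simp only: mult_cancel_left) simp
    finally show ?thesis .
  qed
  ultimately show ?thesis
    using root_of_unity_sum[of ?z d] d_nz by (cases "?z = 1") (simp_all del: One_nat_def)
qed

lemma rep_eps_prod:
  "rep (eps_prod \<gamma> as) F w = (if \<forall>a\<in>set as. \<xi> ^ w a = \<xi> ^ \<gamma> a then F w else 0)"
  by (induction as) (simp_all add: eps_prod_def tensor_rep_1 tensor_rep_mult rep_eps)

lemma rep_eps_all:
  "rep (eps_all \<gamma>) F w = (if \<forall>a\<in>{1..n}. \<xi> ^ w a = \<xi> ^ \<gamma> a then F w else 0)"
  unfolding eps_all_def by (subst rep_eps_prod) (auto simp del: upt_Suc)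

lemma rep_eps_all_base_word: "rep (eps_all \<gamma>) F (base_word \<gamma>) = F (base_word \<gamma>)"
proof -
  have "\<xi> ^ base_word \<gamma> a = \<xi> ^ \<gamma> a" for a
    by (simp add: base_word_def power_add xi_power_d power_mult)
  then show ?thesis by (simp add: rep_eps_all)
qed

lemma rep_g: "rep (free_g b) F = tensor_g v \<xi> b F"
  by (simp add: tensor_rep_var)

lemma rep_chain_local:
  assumes W: "\<And>y b. y \<in> W \<Longrightarrow> b \<in> {1..m} \<Longrightarrow> swap_letters b y \<in> W"
    and F: "\<And>y. y \<in> W \<Longrightarrow> F y = H y" and "1 \<le> i" "y \<in> W"
  shows "rep (chain m i) F y = rep (chain m i) H y"
proof -
  have "rep (prod_list (map free_g bs)) F y = rep (prod_list (map free_g bs)) H y"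
    if "set bs \<subseteq> {1..m}" "y \<in> W" for bs y
    using that
  proof (induction bs arbitrary: y)
    case (Cons b bs)
    then show ?case using W
      by (auto simp: tensor_rep_mult rep_g tensor_g_def)
  qed (simp add: tensor_rep_1 F)
  moreover have "set (rev [i..<Suc m]) \<subseteq> {1..m}" using assms(3) by auto
  ultimately show ?thesis unfolding chain_def using assms(4) by blast
qed

lemma rep_nf_local:
  assumes "p \<in> normal_forms \<gamma> m"
    and "\<And>y b. y \<in> W \<Longrightarrow> b \<in> {1..<m} \<Longrightarrow> swap_letters b y \<in> W"
    and "\<And>y. y \<in> W \<Longrightarrow> F y = H y" and "y \<in> W"
  shows "rep p F y = rep p H y"
  using assms
proof (induction m arbitrary: p F H y)
  case 0
  then obtain c where c: "p \<approx> const c * eps_all \<gamma>" by auto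
  show ?case using 0(3,4)
    by (simp add: eqv_rep[OF c] tensor_rep_mult tensor_rep_const rep_eps_all)
next
  case (Suc m)
  then obtain p' where p': "\<forall>i\<in>{1..Suc m}. p' i \<in> normal_forms \<gamma> m" 
    "p \<approx> (\<Sum>i\<in>{1..Suc m}. p' i * chain m i)" by auto
  have "rep (p' i) (rep (chain m i) F) y = rep (p' i) (rep (chain m i) H) y" if "i \<in> {1..Suc m}" for i
    using Suc.prems that p'(1)
    by (intro Suc.IH[of "p' i"] rep_chain_local[where W = W]) auto
  then show ?case
    unfolding eqv_rep[OF p'(2)] tensor_rep_sum sum_fun_apply tensor_rep_mult by (rule sum.cong[OF refl])
qed

text \<open>
  The generator \<open>g\<^sub>m\<close> first moves the largest letter from position \<open>m + 1\<close> to \<open>m\<close>, the next one to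
  \<open>m - 1\<close>, and so on; at each step the letters involved are in increasing order, so no correction
  term appears.
\<close>

lemma rep_chain_move_down:
  assumes "\<And>a. a \<in> {1..m} \<Longrightarrow> y a < y (Suc m)" "1 \<le> i" "i \<le> Suc m"
  shows "rep (chain m i) F y = v ^ (Suc m - i) * F (move_down m i y)"
  using assms(3,2)
proof (induction i arbitrary: F rule: inc_induct)
  case base
  have "move_down m (Suc m) y = y" by (auto simp: move_down_def)
  then show ?case by (simp add: chain_Suc_self tensor_rep_1)
next
  case (step i)
  let ?z = "move_down m (Suc i) y"
  have "?z i = y i" "?z (Suc i) = y (Suc m)"
    by (simp_all add: move_down_def)
  moreover have "y i < y (Suc m)" using assms(1) step by auto
  moreover have "swap_letters i ?z = move_down m i y"
    using step by (auto simp: swap_letters_def move_down_def fun_eq_iff)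
  ultimately have "tensor_g v \<xi> i F ?z = v * F (move_down m i y)"
    by (simp add: tensor_g_def)
  moreover have "Suc m - i = Suc (Suc m - Suc i)" using step by simp
  ultimately show ?case using step by (simp add: chain_Suc tensor_rep_mult rep_g)
qed

text \<open>
  By induction on \<open>m\<close>, using test functions that single out one chain: after \<open>chain m i\<close> the
  largest letter sits in position \<open>i\<close>. At the base word of colouring \<open>\<gamma>\<close> the framing idempotent acts
  as 1, so the remaining coefficient is read off for \<open>m = 0\<close>.
\<close>

lemma nf_faithful:
  assumes \<gamma>: "\<And>a. \<gamma> a < d"
  shows "m \<le> n \<Longrightarrow> p \<in> normal_forms \<gamma> m \<Longrightarrow> (\<And>F. rep p F (base_word \<gamma>) = 0) \<Longrightarrow> p \<approx> 0"
proof (induction m arbitrary: p)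
  case 0
  then obtain c where c: "p \<approx> const c * eps_all \<gamma>" by auto
  from 0(3)[of "\<lambda>_. 1"] have "c = 0"
    unfolding eqv_rep[OF c] by (simp add: tensor_rep_mult tensor_rep_const rep_eps_all_base_word)
  then show ?case using c by (simp add: const_simps)
next
  case (Suc m)
  let ?x = "base_word \<gamma>"
  have less: "?x a < ?x b" if "a < b" for a b
  proof -
    have "?x a < Suc a * d" using \<gamma>[of a] by (simp add: base_word_def)
    also have "\<dots> \<le> b * d" using that by (intro mult_le_mono1) simp
    finally show ?thesis by (simp add: base_word_def)
  qed
  define W where "W = {y. (\<forall>a. a \<notin> {1..m} \<longrightarrow> y a = ?x a) \<and> (\<forall>a\<in>{1..m}. y a < ?x (Suc m))}"
  have xW: "?x \<in> W" using less by (auto simp: W_def)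
  have W_closed: "swap_letters b y \<in> W" if "y \<in> W" "b \<in> {1..<m}" for y b
    using that by (auto simp: W_def swap_letters_def)
  obtain p' where p': "\<And>i. i \<in> {1..Suc m} \<Longrightarrow> p' i \<in> normal_forms \<gamma> m" 
    "p \<approx> (\<Sum>i\<in>{1..Suc m}. p' i * chain m i)"
    using Suc.prems(2) unfolding normal_forms.simps by blast
  have "p' i \<approx> 0" if i: "i \<in> {1..Suc m}" for i
  proof (rule Suc.IH)
    fix H
    \<comment> \<open>a function that only the chain starting at \<open>i\<close> detects on the words in \<open>W\<close>\<close>
    define F where "F z = (if z i = ?x (Suc m) then H (move_up m i z) / v ^ (Suc m - i) else 0)" for z
    have F: "rep (chain m k) F y = (if k = i then H y else 0)" if y: "y \<in> W" and k: "k \<in> {1..Suc m}" for k y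
    proof -
      have y': "y (Suc m) = ?x (Suc m)" "\<And>a. a \<in> {1..m} \<Longrightarrow> y a < ?x (Suc m)"
        using y by (auto simp: W_def)
      have "rep (chain m k) F y = v ^ (Suc m - k) * F (move_down m k y)"
        using y' k by (intro rep_chain_move_down) auto
      moreover have "move_down m k y i \<noteq> ?x (Suc m)" if "k \<noteq> i"
      proof -
        have "\<exists>a\<in>{1..m}. move_down m k y i = y a"
        proof (cases "k < i")
          case True
          then have "move_down m k y i = y (i - 1)" "i - 1 \<in> {1..m}"
            using i k by (auto simp: move_down_def)
          then show ?thesis by blast
        next
          case False
          then have "move_down m k y i = y i" "i \<in> {1..m}"
            using i k that by (auto simp: move_down_def)
          then show ?thesis by blast
        qed
        then show ?thesis using y'(2) by fastforce
      qed
      moreover have "move_down m i y i = ?x (Suc m)" using y'(1) by (simp add: move_down_def)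
      ultimately show ?thesis
        using k i v_nz by (cases "k = i") (simp_all add: F_def move_up_down)
    qed
    have "rep p F ?x = (\<Sum>k\<in>{1..Suc m}. rep (p' k) (rep (chain m k) F) ?x)"
      unfolding eqv_rep[OF p'(2)] tensor_rep_sum sum_fun_apply tensor_rep_mult ..
    also have "\<dots> = (\<Sum>k\<in>{1..Suc m}. rep (p' k) (if k = i then H else 0) ?x)"
      by (intro sum.cong refl rep_nf_local[where W = W, OF p'(1)] W_closed xW) (auto simp: F)
    also have "\<dots> = (\<Sum>k\<in>{1..Suc m}. if k = i then rep (p' i) H ?x else 0)"
      by (rule sum.cong) (auto simp: tensor_rep_arg_0)
    also have "\<dots> = rep (p' i) H ?x" using i by (subst sum.delta) auto
    finally show "rep (p' i) H ?x = 0" using Suc.prems(3)[of F] by simp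
  qed (use Suc.prems p' i in auto)
  then have "(\<Sum>i\<in>{1..Suc m}. p' i * chain m i) \<approx> (\<Sum>i\<in>{1..Suc m}. 0 * chain m i)"
    using Suc.prems(1) by (intro eqv_sum eqv_right A_chain) auto
  also have "(\<Sum>i\<in>{1..Suc m}. 0 * chain m i) = 0" by simp
  finally show ?case using eqv_trans[OF p'(2)] by blast
qed

text \<open>
  Hence the algebra over any of the coefficient rings embeds into the operators on one tensor space. In
  particular the algebra over the valuation ring embeds into the one over its fraction field, and both
  equalities can be tested on the same vectors.
\<close>

theorem rep_faithful:
  assumes "f \<in> carrier A" "g \<in> carrier A" "\<And>F. rep f F = rep g F"
  shows "f \<approx> g"
proof -
  let ?h = "f - g"
  have h: "?h \<in> carrier A" using assms by auto
  have "?h \<approx> 0"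
  proof (rule eqv_0_from_eps_prod[OF h])
    fix \<gamma> :: "nat \<Rightarrow> nat" assume \<gamma>: "\<And>a. \<gamma> a < d"
    have "eps_all \<gamma> * ?h \<approx> 0"
      by (rule nf_faithful[OF \<gamma> order_refl nf_all[OF h]])
         (simp add: tensor_rep_mult tensor_rep_diff assms(3) tensor_rep_arg_0)
    then show "eps_prod \<gamma> [1..<Suc n] * ?h \<approx> 0" by (simp only: eps_all_def)
  qed auto
  from eqv_add[OF this eqv_refl[OF assms(2)]] show ?thesis by simp
qed

corollary cls_eq_iff_rep:
  "f \<in> carrier A \<Longrightarrow> g \<in> carrier A \<Longrightarrow> cls f = cls g \<longleftrightarrow> (\<forall>F. rep f F = rep g F)"
  using rep_faithful[of f g] eqv_rep[of f g] by (auto simp: eqv_def)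

end

section \<open>Sequences of letters stable under admissible swaps\<close>

definition occurrences :: "(nat \<Rightarrow> 'l) \<Rightarrow> 'l \<Rightarrow> nat \<Rightarrow> nat" where
  "occurrences s l j = card {a \<in> {1..j}. s a = l}"

lemma occurrences_0 [simp]: "occurrences s l 0 = 0"
  by (simp add: occurrences_def)

lemma occurrences_Suc [simp]:
  "occurrences s l (Suc j) = occurrences s l j + (if s (Suc j) = l then 1 else 0)"
proof -
  have "{a \<in> {1..Suc j}. s a = l} =
      (if s (Suc j) = l then insert (Suc j) {a \<in> {1..j}. s a = l} else {a \<in> {1..j}. s a = l})"
    by (auto simp: le_Suc_eq)
  then show ?thesis by (simp add: occurrences_def)
qed

lemma occurrences_mono: "i \<le> j \<Longrightarrow> occurrences s l i \<le> occurrences s l j"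
  unfolding occurrences_def by (intro card_mono) auto

lemma occurrences_pos_iff: "0 < occurrences s l j \<longleftrightarrow> (\<exists>a\<in>{1..j}. s a = l)"
  by (auto simp: occurrences_def card_gt_0_iff)

lemma last_occurrence:
  assumes "0 < occurrences s l j"
  obtains a where "a \<in> {1..j}" "s a = l" "\<And>i. i \<in> {a<..j} \<Longrightarrow> s i \<noteq> l"
    "occurrences s l a = occurrences s l j"
  using assms
proof (induction j arbitrary: thesis)
  case (Suc j)
  show ?case
  proof (cases "s (Suc j) = l")
    case True
    then show ?thesis by (intro Suc.prems(1)[of "Suc j"]) auto
  next
    case False
    then obtain a where "a \<in> {1..j}" "s a = l" "\<And>i. i \<in> {a<..j} \<Longrightarrow> s i \<noteq> l"
      "occurrences s l a = occurrences s l j"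
      using Suc by auto
    then show ?thesis using False by (intro Suc.prems(1)[of a]) (auto simp: le_Suc_eq)
  qed
qed simp

text \<open>
  Two letters of which each occurs between any two occurrences of the other alternate; the
  one that comes first is then ahead by at most one.
\<close>

lemma alternating_occurrences:
  assumes LM: "L \<noteq> M"
    and L: "\<And>a b. 1 \<le> a \<Longrightarrow> a < b \<Longrightarrow> b \<le> m \<Longrightarrow> s a = L \<Longrightarrow> s b = L \<Longrightarrow>
              (\<And>i. i \<in> {a<..<b} \<Longrightarrow> s i \<noteq> L) \<Longrightarrow> \<exists>i\<in>{a<..<b}. s i = M"
    and M: "\<And>a b. 1 \<le> a \<Longrightarrow> a < b \<Longrightarrow> b \<le> m \<Longrightarrow> s a = M \<Longrightarrow> s b = M \<Longrightarrow>
              (\<And>i. i \<in> {a<..<b} \<Longrightarrow> s i \<noteq> M) \<Longrightarrow> \<exists>i\<in>{a<..<b}. s i = L"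
    and first: "\<And>b. 1 \<le> b \<Longrightarrow> b \<le> m \<Longrightarrow> s b = M \<Longrightarrow> \<exists>i\<in>{1..<b}. s i = L"
    and "j \<le> m"
  shows "occurrences s M j \<le> occurrences s L j \<and> occurrences s L j \<le> Suc (occurrences s M j)"
  using \<open>j \<le> m\<close>
proof (induction j rule: less_induct)
  case (less j)
  show ?case
  proof (cases j)
    case (Suc i)
    have IH: "occurrences s M a \<le> occurrences s L a \<and> occurrences s L a \<le> Suc (occurrences s M a)"
      if "a \<le> i" for a
      using less Suc that by auto
    have between: "occurrences s l a < occurrences s l i" if "a < b" "b \<le> i" "s b = l" for l a b
    proof -
      have "occurrences s l (b - 1) < occurrences s l b" using that by (cases b) auto
      then show ?thesis
        using that occurrences_mono[of a "b - 1" s l] occurrences_mono[of b i s l] by linarith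
    qed
    consider "s j = L" | "s j = M" | "s j \<noteq> L" "s j \<noteq> M" by blast
    then show ?thesis
    proof cases
      case 1
      have "occurrences s L i \<le> occurrences s M i"
      proof (rule ccontr)
        assume *: "\<not> ?thesis"
        then have "0 < occurrences s L i" by simp
        then obtain a where a: "a \<in> {1..i}" "s a = L" "\<And>k. k \<in> {a<..i} \<Longrightarrow> s k \<noteq> L"
          "occurrences s L a = occurrences s L i" using last_occurrence[of s L i] by metis
        obtain b where b: "b \<in> {a<..<j}" "s b = M"
          using L[of a j] a 1 less.prems Suc by auto
        show False using between[of a b M] b Suc IH[of a] a * by auto
      qed
      then show ?thesis using 1 IH[of i] Suc LM by simp
    next
      case 2
      have "occurrences s M i < occurrences s L i"
      proof (cases "0 < occurrences s M i")
        case True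
        then obtain a where a: "a \<in> {1..i}" "s a = M" "\<And>k. k \<in> {a<..i} \<Longrightarrow> s k \<noteq> M"
          "occurrences s M a = occurrences s M i" using last_occurrence[of s M i] by metis
        obtain b where b: "b \<in> {a<..<j}" "s b = L"
          using M[of a j] a 2 less.prems Suc by auto
        show ?thesis using between[of a b L] b Suc IH[of a] a by auto
      next
        case False
        moreover have "\<exists>k\<in>{1..<j}. s k = L" using first[of j] 2 less.prems Suc by auto
        then have "0 < occurrences s L i" using Suc by (auto simp: occurrences_pos_iff)
        ultimately show ?thesis by simp
      qed
      then show ?thesis using 2 IH[of i] Suc LM by simp
    next
      case 3
      then show ?thesis using IH[of i] Suc by simp
    qed
  qed simp
qed

text \<open>
  This isolates the combinatorics of Okounkov and Vershik: adjacent letters may be swapped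
  unless they are neighbours, and two local patterns are excluded.
\<close>

locale swap_stable_sequences =
  fixes up down :: "'l \<Rightarrow> 'l" and initial :: "'l \<Rightarrow> bool" and Q :: "(nat \<Rightarrow> 'l) set" and m :: nat
  assumes up_down [simp]: "up (down l) = l" and down_up [simp]: "down (up l) = l"
    and first_letter: "s \<in> Q \<Longrightarrow> 1 \<le> m \<Longrightarrow> initial (s 1)"
    and no_repeat: "s \<in> Q \<Longrightarrow> 1 \<le> a \<Longrightarrow> Suc a \<le> m \<Longrightarrow> s (Suc a) \<noteq> s a"
    and swap: "s \<in> Q \<Longrightarrow> 1 \<le> a \<Longrightarrow> Suc a \<le> m \<Longrightarrow> s (Suc a) \<noteq> up (s a) \<Longrightarrow> s (Suc a) \<noteq> down (s a) \<Longrightarrow>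
        s \<circ> transpose a (Suc a) \<in> Q"
    and no_return: "s \<in> Q \<Longrightarrow> 1 \<le> a \<Longrightarrow> Suc (Suc a) \<le> m \<Longrightarrow>
        s (Suc a) = up (s a) \<or> s (Suc a) = down (s a) \<Longrightarrow> s (Suc (Suc a)) \<noteq> s a"
begin

text \<open>
  Swapping shortens the gap between the two occurrences until both ends of the gap are
  neighbours of the letter. If these agree, induction applies to two consecutive occurrences
  of that neighbour and finds the original letter inside the gap.
\<close>

lemma neighbours_between:
  "s \<in> Q \<Longrightarrow> 1 \<le> a \<Longrightarrow> a < b \<Longrightarrow> b \<le> m \<Longrightarrow> s b = s a \<Longrightarrow> (\<And>i. i \<in> {a<..<b} \<Longrightarrow> s i \<noteq> s a) \<Longrightarrow>
     (\<exists>i\<in>{a<..<b}. s i = up (s a)) \<and> (\<exists>i\<in>{a<..<b}. s i = down (s a))"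
proof (induction "b - a" arbitrary: s a b rule: less_induct)
  case less
  let ?l = "s a"
  have b1: "Suc a \<noteq> b" using no_repeat[of s a] less.prems by auto
  then have b2: "Suc a < b" using less.prems by simp
  define b' where "b' = b - 1"
  have b': "b = Suc b'" "a < b'" using b2 by (auto simp: b'_def)
  consider "s (Suc a) \<noteq> up ?l" "s (Suc a) \<noteq> down ?l" | "s b' \<noteq> up ?l" "s b' \<noteq> down ?l" 
    | "s (Suc a) = up ?l \<or> s (Suc a) = down ?l" "s b' = up ?l \<or> s b' = down ?l" by blast
  then show ?case
  proof cases
    case 1
    let ?s = "s \<circ> transpose a (Suc a)"
    have s: "?s i = s i" if "i \<in> {Suc a<..b}" for i using that by (auto simp: transpose_def)
    have sa: "?s (Suc a) = ?l" by simp
    have "(\<exists>i\<in>{Suc a<..<b}. ?s i = up (?s (Suc a))) \<and> (\<exists>i\<in>{Suc a<..<b}. ?s i = down (?s (Suc a)))"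
    proof (rule less.hyps)
      show "?s \<in> Q" using swap[of s a] 1 less.prems by simp
      show "?s b = ?s (Suc a)" unfolding sa using s[of b] b2 less.prems(5) by simp
      show "?s i \<noteq> ?s (Suc a)" if "i \<in> {Suc a<..<b}" for i
        unfolding sa using s[of i] that less.prems(6)[of i] by auto
    qed (use b2 less.prems in auto)
    then show ?thesis unfolding sa by (metis Suc_lessD greaterThanLessThan_iff greaterThanAtMost_iff less_imp_le s)
  next
    case 2
    let ?s = "s \<circ> transpose b' (Suc b')"
    have s: "?s i = s i" if "i \<in> {a..<b'}" for i using that by (auto simp: transpose_def)
    have sa: "?s a = ?l" using b' by (intro s) auto
    have "(\<exists>i\<in>{a<..<b'}. ?s i = up (?s a)) \<and> (\<exists>i\<in>{a<..<b'}. ?s i = down (?s a))"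
    proof (rule less.hyps)
      have "s b \<noteq> up (s b')" "s b \<noteq> down (s b')" using 2 less.prems(5) by auto
      then show "?s \<in> Q" using swap[of s b'] b' less.prems by simp
      show "?s b' = ?s a" unfolding sa using b' less.prems(5) by simp
      show "?s i \<noteq> ?s a" if "i \<in> {a<..<b'}" for i
        unfolding sa using s[of i] that b' less.prems(6)[of i] by auto
    qed (use b' less.prems in auto)
    then show ?thesis unfolding sa using s b' by (metis greaterThanLessThan_iff atLeastLessThan_iff less_SucI less_imp_le)
  next
    case 3
    show ?thesis
    proof (cases "s (Suc a) = s b'")
      case False
      have "Suc a \<in> {a<..<b}" "b' \<in> {a<..<b}" using b' b2 by auto
      then show ?thesis using 3 False by metis
    next
      case True
      have "Suc a \<noteq> b'" using no_return[of s a] 3 less.prems b' by auto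
      then have ab': "Suc a < b'" using b' by simp
      let ?R = "\<lambda>k. Suc a < k \<and> s k = s (Suc a)"
      define k where "k = (LEAST k. ?R k)"
      have Rb: "?R b'" using ab' True by simp
      have k: "?R k" "k \<le> b'" unfolding k_def using Rb by (rule LeastI, rule Least_le)
      have kmin: "s i \<noteq> s (Suc a)" if "i \<in> {Suc a<..<k}" for i
        using not_less_Least[of i ?R] that unfolding k_def[symmetric] by auto
      have "(\<exists>i\<in>{Suc a<..<k}. s i = up (s (Suc a))) \<and> (\<exists>i\<in>{Suc a<..<k}. s i = down (s (Suc a)))"
        using k kmin b' less.prems by (intro less.hyps) auto
      then obtain i where "i \<in> {Suc a<..<k}" "s i = ?l"
        using 3(1) by (metis up_down down_up)
      then show ?thesis using less.prems(6)[of i] k b' by auto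
    qed
  qed
qed

lemma neighbour_before:
  "s \<in> Q \<Longrightarrow> 1 \<le> b \<Longrightarrow> b \<le> m \<Longrightarrow> \<not> initial (s b) \<Longrightarrow>
     \<exists>i\<in>{1..<b}. s i = up (s b) \<or> s i = down (s b)"
proof (induction b arbitrary: s)
  case (Suc b)
  show ?case
  proof (rule ccontr)
    assume *: "\<not> ?thesis"
    have b: "b \<noteq> 0" using first_letter[of s] Suc.prems by (auto intro: gr0I)
    let ?s = "s \<circ> transpose b (Suc b)"
    have sb: "?s b = s (Suc b)" by simp
    have s: "?s i = s i" if "i < b" for i using that by (auto simp: transpose_def)
    have "s b \<noteq> up (s (Suc b))" "s b \<noteq> down (s (Suc b))"
      using * b by auto
    then have "s (Suc b) \<noteq> up (s b)" "s (Suc b) \<noteq> down (s b)" by auto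
    then have sQ: "?s \<in> Q" using swap[of s b] Suc.prems b by simp
    have "\<exists>i\<in>{1..<b}. ?s i = up (?s b) \<or> ?s i = down (?s b)"
      using Suc.IH[OF sQ] Suc.prems b by simp
    then show False using * s unfolding sb by (metis atLeastLessThan_iff less_SucI)
  qed
qed simp

lemma alternating:
  assumes "s \<in> Q" "M \<noteq> L" "M = up L \<or> M = down L"
    and "\<And>b. 1 \<le> b \<Longrightarrow> b \<le> m \<Longrightarrow> s b = M \<Longrightarrow> \<exists>i\<in>{1..<b}. s i = L" and "j \<le> m"
  shows "occurrences s M j \<le> occurrences s L j \<and> occurrences s L j \<le> Suc (occurrences s M j)"
proof (rule alternating_occurrences[OF _ _ _ assms(4,5)])
  fix a b
  assume *: "1 \<le> a" "a < b" "b \<le> m"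
  show "\<exists>i\<in>{a<..<b}. s i = M"
    if "s a = L" "s b = L" "\<And>i. i \<in> {a<..<b} \<Longrightarrow> s i \<noteq> L"
    using neighbours_between[OF assms(1) *] that assms(3) by metis
  show "\<exists>i\<in>{a<..<b}. s i = L"
    if "s a = M" "s b = M" "\<And>i. i \<in> {a<..<b} \<Longrightarrow> s i \<noteq> M"
    using neighbours_between[OF assms(1) *] that assms(3) by (metis up_down down_up)
qed (use assms(2) in auto)

end

section \<open>Modules for generic parameters\<close>

text \<open>
  The exponents of the contents and the colours of a sequence of nodes: a balanced sequence is
  one in which each diagonal of each component is filled in step with its two neighbours.
\<close>

definition balanced :: "nat \<Rightarrow> (nat \<Rightarrow> int \<times> 'c) \<Rightarrow> bool" where
  "balanced n s \<longleftrightarrow> (\<forall>j\<le>n. \<forall>k p.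
     (0 \<le> k \<longrightarrow> occurrences s (k + 1, p) j \<le> occurrences s (k, p) j \<and>
               occurrences s (k, p) j \<le> Suc (occurrences s (k + 1, p) j)) \<and>
     (k \<le> 0 \<longrightarrow> occurrences s (k - 1, p) j \<le> occurrences s (k, p) j \<and>
               occurrences s (k, p) j \<le> Suc (occurrences s (k - 1, p) j)))"

text \<open>
  A module with operators \<open>G\<^sub>b\<close>, \<open>T\<^sub>a\<close> satisfying the relations of the algebra, where \<open>v\<close> is not a
  root of unity. The quadratic relation is split according to whether a vector has equal or different
  eigenvalues of \<open>T\<^sub>b\<close> and \<open>T\<^sub>b\<^sub>+\<^sub>1\<close>, which avoids the idempotents \<open>e\<^sub>b\<close>.
\<close>

locale yh_module = vector_space scale
  for scale :: "'f::field \<Rightarrow> 'v::ab_group_add \<Rightarrow> 'v" (infixr "*s" 75) +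
  fixes G T :: "nat \<Rightarrow> 'v \<Rightarrow> 'v" and n :: nat and v :: 'f
  assumes G_add: "G b (x + y) = G b x + G b y" and G_scale: "G b (c *s x) = c *s G b x"
    and T_add: "T a (x + y) = T a x + T a y" and T_scale: "T a (c *s x) = c *s T a x"
    and T_G: "a \<in> {1..n} \<Longrightarrow> b \<in> {1..<n} \<Longrightarrow> T a (G b x) = G b (T (transpose b (Suc b) a) x)"
    and G_same: "b \<in> {1..<n} \<Longrightarrow> T b x = T (Suc b) x \<Longrightarrow> G b (G b x) = v *s x + (v - 1) *s G b x"
    and G_diff: "b \<in> {1..<n} \<Longrightarrow> T b x = c *s x \<Longrightarrow> T (Suc b) x = c' *s x \<Longrightarrow> c \<noteq> c' \<Longrightarrow> 
      G b (G b x) = v *s x"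
    and G_braid: "1 \<le> b \<Longrightarrow> Suc b < n \<Longrightarrow> 
      G b (G (Suc b) (G b x)) = G (Suc b) (G b (G (Suc b) x))"
    and G_commute: "a \<in> {1..<n} \<Longrightarrow> b \<in> {1..<n} \<Longrightarrow> Suc a < b \<Longrightarrow> G a (G b x) = G b (G a x)"
    and v_nz: "v \<noteq> 0" and v_generic: "0 < i \<Longrightarrow> v ^ i \<noteq> 1"
begin

definition V :: "(nat \<Rightarrow> 'f) \<Rightarrow> 'v set" where
  "V \<gamma> = {x. \<forall>a\<in>{1..n}. T a x = \<gamma> a *s x}"

fun X :: "nat \<Rightarrow> 'v \<Rightarrow> 'v" where
  "X 0 x = x"
| "X (Suc 0) x = x"
| "X (Suc (Suc a)) x = inverse v *s G (Suc a) (X (Suc a) (G (Suc a) x))"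

lemma G_0 [simp]: "G b 0 = 0" using G_scale[of b 0 0] by simp
lemma G_uminus: "G b (- x) = - G b x" using G_add[of b x "- x"] by (simp add: eq_neg_iff_add_eq_0 add.commute)
lemma G_minus: "G b (x - y) = G b x - G b y" using G_add[of b x "- y"] by (simp add: G_uminus)

lemma X_add: "X a (x + y) = X a x + X a y"
  by (induction a x arbitrary: y rule: X.induct) (simp_all add: G_add scale_right_distrib)

lemma X_scale: "X a (c *s x) = c *s X a x"
  by (induction a x rule: X.induct) (simp_all add: G_scale mult.commute)

lemma X_0 [simp]: "X b 0 = 0" using X_scale[of b 0 0] by simp
lemma X_uminus: "X b (- x) = - X b x" using X_add[of b x "- x"] by (simp add: eq_neg_iff_add_eq_0 add.commute)
lemma X_minus: "X b (x - y) = X b x - X b y" using X_add[of b x "- y"] by (simp add: X_uminus)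

lemma X_Suc: "1 \<le> b \<Longrightarrow> v *s X (Suc b) x = G b (X b (G b x))"
  using v_nz by (cases b) simp_all

text \<open>
  For \<open>b > a\<close> the element \<open>X\<^sub>a\<close> only involves generators far from \<open>G\<^sub>b\<close>. For \<open>b = a - 2\<close> a braid
  relation turns \<open>G\<^sub>b\<close> into \<open>G\<^sub>b\<^sub>+\<^sub>1\<close> on its way through \<open>G\<^sub>b\<^sub>+\<^sub>1 G\<^sub>b\<close>; this passes \<open>X\<^sub>b\<close> and is
  turned back by a second braid relation.
\<close>

lemma G_X_commute:
  "b \<in> {1..<n} \<Longrightarrow> a \<in> {1..n} \<Longrightarrow> b \<noteq> a \<Longrightarrow> Suc b \<noteq> a \<Longrightarrow> G b (X a x) = X a (G b x)"
proof (induction a arbitrary: b x rule: less_induct)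
  case (less a)
  show ?case
  proof (cases "a \<le> 1")
    case True
    then have "a = 1" using less.prems by simp
    then show ?thesis by simp
  next
    case False
    then obtain a' where a': "a = Suc a'" "1 \<le> a'" by (cases a) auto
    then have X: "X (Suc a') y = inverse v *s G a' (X a' (G a' y))" for y by (cases a') auto
    consider "Suc a' < b" | "Suc b < a'" | "a' = Suc b" using less.prems a' by linarith
    then show ?thesis
    proof cases
      case 1
      then show ?thesis using less.IH[of a' b, symmetric] less.prems a' G_commute[of a' b] by (simp add: X G_scale)
    next
      case 2
      then show ?thesis using less.IH[of a' b] less.prems a' G_commute[of b a'] by (simp add: X G_scale)
    next
      case 3
      have Xb: "X a' y = inverse v *s G b (X b (G b y))" for y
        using 3 less.prems by (cases b) auto
      have XG: "G a' (X b y) = X b (G a' y)" for y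
        using less.IH[of b a'] less.prems a' 3 by simp
      have br: "G b (G a' (G b y)) = G a' (G b (G a' y))" for y
        using G_braid[of b y] 3 less.prems a' by simp
      have "G b (G a' (G b (X b (G b (G a' x))))) = G a' (G b (X b (G b (G a' (G b x)))))"
        by (simp only: br XG)
      then show ?thesis by (simp add: a'(1) X Xb G_scale)
    qed
  qed
qed

lemma X_commute_less: "b < a \<Longrightarrow> a \<in> {1..n} \<Longrightarrow> X a (X b x) = X b (X a x)"
proof (induction b x rule: X.induct)
  case (3 b x)
  have "X a (G (Suc b) y) = G (Suc b) (X a y)" for y
    using G_X_commute[of "Suc b" a y] 3 by simp
  then show ?case using 3 by (simp add: X_scale)
qed simp_all

lemma X_commute: "a \<in> {1..n} \<Longrightarrow> b \<in> {1..n} \<Longrightarrow> X a (X b x) = X b (X a x)"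
  using X_commute_less[of b a x] X_commute_less[of a b x] by (cases a b rule: linorder_cases) auto

lemma T_0 [simp]: "T a 0 = 0" using T_scale[of a 0 0] by simp

lemma V_0 [simp]: "0 \<in> V \<gamma>"
  and V_add: "x \<in> V \<gamma> \<Longrightarrow> y \<in> V \<gamma> \<Longrightarrow> x + y \<in> V \<gamma>"
  and V_scale: "x \<in> V \<gamma> \<Longrightarrow> c *s x \<in> V \<gamma>"
  by (simp_all add: V_def T_add T_scale scale_right_distrib mult.commute)

lemma V_uminus: "x \<in> V \<gamma> \<Longrightarrow> - x \<in> V \<gamma>"
  using V_scale[of x \<gamma> "- 1"] by simp

lemma V_minus: "x \<in> V \<gamma> \<Longrightarrow> y \<in> V \<gamma> \<Longrightarrow> x - y \<in> V \<gamma>"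
  using V_add[of x \<gamma> "- y"] V_uminus[of y] by simp

lemma G_V: "x \<in> V \<gamma> \<Longrightarrow> b \<in> {1..<n} \<Longrightarrow> G b x \<in> V (\<gamma> \<circ> transpose b (Suc b))"
proof -
  assume x: "x \<in> V \<gamma>" and b: "b \<in> {1..<n}"
  have "transpose b (Suc b) a \<in> {1..n}" if "a \<in> {1..n}" for a
    using that b by (auto simp: transpose_def)
  then show ?thesis using x b by (auto simp: V_def T_G G_scale)
qed

lemma transpose_twice: "\<gamma> \<circ> transpose b c \<circ> transpose b c = \<gamma>"
  by (simp add: comp_assoc)

lemma X_V: "x \<in> V \<gamma> \<Longrightarrow> a \<le> n \<Longrightarrow> X a x \<in> V \<gamma>"
proof (induction a x arbitrary: \<gamma> rule: X.induct)
  case (3 a x)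
  have "G (Suc a) x \<in> V (\<gamma> \<circ> transpose (Suc a) (Suc (Suc a)))"
    using 3 by (intro G_V) auto
  then have "X (Suc a) (G (Suc a) x) \<in> V (\<gamma> \<circ> transpose (Suc a) (Suc (Suc a)))"
    using 3 by auto
  from G_V[OF this, of "Suc a", unfolded transpose_twice]
  have "G (Suc a) (X (Suc a) (G (Suc a) x)) \<in> V \<gamma>"
    using 3 by auto
  then show ?case by (simp add: V_scale)
qed simp_all

lemma transpose_same: "\<gamma> b = \<gamma> (Suc b) \<Longrightarrow> \<gamma> \<circ> transpose b (Suc b) = \<gamma>"
  by (auto simp: transpose_def fun_eq_iff)

lemma GG_same: "b \<in> {1..<n} \<Longrightarrow> \<gamma> b = \<gamma> (Suc b) \<Longrightarrow> x \<in> V \<gamma> \<Longrightarrow> G b (G b x) = v *s x + (v - 1) *s G b x"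
  by (rule G_same) (auto simp: V_def)

lemma GG_diff: "b \<in> {1..<n} \<Longrightarrow> \<gamma> b \<noteq> \<gamma> (Suc b) \<Longrightarrow> x \<in> V \<gamma> \<Longrightarrow> G b (G b x) = v *s x"
  by (rule G_diff[of b x "\<gamma> b" "\<gamma> (Suc b)"]) (auto simp: V_def)

lemma G_V_same: "b \<in> {1..<n} \<Longrightarrow> \<gamma> b = \<gamma> (Suc b) \<Longrightarrow> x \<in> V \<gamma> \<Longrightarrow> G b x \<in> V \<gamma>"
  using G_V[of x \<gamma> b] transpose_same[of \<gamma> b] by simp

lemma Suc_X_G_same:
  assumes "b \<in> {1..<n}" "\<gamma> b = \<gamma> (Suc b)" "x \<in> V \<gamma>"
  shows "X (Suc b) (G b x) = G b (X b x) + (v - 1) *s X (Suc b) x"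
proof -
  have "v *s X (Suc b) (G b x) = v *s G b (X b x) + (v - 1) *s G b (X b (G b x))"
    using assms X_Suc[of b "G b x"] by (simp add: GG_same X_add X_scale G_add G_scale)
  also have "\<dots> = v *s G b (X b x) + (v - 1) *s (v *s X (Suc b) x)"
    using assms X_Suc[of b x] by simp
  also have "\<dots> = v *s (G b (X b x) + (v - 1) *s X (Suc b) x)"
    by (simp add: scale_right_distrib mult.commute)
  finally show ?thesis using v_nz by (simp only: scale_cancel_left) simp
qed

lemma X_G_same:
  assumes "b \<in> {1..<n}" "\<gamma> b = \<gamma> (Suc b)" "x \<in> V \<gamma>"
  shows "X b (G b x) = G b (X (Suc b) x) - (v - 1) *s X (Suc b) x"
proof -
  have V: "X b (G b x) \<in> V \<gamma>" using assms by (intro X_V G_V_same) auto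
  have "v *s G b (X (Suc b) x) = G b (G b (X b (G b x)))"
    using assms X_Suc[of b x] by (simp flip: G_scale)
  also have "\<dots> = v *s X b (G b x) + (v - 1) *s (v *s X (Suc b) x)"
    using assms V X_Suc[of b x] by (simp add: GG_same)
  also have "\<dots> = v *s (X b (G b x) + (v - 1) *s X (Suc b) x)"
    by (simp add: scale_right_distrib mult.commute)
  finally have "G b (X (Suc b) x) = X b (G b x) + (v - 1) *s X (Suc b) x"
    using v_nz by (simp only: scale_cancel_left) simp
  then show ?thesis by simp
qed

lemma Suc_X_G_diff:
  assumes "b \<in> {1..<n}" "\<gamma> b \<noteq> \<gamma> (Suc b)" "x \<in> V \<gamma>"
  shows "X (Suc b) (G b x) = G b (X b x)" and "X b (G b x) = G b (X (Suc b) x)"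
proof -
  have "v *s X (Suc b) (G b x) = v *s (G b (X b x))"
    using assms X_Suc[of b "G b x"] by (simp add: GG_diff X_scale G_scale)
  then show "X (Suc b) (G b x) = G b (X b x)" using v_nz by simp
  have "G b x \<in> V (\<gamma> \<circ> transpose b (Suc b))" using assms by (intro G_V) auto
  then have V: "X b (G b x) \<in> V (\<gamma> \<circ> transpose b (Suc b))" using assms by (intro X_V) auto
  have "v *s G b (X (Suc b) x) = G b (G b (X b (G b x)))"
    using assms X_Suc[of b x] by (simp flip: G_scale)
  also have "\<dots> = v *s X b (G b x)"
    using assms by (intro GG_diff[OF _ _ V]) auto
  finally show "X b (G b x) = G b (X (Suc b) x)" using v_nz by simp
qed

text \<open>
  The intertwiner exchanges the eigenvalues of \<open>X\<^sub>b\<close> and \<open>X\<^sub>b\<^sub>+\<^sub>1\<close> on vectors whose colours in these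
  positions agree; for different colours \<open>G\<^sub>b\<close> itself does so. Its square is
  \<open>(v X\<^sub>b - X\<^sub>b\<^sub>+\<^sub>1) (v X\<^sub>b\<^sub>+\<^sub>1 - X\<^sub>b)\<close>, hence invertible away from neighbouring contents.
\<close>

definition intertwiner :: "nat \<Rightarrow> 'v \<Rightarrow> 'v" where
  "intertwiner b x = G b (X b x - X (Suc b) x) + (v - 1) *s X (Suc b) x"

lemma intertwiner_0 [simp]: "intertwiner b 0 = 0"
  and intertwiner_scale: "intertwiner b (c *s x) = c *s intertwiner b x"
  and intertwiner_minus: "intertwiner b (x - y) = intertwiner b x - intertwiner b y"
  by (simp_all add: intertwiner_def X_scale X_minus G_scale G_minus G_add algebra_simps)

context
  fixes \<gamma> :: "nat \<Rightarrow> 'f" and b :: nat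
  assumes b: "b \<in> {1..<n}" and \<gamma>: "\<gamma> b = \<gamma> (Suc b)"
begin

lemma intertwiner_V: "x \<in> V \<gamma> \<Longrightarrow> intertwiner b x \<in> V \<gamma>"
  unfolding intertwiner_def using b \<gamma> by (intro V_add V_scale G_V_same V_minus X_V) auto

lemma X_intertwiner:
  assumes x: "x \<in> V \<gamma>"
  shows "X (Suc b) (intertwiner b x) = intertwiner b (X b x)"
    and "X b (intertwiner b x) = intertwiner b (X (Suc b) x)"
proof -
  have bn: "b \<le> n" "Suc b \<le> n" using b by auto
  have c: "X (Suc b) (X b y) = X b (X (Suc b) y)" for y
    using b by (intro X_commute) auto
  note V = x X_V[OF x bn(1)] X_V[OF x bn(2)]
  show "X (Suc b) (intertwiner b x) = intertwiner b (X b x)"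
    unfolding intertwiner_def
    by (simp add: X_add X_scale G_minus X_minus Suc_X_G_same[OF b \<gamma>] V c algebra_simps)
  show "X b (intertwiner b x) = intertwiner b (X (Suc b) x)"
    unfolding intertwiner_def
    by (simp add: X_add X_scale G_minus X_minus X_G_same[OF b \<gamma>] V c algebra_simps)
qed

lemma intertwiner_twice:
  assumes x: "x \<in> V \<gamma>" and a: "X b x = a *s x"
  shows "intertwiner b (intertwiner b x) =
    (v * a) *s (v *s X (Suc b) x - a *s x) - X (Suc b) (v *s X (Suc b) x - a *s x)"
proof -
  let ?B = "X (Suc b)"
  have bn: "b \<le> n" "Suc b \<le> n" using b by auto
  have V: "?B x \<in> V \<gamma>" "?B (?B x) \<in> V \<gamma>" using X_V x bn by auto
  have c: "X b (?B y) = ?B (X b y)" for y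
    using b by (intro X_commute) auto
  have "intertwiner b (intertwiner b x) =
      G b (intertwiner b (?B x) - intertwiner b (X b x)) + (v - 1) *s intertwiner b (X b x)"
    by (subst intertwiner_def) (simp add: X_intertwiner x)
  also have "\<dots> = (v * a) *s (v *s ?B x - a *s x) - ?B (v *s ?B x - a *s x)"
    using V x
    by (simp add: a intertwiner_scale) 
       (simp add: intertwiner_def X_scale X_minus G_add G_minus G_scale c a GG_same[OF b \<gamma>] algebra_simps)
  finally show ?thesis .
qed

end


text \<open>
  \<open>apply_roots f cs\<close> is the operator \<open>(f - c\<^sub>1) \<dots> (f - c\<^sub>r)\<close>.
\<close>

fun apply_roots :: "('v \<Rightarrow> 'v) \<Rightarrow> 'f list \<Rightarrow> 'v \<Rightarrow> 'v" where
  "apply_roots f [] x = x"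
| "apply_roots f (c # cs) x = f (apply_roots f cs x) - c *s apply_roots f cs x"

definition linear_op :: "('v \<Rightarrow> 'v) \<Rightarrow> bool" where
  "linear_op f \<longleftrightarrow> (\<forall>x y. f (x + y) = f x + f y) \<and> (\<forall>c x. f (c *s x) = c *s f x)"

lemma linear_opD:
  assumes "linear_op f"
  shows "f (x + y) = f x + f y" "f (c *s x) = c *s f x" "f 0 = 0" "f (x - y) = f x - f y"
proof -
  show *: "f (x + y) = f x + f y" "f (c *s x) = c *s f x" for x y c
    using assms by (auto simp: linear_op_def)
  show "f 0 = 0" using *(2)[of 0 0] by simp
  show "f (x - y) = f x - f y"
    using *(1)[of x "(- 1) *s y"] *(2)[of "- 1" y] by simp
qed

lemma linear_X [simp]: "linear_op (X a)"
  and linear_G [simp]: "linear_op (G a)"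
  and linear_intertwiner [simp]: "linear_op (intertwiner a)"
  by (simp_all add: linear_op_def X_add X_scale G_add G_scale intertwiner_scale)
     (simp add: intertwiner_def G_add X_add G_minus algebra_simps)

lemma linear_apply_roots: "linear_op f \<Longrightarrow> linear_op (apply_roots f cs)"
proof (induction cs)
  case (Cons c cs)
  then show ?case
    by (simp add: linear_op_def algebra_simps)
qed (simp add: linear_op_def)

lemma apply_roots_append: "apply_roots f (cs @ ds) x = apply_roots f cs (apply_roots f ds x)"
  by (induction cs) simp_all

lemma apply_roots_commute1:
  assumes "linear_op f"
  shows "apply_roots f cs (f x - c *s x) = f (apply_roots f cs x) - c *s apply_roots f cs x"
proof (induction cs)
  case (Cons d cs)
  let ?z = "apply_roots f cs x"
  have "apply_roots f (d # cs) (f x - c *s x) = f (f ?z - c *s ?z) - d *s (f ?z - c *s ?z)"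
    using Cons by simp
  also have "\<dots> = f (f ?z - d *s ?z) - c *s (f ?z - d *s ?z)"
    by (simp add: linear_opD[OF assms] algebra_simps)
  finally show ?case by simp
qed simp

lemma apply_roots_swap:
  assumes "linear_op f"
  shows "apply_roots f cs (apply_roots f ds x) = apply_roots f ds (apply_roots f cs x)"
  by (induction cs) (simp_all add: apply_roots_commute1[OF assms])

lemma apply_roots_append_0:
  assumes "linear_op f" "apply_roots f cs x = 0"
  shows "apply_roots f (ds @ cs) x = 0" "apply_roots f (cs @ ds) x = 0"
  using linear_opD(3)[OF linear_apply_roots[OF assms(1)]]
  by (simp_all add: apply_roots_append assms(2) apply_roots_swap[OF assms(1), of cs ds])

lemma apply_roots_remove1:
  assumes "linear_op f" "c \<in> set cs"
  shows "apply_roots f cs x = apply_roots f (remove1 c cs) (f x - c *s x)"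
  using assms(2)
proof (induction cs)
  case (Cons d cs)
  show ?case
  proof (cases "c = d")
    case True
    then show ?thesis by (simp add: apply_roots_commute1[OF assms(1)])
  next
    case False
    then show ?thesis using Cons by simp
  qed
qed simp

lemma apply_roots_mset:
  assumes "linear_op f" "mset cs = mset ds"
  shows "apply_roots f cs x = apply_roots f ds x"
  using assms(2)
proof (induction cs arbitrary: ds x)
  case (Cons c cs)
  then have "c \<in> set ds" "mset cs = mset (remove1 c ds)"
    by (metis list.set_intros(1) mset_eq_setD, metis add_mset_remove_trivial mset.simps(2) mset_remove1)
  then show ?case using Cons.IH apply_roots_remove1[OF assms(1), of c ds]
    by (simp flip: apply_roots_commute1[OF assms(1)])
qed simp

lemma apply_roots_superset_0:
  assumes "linear_op f" "mset cs \<subseteq># mset ds" "apply_roots f cs x = 0"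
  shows "apply_roots f ds x = 0"
proof -
  obtain es where es: "mset ds = mset (cs @ es)"
    using assms(2) by (metis ex_mset mset_append mset_subset_eq_exists_conv)
  show ?thesis unfolding apply_roots_mset[OF assms(1) es]
    by (rule apply_roots_append_0[OF assms(1,3)])
qed

lemma apply_roots_eigenvector:
  assumes "linear_op f" "f x = c *s x"
  shows "apply_roots f cs x = (\<Prod>d\<leftarrow>cs. c - d) *s x"
  by (induction cs) (simp_all add: linear_opD[OF assms(1)] assms(2) algebra_simps)

lemma apply_roots_eigenvector_distinct:
  assumes "linear_op f" "f x = c *s x" "c \<notin> set cs" "apply_roots f cs x = 0"
  shows "x = 0"
  using assms(3,4) unfolding apply_roots_eigenvector[OF assms(1,2)] by (auto simp: prod_list_zero_iff)

lemma apply_roots_transfer: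
  assumes "x \<in> W" "\<And>y. y \<in> W \<Longrightarrow> f y \<in> W" "\<And>y z c. y \<in> W \<Longrightarrow> z \<in> W \<Longrightarrow> y - c *s z \<in> W"
    and "linear_op h" "\<And>y. y \<in> W \<Longrightarrow> h (f y) = g (h y)"
  shows "h (apply_roots f cs x) = apply_roots g cs (h x) \<and> apply_roots f cs x \<in> W"
  by (induction cs) (use assms in \<open>auto simp: linear_opD[OF assms(4)]\<close>)

text \<open>
  A Jordan block would give an eigenvector \<open>w = (f - c) x\<close> killed by the product of the remaining
  factors, which acts on it by a nonzero scalar.
\<close>

lemma no_jordan_block:
  assumes f: "linear_op f" and "distinct cs" "apply_roots f cs x = 0" "apply_roots f [c, c] x = 0"
  shows "f x = c *s x"
proof -
  let ?w = "f x - c *s x"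
  have w: "f ?w = c *s ?w" using assms(4) by simp
  have "apply_roots f (remove1 c cs) ?w = 0"
  proof (cases "c \<in> set cs")
    case True
    then show ?thesis using apply_roots_remove1[OF f True, of x] assms(3) by simp
  next
    case False
    then show ?thesis
      using assms(3) by (simp add: remove1_idem apply_roots_commute1[OF f] linear_opD[OF f])
  qed
  moreover have "c \<notin> set (remove1 c cs)" using assms(2) by simp
  ultimately have "?w = 0" using apply_roots_eigenvector_distinct[OF f w] by blast
  then show ?thesis by simp
qed

text \<open>
  Repeated roots are removed one at a time: with a root \<open>c\<close> left over, the other factors produce a
  vector killed by \<open>(f - c)\<^sup>2\<close>, hence by \<open>f - c\<close>.
\<close>

lemma distinct_roots:
  assumes f: "linear_op f" and W: "x \<in> W" "\<And>y. y \<in> W \<Longrightarrow> f y \<in> W" 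
      "\<And>y z c. y \<in> W \<Longrightarrow> z \<in> W \<Longrightarrow> y - c *s z \<in> W"
    and jordan: "\<And>y c. y \<in> W \<Longrightarrow> apply_roots f [c, c] y = 0 \<Longrightarrow> f y = c *s y"
    and "apply_roots f cs x = 0"
  shows "apply_roots f (remdups cs) x = 0"
  using \<open>apply_roots f cs x = 0\<close> W(1)
proof (induction cs arbitrary: x)
  case (Cons c cs)
  let ?y = "f x - c *s x"
  have y: "?y \<in> W" using Cons.prems W by auto
  have "apply_roots f cs ?y = 0" using Cons.prems by (simp add: apply_roots_commute1[OF f])
  from Cons.IH[OF this y] have *: "apply_roots f (remdups cs) ?y = 0" .
  show ?case
  proof (cases "c \<in> set cs")
    case False
    then show ?thesis using * by (simp add: apply_roots_commute1[OF f])
  next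
    case True
    let ?ds = "remove1 c (remdups cs)"
    let ?z = "apply_roots f ?ds x"
    have z: "?z \<in> W"
      using apply_roots_transfer[of x W f id f ?ds] Cons.prems W by (auto simp: linear_op_def)
    have "apply_roots f [c, c] ?z = apply_roots f ?ds (apply_roots f [c, c] x)"
      by (rule apply_roots_swap[OF f])
    also have "\<dots> = apply_roots f ?ds (f ?y - c *s ?y)" by simp
    also have "\<dots> = apply_roots f (remdups cs) ?y"
      using True by (subst (2) apply_roots_remove1[OF f, of c]) auto
    finally have "apply_roots f [c, c] ?z = 0" by (simp only: *)
    from jordan[OF z this] have "apply_roots f ?ds ?y = 0"
      by (simp only: apply_roots_commute1[OF f] diff_self)
    moreover have "apply_roots f (remdups cs) x = apply_roots f ?ds ?y"
      using True by (intro apply_roots_remove1[OF f]) simp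
    ultimately show ?thesis using True by (simp only: remdups.simps if_True)
  qed
qed simp

text \<open>
  Lagrange interpolation, phrased as an induction rule: a vector killed by distinct linear factors is
  a sum of eigenvectors lying in any given \<open>f\<close>-stable subspace that contains it.
\<close>

lemma eigenvector_decomposition:
  assumes f: "linear_op f" and W: "x \<in> W" "\<And>y. y \<in> W \<Longrightarrow> f y \<in> W" 
      "\<And>y z c. y \<in> W \<Longrightarrow> z \<in> W \<Longrightarrow> y - c *s z \<in> W"
    and cs: "distinct cs" "apply_roots f cs x = 0"
    and P: "P 0" "\<And>y z. P y \<Longrightarrow> P z \<Longrightarrow> P (y + z)"
      "\<And>y c. y \<in> W \<Longrightarrow> c \<in> set cs \<Longrightarrow> f y = c *s y \<Longrightarrow> P y"
  shows "P x"
  using cs W(1) P(3)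
proof (induction cs arbitrary: x)
  case Nil
  then show ?case using P(1) by simp
next
  case (Cons c cs)
  let ?z = "apply_roots f cs x"
  let ?k = "\<Prod>d\<leftarrow>cs. c - d"
  have z: "f ?z = c *s ?z" using Cons.prems by simp
  have zW: "?z \<in> W"
    using apply_roots_transfer[of x W f id f cs] Cons.prems W by (auto simp: linear_op_def)
  have k: "?k \<noteq> 0" using Cons.prems(1) by (auto simp: prod_list_zero_iff)
  have W0: "0 \<in> W" using W(3)[OF zW zW, of 1] by simp
  have uW: "(1 / ?k) *s ?z \<in> W" using W(3)[OF W0 zW, of "- 1 / ?k"] by simp
  let ?u = "(1 / ?k) *s ?z"
  have "f ?u = c *s ?u" using z by (simp add: linear_opD[OF f])
  from Cons.prems(4)[OF uW _ this] have Pu: "P ?u" by simp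
  have "apply_roots f cs (x - ?u) = ?z - (1 / ?k) *s apply_roots f cs ?z"
    by (simp add: linear_opD[OF linear_apply_roots[OF f]])
  also have "\<dots> = 0"
    using k by (simp add: apply_roots_eigenvector[OF f z])
  finally have ann: "apply_roots f cs (x - ?u) = 0" .
  have "P (x - ?u)"
  proof (rule Cons.IH[OF _ ann])
    show "distinct cs" using Cons.prems(1) by simp
    show "x - ?u \<in> W" by (rule W(3)[OF Cons.prems(3) zW])
    show "P y" if "y \<in> W" "d \<in> set cs" "f y = d *s y" for y d
      using Cons.prems(4)[OF that(1) _ that(3)] that(2) by simp
  qed
  from P(2)[OF this Pu] show ?case by simp
qed

text \<open>
  The roots must not depend on the colours \<open>\<gamma>\<close>, because \<open>G\<^sub>a\<close> permutes these in the inductive step.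
\<close>

definition semisimple :: "nat \<Rightarrow> bool" where
  "semisimple a \<longleftrightarrow> (\<exists>cs. distinct cs \<and> (\<forall>\<gamma>. \<forall>x\<in>V \<gamma>. apply_roots (X a) cs x = 0))"

definition weight_vectors :: "nat \<Rightarrow> (nat \<Rightarrow> 'f) \<Rightarrow> (nat \<Rightarrow> 'f) \<Rightarrow> 'v set" where
  "weight_vectors m c \<gamma> = {x \<in> V \<gamma>. \<forall>a\<in>{1..m}. X a x = c a *s x}"

definition weight :: "nat \<Rightarrow> (nat \<Rightarrow> 'f) \<Rightarrow> (nat \<Rightarrow> 'f) \<Rightarrow> bool" where
  "weight m c \<gamma> \<longleftrightarrow> (\<exists>x\<in>weight_vectors m c \<gamma>. x \<noteq> 0)"

lemma V_closed: "y \<in> V \<gamma> \<Longrightarrow> z \<in> V \<gamma> \<Longrightarrow> y - c *s z \<in> V \<gamma>"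
  by (intro V_minus V_scale)

lemma weight_vector_induct:
  assumes "m \<le> n" "\<forall>a\<in>{1..m}. semisimple a"
    and "x \<in> W" "W \<subseteq> V \<gamma>" "\<And>y a. y \<in> W \<Longrightarrow> a \<in> {1..m} \<Longrightarrow> X a y \<in> W"
      "\<And>y z c. y \<in> W \<Longrightarrow> z \<in> W \<Longrightarrow> y - c *s z \<in> W"
    and P: "P 0" "\<And>y z. P y \<Longrightarrow> P z \<Longrightarrow> P (y + z)"
      "\<And>y c. y \<in> W \<Longrightarrow> y \<in> weight_vectors m c \<gamma> \<Longrightarrow> P y"
  shows "P x"
  using assms(1-3,5) P(3)
proof (induction m)
  case 0
  then show ?case using assms(4) by (auto simp: weight_vectors_def)
next
  case (Suc m)
  show ?case
  proof (rule Suc.IH)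
    fix y c
    assume y: "y \<in> W" "y \<in> weight_vectors m c \<gamma>"
    obtain cs where cs: "distinct cs" "\<And>x. x \<in> V \<gamma> \<Longrightarrow> apply_roots (X (Suc m)) cs x = 0"
    proof -
      have "semisimple (Suc m)" using Suc.prems(2) by simp
      then show ?thesis using that unfolding semisimple_def by blast
    qed
    let ?W = "W \<inter> weight_vectors m c \<gamma>"
    show "P y"
    proof (rule eigenvector_decomposition[where f = "X (Suc m)" and W = ?W and cs = cs])
      fix z assume z: "z \<in> ?W"
      have "X a (X (Suc m) z) = c a *s X (Suc m) z" if "a \<in> {1..m}" for a
        using that z Suc.prems(1) X_commute[of a "Suc m" z] by (simp add: weight_vectors_def X_scale)
      then show "X (Suc m) z \<in> ?W"
        using z Suc.prems by (auto simp: weight_vectors_def intro: X_V)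
    next
      fix z z' d assume "z \<in> ?W" "z' \<in> ?W"
      then show "z - d *s z' \<in> ?W"
        using assms(6) by (auto simp: weight_vectors_def V_closed X_minus X_scale algebra_simps)
    next
      fix z d assume z: "z \<in> ?W" "X (Suc m) z = d *s z"
      have "z \<in> weight_vectors (Suc m) (c(Suc m := d)) \<gamma>"
        using z by (auto simp: weight_vectors_def le_Suc_eq)
      then show "P z" using Suc.prems(5) z by blast
    qed (use y cs P assms(4) in \<open>auto simp: weight_vectors_def\<close>)
  qed (use Suc.prems in auto)
qed

end

section \<open>Weights are balanced\<close>

lemma power_int_generic_inj:
  fixes v :: "'f::field"
  assumes "v \<noteq> 0" "\<And>i. 0 < i \<Longrightarrow> v ^ i \<noteq> 1" "v powi i = v powi j"
  shows "i = j"
proof -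
  have *: False if "i < j" "v powi i = v powi j" for i j
  proof -
    have "v powi i * v powi (j - i) = v powi i * 1"
      using that assms(1) power_int_add[of v i "j - i"] by simp
    then have "v powi (j - i) = 1" using assms(1) by simp
    then have "v ^ nat (j - i) = 1" using that by (simp add: power_int_def)
    then show False using assms(2)[of "nat (j - i)"] that by simp
  qed
  show ?thesis using *[of i j] *[of j i] assms(3) by (cases i j rule: linorder_cases) auto
qed

context yh_module
begin

declare X.simps(3) [simp del]

lemma v_neq_1: "v \<noteq> 1"
  using v_generic[of 1] by simp

lemma v_neq_minus_1: "v + 1 \<noteq> 0"
proof
  assume "v + 1 = 0"
  then have "v = - 1" by (simp add: add_eq_0_iff2)
  then have "v ^ 2 = 1" by simp
  then show False using v_generic[of 2] by simp
qed

lemma powi_inj: "v powi i = v powi j \<longleftrightarrow> i = j"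
  using power_int_generic_inj[of v i j] v_nz v_generic by auto

lemma G_inj:
  assumes "b \<in> {1..<n}" "x \<in> V \<gamma>" "G b x = 0"
  shows "x = 0"
proof (cases "\<gamma> b = \<gamma> (Suc b)")
  case True
  then show ?thesis using GG_same[OF assms(1) True assms(2)] assms(3) v_nz by simp
next
  case False
  then show ?thesis using GG_diff[OF assms(1) False assms(2)] assms(3) v_nz by simp
qed

lemma X_inj: "a \<le> n \<Longrightarrow> x \<in> V \<gamma> \<Longrightarrow> X a x = 0 \<Longrightarrow> x = 0"
proof (induction a x arbitrary: \<gamma> rule: X.induct)
  case (3 a x)
  have b: "Suc a \<in> {1..<n}" using 3 by auto
  note Gx = G_V[OF 3(3) b]
  have "X (Suc a) (G (Suc a) x) = 0"
    using 3 v_nz by (intro G_inj[OF b X_V[OF Gx]]) (auto simp: X.simps(3))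
  then have "G (Suc a) x = 0" using 3 Gx by auto
  then show ?case using G_inj[OF b] 3 by blast
qed simp_all

lemma X_G_apart: "b \<in> {1..<n} \<Longrightarrow> a \<in> {1..n} \<Longrightarrow> a \<noteq> b \<Longrightarrow> a \<noteq> Suc b \<Longrightarrow> X a (G b x) = G b (X a x)"
  using G_X_commute[of b a x] by simp

lemma weight_vectors_intertwiner:
  assumes "x \<in> weight_vectors m c \<gamma>" "m \<le> n" "1 \<le> b" "Suc b \<le> m" "\<gamma> b = \<gamma> (Suc b)"
  shows "intertwiner b x \<in> weight_vectors m (c \<circ> transpose b (Suc b)) \<gamma>"
proof -
  have b: "b \<in> {1..<n}" using assms by auto
  have x: "x \<in> V \<gamma>" using assms by (simp add: weight_vectors_def)
  have "X a (intertwiner b x) = c (transpose b (Suc b) a) *s intertwiner b x" if a: "a \<in> {1..m}" for a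
  proof -
    consider "a = b" | "a = Suc b" | "a \<noteq> b" "a \<noteq> Suc b" by blast
    then show ?thesis
    proof cases
      case 1
      then show ?thesis using X_intertwiner[OF b assms(5) x] assms
        by (simp add: weight_vectors_def intertwiner_scale)
    next
      case 2
      then show ?thesis using X_intertwiner[OF b assms(5) x] assms
        by (simp add: weight_vectors_def intertwiner_scale)
    next
      case 3
      have "X a (intertwiner b x) = intertwiner b (X a x)"
        using 3 a assms b X_commute[of a b] X_commute[of a "Suc b"]
        by (simp add: intertwiner_def X_add X_scale X_minus X_G_apart)
      then show ?thesis using 3 a assms(1) by (simp add: weight_vectors_def intertwiner_scale)
    qed
  qed
  then show ?thesis using intertwiner_V[OF b assms(5) x] by (simp add: weight_vectors_def)
qed

lemma weight_vectors_G:
  assumes "x \<in> weight_vectors m c \<gamma>" "m \<le> n" "1 \<le> b" "Suc b \<le> m" "\<gamma> b \<noteq> \<gamma> (Suc b)"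
  shows "G b x \<in> weight_vectors m (c \<circ> transpose b (Suc b)) (\<gamma> \<circ> transpose b (Suc b))"
proof -
  have b: "b \<in> {1..<n}" using assms by auto
  have x: "x \<in> V \<gamma>" using assms by (simp add: weight_vectors_def)
  have "X a (G b x) = c (transpose b (Suc b) a) *s G b x" if a: "a \<in> {1..m}" for a
  proof -
    consider "a = b" | "a = Suc b" | "a \<noteq> b" "a \<noteq> Suc b" by blast
    then show ?thesis
      using Suc_X_G_diff[OF b assms(5) x] X_G_apart[of b a x] assms a b
      by cases (auto simp: weight_vectors_def G_scale)
  qed
  then show ?thesis using G_V[OF x b] by (simp add: weight_vectors_def)
qed

lemma weight_content_nz: "weight m c \<gamma> \<Longrightarrow> m \<le> n \<Longrightarrow> a \<in> {1..m} \<Longrightarrow> c a \<noteq> 0"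
  using X_inj[of a _ \<gamma>] by (force simp: weight_def weight_vectors_def)

text \<open>
  If both \<open>X\<^sub>a\<close> and \<open>X\<^sub>a\<^sub>+\<^sub>1\<close> acted on \<open>x\<close> by \<open>c\<close>, then \<open>(X\<^sub>a - c) G\<^sub>a x\<close> would be a nonzero multiple of
  \<open>x\<close>, a Jordan block.
\<close>

lemma weight_no_repeat:
  assumes "weight m c \<gamma>" "m \<le> n" "1 \<le> a" "Suc a \<le> m" "semisimple a" "\<gamma> a = \<gamma> (Suc a)"
  shows "c (Suc a) \<noteq> c a"
proof
  assume eq: "c (Suc a) = c a"
  have a: "a \<in> {1..<n}" using assms by auto
  obtain x where x: "x \<in> V \<gamma>" "x \<noteq> 0" "X a x = c a *s x" "X (Suc a) x = c a *s x"
    using assms eq by (auto simp: weight_def weight_vectors_def)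
  have XG: "X a (G a x) - c a *s G a x = (- (v - 1) * c a) *s x"
    using X_G_same[OF a assms(6) x(1)] x by (simp add: G_scale algebra_simps)
  have "apply_roots (X a) [c a, c a] (G a x) = 0"
    using x XG by (simp add: X_scale mult.commute)
  moreover obtain cs where "distinct cs" "apply_roots (X a) cs (G a x) = 0"
    using assms(5) G_V_same[OF a assms(6) x(1)] unfolding semisimple_def by blast
  ultimately have "X a (G a x) = c a *s G a x"
    by (intro no_jordan_block[of "X a" cs]) auto
  then show False using XG x v_neq_1 weight_content_nz[OF assms(1,2), of a] assms(3,4) by simp
qed

lemma intertwiner_twice_weight:
  assumes "b \<in> {1..<n}" "\<gamma> b = \<gamma> (Suc b)" "x \<in> V \<gamma>" "X b x = a *s x" "X (Suc b) x = a' *s x"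
  shows "intertwiner b (intertwiner b x) = ((v * a - a') * (v * a' - a)) *s x"
  unfolding intertwiner_twice[OF assms(1-4)] using assms(5)
  by (simp add: X_minus X_scale algebra_simps)

lemma weight_swap:
  assumes "weight m c \<gamma>" "m \<le> n" "1 \<le> a" "Suc a \<le> m"
    and "\<gamma> a \<noteq> \<gamma> (Suc a) \<or> c (Suc a) \<noteq> v * c a \<and> c (Suc a) \<noteq> c a / v"
  shows "weight m (c \<circ> transpose a (Suc a)) (\<gamma> \<circ> transpose a (Suc a))"
proof -
  have a: "a \<in> {1..<n}" using assms by auto
  obtain x where x: "x \<in> weight_vectors m c \<gamma>" "x \<noteq> 0"
    using assms by (auto simp: weight_def)
  then have xV: "x \<in> V \<gamma>" and Xx: "X a x = c a *s x" "X (Suc a) x = c (Suc a) *s x"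
    using assms by (auto simp: weight_vectors_def)
  show ?thesis
  proof (cases "\<gamma> a = \<gamma> (Suc a)")
    case False
    then show ?thesis using weight_vectors_G[OF x(1) assms(2-4) False] G_inj[OF a xV] x(2)
      by (auto simp: weight_def)
  next
    case True
    have "v * c a - c (Suc a) \<noteq> 0" "v * c (Suc a) - c a \<noteq> 0"
      using assms(5) True v_nz by (auto simp: field_simps)
    then have "(v * c a - c (Suc a)) * (v * c (Suc a) - c a) \<noteq> 0" by simp
    then have "intertwiner a (intertwiner a x) \<noteq> 0"
      using intertwiner_twice_weight[OF a True xV Xx] x(2) by simp
    then have "intertwiner a x \<noteq> 0" by auto
    then show ?thesis using weight_vectors_intertwiner[OF x(1) assms(2-4) True] transpose_same[of \<gamma> a] True
      by (auto simp: weight_def)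
  qed
qed

text \<open>
  The vanishing of the intertwiner is a linear equation for \<open>G\<^sub>b x\<close> with leading coefficient \<open>a - a'\<close>,
  which is nonzero for neighbouring contents.
\<close>

lemma G_on_neighbours:
  assumes b: "b \<in> {1..<n}" "\<gamma> b = \<gamma> (Suc b)" and x: "x \<in> V \<gamma>" "X b x = a *s x" "X (Suc b) x = a' *s x"
    and "intertwiner b x = 0" "a \<noteq> 0"
  shows "a' = v * a \<Longrightarrow> G b x = v *s x" and "a' = a / v \<Longrightarrow> G b x = (- 1) *s x"
proof -
  have eq: "(a - a') *s G b x = (- (v - 1) * a') *s x"
    using assms(6) x by (simp add: intertwiner_def G_minus G_scale algebra_simps eq_neg_iff_add_eq_0)
  show "G b x = v *s x" if "a' = v * a"
  proof -
    have "(a - a') *s G b x = (a - a') *s (v *s x)"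
      unfolding eq using that by (simp add: algebra_simps)
    moreover have "a - a' \<noteq> 0" using that assms(7) v_neq_1 by simp
    ultimately show ?thesis by (simp only: scale_cancel_left) simp
  qed
  show "G b x = (- 1) *s x" if "a' = a / v"
  proof -
    have "(a - a') *s G b x = (a - a') *s ((- 1) *s x)"
      unfolding eq using that v_nz by (simp add: field_simps)
    moreover have "a - a' \<noteq> 0" using that assms(7) v_neq_1 v_nz by (auto simp: field_simps)
    ultimately show ?thesis by (simp only: scale_cancel_left) simp
  qed
qed

text \<open>
  On such a weight vector both intertwiners vanish, since they lead to weights with a repetition; then
  \<open>G\<^sub>a\<close> and \<open>G\<^sub>a\<^sub>+\<^sub>1\<close> act by the two different scalars \<open>v\<close> and \<open>-1\<close>, against the braid relation.
\<close>

lemma weight_no_return: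
  assumes w: "weight m c \<gamma>" and m: "m \<le> n" and a: "1 \<le> a" "Suc (Suc a) \<le> m" 
    and ss: "semisimple a" "semisimple (Suc a)"
    and \<gamma>: "\<gamma> (Suc a) = \<gamma> a" "\<gamma> (Suc (Suc a)) = \<gamma> a"
    and nb: "c (Suc a) = v * c a \<or> c (Suc a) = c a / v"
  shows "c (Suc (Suc a)) \<noteq> c a"
proof
  assume eq: "c (Suc (Suc a)) = c a"
  have a': "a \<in> {1..<n}" "Suc a \<in> {1..<n}" using a m by auto
  have g: "\<gamma> a = \<gamma> (Suc a)" "\<gamma> (Suc a) = \<gamma> (Suc (Suc a))" using \<gamma> by auto
  obtain x where x: "x \<in> weight_vectors m c \<gamma>" "x \<noteq> 0"
    using w by (auto simp: weight_def)
  then have xV: "x \<in> V \<gamma>" and Xx: "X a x = c a *s x" "X (Suc a) x = c (Suc a) *s x"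
    "X (Suc (Suc a)) x = c a *s x"
    using a eq by (auto simp: weight_vectors_def)
  have nz: "c a \<noteq> 0" "c (Suc a) \<noteq> 0"
    using weight_content_nz[OF w m, of a] weight_content_nz[OF w m, of "Suc a"] a by auto
  have i1: "intertwiner a x = 0"
  proof (rule ccontr)
    assume "intertwiner a x \<noteq> 0"
    then have "weight m (c \<circ> transpose a (Suc a)) \<gamma>"
      using weight_vectors_intertwiner[OF x(1) m a(1) _ g(1)] a by (auto simp: weight_def)
    from weight_no_repeat[OF this m _ a(2) ss(2) g(2)] show False using eq by (simp add: transpose_def)
  qed
  have i2: "intertwiner (Suc a) x = 0"
  proof (rule ccontr)
    assume "intertwiner (Suc a) x \<noteq> 0"
    then have "weight m (c \<circ> transpose (Suc a) (Suc (Suc a))) \<gamma>"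
      using weight_vectors_intertwiner[OF x(1) m _ a(2) g(2)] by (auto simp: weight_def)
    from weight_no_repeat[OF this m a(1) _ ss(1) g(1)] show False using eq a by (simp add: transpose_def)
  qed
  obtain l l' where l: "G a x = l *s x" "G (Suc a) x = l' *s x" "l \<noteq> 0" "l' \<noteq> 0" "l \<noteq> l'"
  proof -
    have vm: "v \<noteq> - 1" using v_neq_minus_1 by auto
    from nb show ?thesis
    proof
      assume *: "c (Suc a) = v * c a"
      have "G a x = v *s x" using G_on_neighbours(1)[OF a'(1) g(1) xV Xx(1,2) i1 nz(1)] * by simp
      moreover have "G (Suc a) x = (- 1) *s x"
        using G_on_neighbours(2)[OF a'(2) g(2) xV Xx(2,3) i2 nz(2)] * v_nz by simp
      ultimately show ?thesis using that[of v "- 1"] v_nz vm by simp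
    next
      assume *: "c (Suc a) = c a / v"
      have "G a x = (- 1) *s x" using G_on_neighbours(2)[OF a'(1) g(1) xV Xx(1,2) i1 nz(1)] * by simp
      moreover have "G (Suc a) x = v *s x"
        using G_on_neighbours(1)[OF a'(2) g(2) xV Xx(2,3) i2 nz(2)] * v_nz by simp
      ultimately show ?thesis using that[of "- 1" v] v_nz vm by simp
    qed
  qed
  have "G a (G (Suc a) (G a x)) = G (Suc a) (G a (G (Suc a) x))"
    using a m by (intro G_braid) auto
  then have "(l * l * l') *s x = (l' * l' * l) *s x"
    by (simp add: l G_scale mult.commute mult.left_commute)
  then show False using l x(2) by simp
qed

definition weight_letters :: "nat \<Rightarrow> (nat \<Rightarrow> 'f \<times> 'f) set" where
  "weight_letters m = {\<lambda>a. (c a, \<gamma> a) | c \<gamma>. weight m c \<gamma>}"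

lemma swap_stable_weights:
  assumes m: "m \<le> n" and ss: "\<forall>a\<in>{1..<m}. semisimple a"
  shows "swap_stable_sequences (\<lambda>(c, p). (v * c, p)) (\<lambda>(c, p). (c / v, p)) (\<lambda>(c, p). c = 1) (weight_letters m) m"
proof
  fix s assume "s \<in> weight_letters m"
  then obtain c \<gamma> where s: "s = (\<lambda>a. (c a, \<gamma> a))" and w: "weight m c \<gamma>"
    by (auto simp: weight_letters_def)
  show "case s 1 of (c, p) \<Rightarrow> c = 1" if "1 \<le> m"
  proof -
    obtain x where x: "x \<noteq> 0" "\<forall>a\<in>{1..m}. X a x = c a *s x"
      using w by (auto simp: weight_def weight_vectors_def)
    have "1 *s x = c 1 *s x" using bspec[OF x(2), of 1] that by simp
    then show ?thesis using \<open>x \<noteq> 0\<close> by (simp only: scale_cancel_right s) simp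
  qed
  show "s (Suc a) \<noteq> s a" if "1 \<le> a" "Suc a \<le> m" for a
    using weight_no_repeat[OF w m that] ss that by (auto simp: s)
  show "s \<circ> transpose a (Suc a) \<in> weight_letters m"
    if "1 \<le> a" "Suc a \<le> m" "s (Suc a) \<noteq> (case s a of (c, p) \<Rightarrow> (v * c, p))"
      "s (Suc a) \<noteq> (case s a of (c, p) \<Rightarrow> (c / v, p))" for a
  proof -
    let ?t = "transpose a (Suc a)"
    have "weight m (c \<circ> ?t) (\<gamma> \<circ> ?t)"
      using weight_swap[OF w m that(1,2)] that(3,4) by (auto simp: s)
    moreover have "s \<circ> ?t = (\<lambda>a. ((c \<circ> ?t) a, (\<gamma> \<circ> ?t) a))"
      by (simp add: s fun_eq_iff)
    ultimately show ?thesis unfolding weight_letters_def by blast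
  qed
  show "s (Suc (Suc a)) \<noteq> s a"
    if "1 \<le> a" "Suc (Suc a) \<le> m" "s (Suc a) = (case s a of (c, p) \<Rightarrow> (v * c, p)) \<or>
      s (Suc a) = (case s a of (c, p) \<Rightarrow> (c / v, p))" for a
    using weight_no_return[OF w m that(1,2)] that(3) ss that(1,2) by (auto simp: s)
qed (use v_nz in auto)

text \<open>
  The contents are powers of \<open>v\<close> because a content different from 1 has a neighbour before it. To see
  that the sequence is balanced, it remains to know which of the letters \<open>v\<^sup>e\<close> and \<open>v\<^sup>e\<^sup>+\<^sup>1\<close> comes first:
  following neighbours backwards from an exponent beyond \<open>e\<close> one has to pass through \<open>e\<close> before
  reaching 0.
\<close>

lemma weight_contents:
  assumes w: "weight m c \<gamma>" and m: "m \<le> n" and ss: "\<forall>a\<in>{1..<m}. semisimple a"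
  obtains k where "\<And>a. a \<in> {1..m} \<Longrightarrow> c a = v powi k a"
    "balanced m (\<lambda>a. (k a, \<gamma> a))"
proof -
  interpret Q: swap_stable_sequences "\<lambda>(c, p). (v * c, p)" "\<lambda>(c, p). (c / v, p)" "\<lambda>(c, p). c = 1"
    "weight_letters m" m
    by (rule swap_stable_weights[OF m ss])
  let ?s = "\<lambda>a. (c a, \<gamma> a)"
  have s: "?s \<in> weight_letters m" using w by (auto simp: weight_letters_def)
  have nb: "\<exists>i\<in>{1..<b}. \<gamma> i = \<gamma> b \<and> (c i = v * c b \<or> c i = c b / v)"
    if "1 \<le> b" "b \<le> m" "c b \<noteq> 1" for b
    using Q.neighbour_before[OF s that(1,2)] that(3) by auto
  have "\<exists>k. c a = v powi k" if "a \<in> {1..m}" for a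
    using that
  proof (induction a rule: less_induct)
    case (less a)
    show ?case
    proof (cases "c a = 1")
      case True
      then show ?thesis by (intro exI[of _ 0]) simp
    next
      case False
      then obtain i where i: "i \<in> {1..<a}" "c i = v * c a \<or> c i = c a / v"
        using nb[of a] less.prems by auto
      then obtain k where k: "c i = v powi k" using less by auto
      have "c a = v powi (k - 1) \<or> c a = v powi (k + 1)"
        using i(2) k v_nz by (auto simp: power_int_diff power_int_add field_simps)
      then show ?thesis by blast
    qed
  qed
  then obtain k where k: "\<And>a. a \<in> {1..m} \<Longrightarrow> c a = v powi k a" by metis
  have up: "v * v powi i = v powi (i + 1)" "v powi i / v = v powi (i - 1)" for i
    using v_nz by (simp_all add: power_int_add power_int_diff)
  have nbk: "\<exists>i\<in>{1..<b}. \<gamma> i = \<gamma> b \<and> (k i = k b + 1 \<or> k i = k b - 1)"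
    if b: "1 \<le> b" "b \<le> m" "k b \<noteq> 0" for b
  proof -
    have "c b \<noteq> 1" using k[of b] b powi_inj[of "k b" 0] by simp
    then obtain i where i: "i \<in> {1..<b}" "\<gamma> i = \<gamma> b" "c i = v * c b \<or> c i = c b / v"
      using nb b by blast
    then have "k i = k b + 1 \<or> k i = k b - 1"
      using k[of i] k[of b] b by (simp add: up powi_inj)
    then show ?thesis using i by blast
  qed
  have before_pos: "\<exists>i\<in>{1..<b}. \<gamma> i = \<gamma> b \<and> k i = e" if "1 \<le> b" "b \<le> m" "0 \<le> e" "e < k b" for b e
    using that
  proof (induction b rule: less_induct)
    case (less b)
    then obtain i where i: "i \<in> {1..<b}" "\<gamma> i = \<gamma> b" "k i = k b + 1 \<or> k i = k b - 1"
      using nbk[of b] by auto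
    show ?case
    proof (cases "k i = e")
      case False
      then have "\<exists>j\<in>{1..<i}. \<gamma> j = \<gamma> i \<and> k j = e" using less i by (intro less.IH) auto
      then show ?thesis using i by fastforce
    qed (use i in blast)
  qed
  have before_neg: "\<exists>i\<in>{1..<b}. \<gamma> i = \<gamma> b \<and> k i = e" if "1 \<le> b" "b \<le> m" "e \<le> 0" "k b < e" for b e
    using that
  proof (induction b rule: less_induct)
    case (less b)
    then obtain i where i: "i \<in> {1..<b}" "\<gamma> i = \<gamma> b" "k i = k b + 1 \<or> k i = k b - 1"
      using nbk[of b] by auto
    show ?case
    proof (cases "k i = e")
      case False
      then have "\<exists>j\<in>{1..<i}. \<gamma> j = \<gamma> i \<and> k j = e" using less i by (intro less.IH) auto
      then show ?thesis using i by fastforce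
    qed (use i in blast)
  qed
  have occ: "occurrences (\<lambda>a. (k a, \<gamma> a)) (e, p) j = occurrences ?s (v powi e, p) j" if "j \<le> m" for e p j
    unfolding occurrences_def
    by (rule arg_cong[of _ _ card]) (use k powi_inj that in auto)
  have "balanced m (\<lambda>a. (k a, \<gamma> a))"
    unfolding balanced_def
  proof (intro allI impI conjI)
    fix j e p assume j: "j \<le> m"
    show "occurrences (\<lambda>a. (k a, \<gamma> a)) (e + 1, p) j \<le> occurrences (\<lambda>a. (k a, \<gamma> a)) (e, p) j"
      "occurrences (\<lambda>a. (k a, \<gamma> a)) (e, p) j \<le> Suc (occurrences (\<lambda>a. (k a, \<gamma> a)) (e + 1, p) j)"
      if e: "0 \<le> e"
    proof -
      have "\<exists>i\<in>{1..<b}. ?s i = (v powi e, p)" if b: "1 \<le> b" "b \<le> m" "?s b = (v powi (e + 1), p)" for b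
      proof -
        have "k b = e + 1" "\<gamma> b = p" using b k[of b] by (simp_all add: powi_inj)
        then obtain i where "i \<in> {1..<b}" "\<gamma> i = p" "k i = e"
          using before_pos[of b e] b e by auto
        then show ?thesis using k[of i] b by (intro bexI[of _ i]) auto
      qed
      then show "occurrences (\<lambda>a. (k a, \<gamma> a)) (e + 1, p) j \<le> occurrences (\<lambda>a. (k a, \<gamma> a)) (e, p) j"
        "occurrences (\<lambda>a. (k a, \<gamma> a)) (e, p) j \<le> Suc (occurrences (\<lambda>a. (k a, \<gamma> a)) (e + 1, p) j)"
        using Q.alternating[OF s, of "(v powi (e + 1), p)" "(v powi e, p)" j] j
        by (simp_all add: occ up powi_inj)
    qed
    show "occurrences (\<lambda>a. (k a, \<gamma> a)) (e - 1, p) j \<le> occurrences (\<lambda>a. (k a, \<gamma> a)) (e, p) j"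
      "occurrences (\<lambda>a. (k a, \<gamma> a)) (e, p) j \<le> Suc (occurrences (\<lambda>a. (k a, \<gamma> a)) (e - 1, p) j)"
      if e: "e \<le> 0"
    proof -
      have "\<exists>i\<in>{1..<b}. ?s i = (v powi e, p)" if b: "1 \<le> b" "b \<le> m" "?s b = (v powi (e - 1), p)" for b
      proof -
        have "k b = e - 1" "\<gamma> b = p" using b k[of b] by (simp_all add: powi_inj)
        then obtain i where "i \<in> {1..<b}" "\<gamma> i = p" "k i = e"
          using before_neg[of b e] b e by auto
        then show ?thesis using k[of i] b by (intro bexI[of _ i]) auto
      qed
      then show "occurrences (\<lambda>a. (k a, \<gamma> a)) (e - 1, p) j \<le> occurrences (\<lambda>a. (k a, \<gamma> a)) (e, p) j"
        "occurrences (\<lambda>a. (k a, \<gamma> a)) (e, p) j \<le> Suc (occurrences (\<lambda>a. (k a, \<gamma> a)) (e - 1, p) j)"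
        using Q.alternating[OF s, of "(v powi (e - 1), p)" "(v powi e, p)" j] j
        by (simp_all add: occ up powi_inj)
    qed
  qed
  then show ?thesis using that[of k] k by blast
qed

text \<open>
  A partition does not have addable nodes on two adjacent diagonals: the balance between these
  diagonals tells which of them is to be filled next.
\<close>

lemma weight_continuation:
  assumes w: "weight (Suc m) c \<gamma>" and w': "weight (Suc m) c' \<gamma>"
    and m: "Suc m \<le> n" and ss: "\<forall>a\<in>{1..m}. semisimple a"
    and same: "\<And>a. a \<in> {1..m} \<Longrightarrow> c' a = c a"
  shows "c' (Suc m) \<noteq> v * c (Suc m)"
proof
  assume eq: "c' (Suc m) = v * c (Suc m)"
  have ss': "\<forall>a\<in>{1..<Suc m}. semisimple a" using ss by auto
  obtain k where k: "\<And>a. a \<in> {1..Suc m} \<Longrightarrow> c a = v powi k a" and bal: "balanced (Suc m) (\<lambda>a. (k a, \<gamma> a))"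
    using weight_contents[OF w m ss'] by blast
  obtain k' where k': "\<And>a. a \<in> {1..Suc m} \<Longrightarrow> c' a = v powi k' a" and bal': "balanced (Suc m) (\<lambda>a. (k' a, \<gamma> a))"
    using weight_contents[OF w' m ss'] by blast
  have kk: "k' a = k a" if "a \<in> {1..m}" for a
    using same[OF that] k[of a] k'[of a] that by (simp add: powi_inj)
  have "v powi k' (Suc m) = v powi (k (Suc m) + 1)"
    using eq k[of "Suc m"] k'[of "Suc m"] v_nz by (simp add: power_int_add)
  then have kS: "k' (Suc m) = k (Suc m) + 1" by (simp add: powi_inj)
  let ?e = "k (Suc m)" and ?p = "\<gamma> (Suc m)"
  have occ: "occurrences (\<lambda>a. (k' a, \<gamma> a)) l m = occurrences (\<lambda>a. (k a, \<gamma> a)) l m" for l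
    unfolding occurrences_def by (rule arg_cong[of _ _ card]) (use kk in auto)
  show False
  proof (cases "0 \<le> ?e")
    case True
    from bal[unfolded balanced_def, rule_format, of "Suc m" ?e ?p] 
      bal'[unfolded balanced_def, rule_format, of "Suc m" ?e ?p] True
    show False by (simp add: kS occ)
  next
    case False
    from bal[unfolded balanced_def, rule_format, of "Suc m" "?e + 1" ?p] 
      bal'[unfolded balanced_def, rule_format, of "Suc m" "?e + 1" ?p] False
    show False by (simp add: kS occ)
  qed
qed

end

section \<open>Semisimplicity of the Jucys--Murphy elements\<close>

context yh_module
begin

lemma subset_mset_remdups:
  assumes "distinct cs" "set cs \<subseteq> set ds"
  shows "mset cs \<subseteq># mset (remdups ds)"
proof -
  have "mset cs = mset_set (set cs)" using assms(1) by (simp add: mset_set_set)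
  also have "\<dots> \<subseteq># mset_set (set ds)" using assms(2) by (intro subset_imp_msubset_mset_set) auto
  also have "\<dots> = mset (remdups ds)" by (metis distinct_remdups mset_set_set set_remdups)
  finally show ?thesis .
qed

text \<open>
  With \<open>A = X\<^sub>b\<close> acting by \<open>a\<close> and \<open>B = X\<^sub>b\<^sub>+\<^sub>1\<close>: a Jordan block of \<open>B\<close> with eigenvalue \<open>v\<close> or
  \<open>v\<^sup>-\<^sup>1\<close> times \<open>a\<close> that is killed by the intertwiner would give \<open>G\<^sub>b\<close> a Jordan block, whereas
  \<open>G\<^sub>b\<close> has the distinct eigenvalues \<open>v\<close> and \<open>-1\<close>.
\<close>

lemma no_jordan_block_neighbours:
  assumes b: "b \<in> {1..<n}" "\<gamma> b = \<gamma> (Suc b)" and x: "x \<in> V \<gamma>" "X b x = a *s x" and a: "a \<noteq> 0"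
    and y: "X (Suc b) x = d *s x + y" "X (Suc b) y = d *s y" "y \<in> V \<gamma>" "X b y = a *s y"
    and i: "intertwiner b x = 0" "intertwiner b y = 0" and d: "d = v * a \<or> d = a / v"
  shows "y = 0"
proof -
  obtain l where l: "G b y = l *s y" "d = v * a \<and> l = v \<or> d = a / v \<and> l = - 1"
    using d G_on_neighbours[OF b y(3,4,2) i(2) a] by blast
  have ad: "a - d \<noteq> 0" using d a v_neq_1 v_nz by (auto simp: field_simps)
  have ld: "l * (a - d) = - (v - 1) * d" using l(2) v_nz by (auto simp: field_simps)
  define \<mu> where "\<mu> = (l - (v - 1)) / (a - d)"
  have mu: "(a - d) * \<mu> = l - (v - 1)" using ad by (simp add: \<mu>_def)
  have "\<mu> \<noteq> 0" using ad v_nz l(2) by (auto simp: \<mu>_def)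
  have "G b (X b x - X (Suc b) x) + (v - 1) *s X (Suc b) x = 0"
    using i(1) by (simp add: intertwiner_def)
  then have "(a - d) *s G b x = l *s y - (v - 1) *s (d *s x + y)"
    by (simp add: x y(1) G_minus G_add G_scale l(1) algebra_simps)
  also have "\<dots> = (- (v - 1) * d) *s x + (l - (v - 1)) *s y"
    by (simp add: algebra_simps)
  also have "\<dots> = (l * (a - d)) *s x + ((a - d) * \<mu>) *s y"
    by (simp only: ld mu)
  also have "\<dots> = (a - d) *s (l *s x + \<mu> *s y)"
    by (simp add: scale_right_distrib mult.commute)
  finally have Gx: "G b x = l *s x + \<mu> *s y"
    using ad by (simp only: scale_cancel_left) simp
  have "G b (G b x) = (l * l) *s x + (2 * l * \<mu>) *s y"
    by (simp add: Gx G_add G_scale l(1) scale_right_distrib algebra_simps flip: scale_left_distrib)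
  moreover have "G b (G b x) = (v + (v - 1) * l) *s x + ((v - 1) * \<mu>) *s y"
    unfolding GG_same[OF b x(1)] by (simp add: Gx scale_right_distrib scale_left_distrib)
  moreover have "l * l = v + (v - 1) * l" using l(2) by (auto simp: algebra_simps)
  ultimately have "(2 * l * \<mu>) *s y = ((v - 1) * \<mu>) *s y" by auto
  then have "(2 * l * \<mu> - (v - 1) * \<mu>) *s y = 0"
    by (simp only: scale_left_diff_distrib diff_self)
  then have "((2 * l - (v - 1)) * \<mu>) *s y = 0"
    by (simp only: left_diff_distrib[of "2 * l"])
  moreover have "2 * l - (v - 1) \<noteq> 0"
    using l(2) v_neq_minus_1 by (auto simp: algebra_simps)
  ultimately show "y = 0" using \<open>\<mu> \<noteq> 0\<close> by simp
qed

text \<open>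
  On a simultaneous eigenvector of \<open>X\<^sub>1, \<dots>, X\<^sub>m\<close> the intertwiner carries a Jordan block of \<open>X\<^sub>m\<^sub>+\<^sub>1\<close> over
  to \<open>X\<^sub>m\<close>, which has none. So the intertwiner kills the eigenvector of the block and the contents in
  positions \<open>m\<close>, \<open>m + 1\<close> are neighbours. If the intertwiner did not kill the whole block, both contents
  could follow the same sequence of length \<open>m - 1\<close>, contrary to the balance of weights.
\<close>

lemma semisimple_Suc_no_jordan_block:
  assumes m: "1 \<le> m" "Suc m \<le> n" and ss: "\<forall>a\<in>{1..m}. semisimple a"
    and g: "\<gamma> m = \<gamma> (Suc m)" and x: "x \<in> V \<gamma>" "apply_roots (X (Suc m)) [d, d] x = 0"
  shows "X (Suc m) x = d *s x"
proof -
  let ?B = "X (Suc m)"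
  have b: "m \<in> {1..<n}" using m by auto
  define W where "W = {y \<in> V \<gamma>. apply_roots ?B [d, d] y = 0}"
  show ?thesis
  proof (rule weight_vector_induct[where m = m and W = W and \<gamma> = \<gamma> and x = x])
    fix y a assume y: "y \<in> W" and a: "a \<in> {1..m}"
    have "apply_roots ?B [d, d] (X a y) = X a (apply_roots ?B [d, d] y)"
      using a m X_commute[of a "Suc m"] by (simp add: X_minus X_scale)
    then show "X a y \<in> W" using y a m by (auto simp: W_def X_V simp del: apply_roots.simps)
  next
    fix y z c assume "y \<in> W" "z \<in> W"
    then show "y - c *s z \<in> W"
      using linear_opD[OF linear_apply_roots[OF linear_X, of "Suc m" "[d, d]"]]
      by (simp add: W_def V_closed del: apply_roots.simps)
  next
    fix z c assume z: "z \<in> W" "z \<in> weight_vectors m c \<gamma>"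
    then have zV: "z \<in> V \<gamma>" and Az: "X m z = c m *s z" and J: "apply_roots ?B [d, d] z = 0"
      using m by (auto simp: W_def weight_vectors_def)
    define y where "y = ?B z - d *s z"
    have By: "?B y = d *s y" using J by (simp add: y_def)
    have yV: "y \<in> V \<gamma>" using zV m by (simp add: y_def V_closed X_V)
    have y_weight: "X a y = c a *s y" if "a \<in> {1..m}" for a
      using that z m X_commute[of a "Suc m" z] by (simp add: y_def weight_vectors_def X_minus X_scale algebra_simps)
    have Ay: "X m y = c m *s y" using y_weight m by simp
    have "y = 0"
    proof (rule ccontr)
      assume "y \<noteq> 0"
      then have "z \<noteq> 0" by (auto simp: y_def)
      then have wz: "weight m c \<gamma>" using z by (auto simp: weight_def)
      have a: "c m \<noteq> 0" using weight_content_nz[OF wz] m by simp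
      note X_i = X_intertwiner[OF b g]
      have AiJ: "apply_roots (X m) [d, d] (intertwiner m z) = intertwiner m (apply_roots ?B [d, d] z)"
        using zV yV m by (simp add: X_i X_V V_closed intertwiner_minus intertwiner_scale X_minus X_scale)
      obtain cs where cs: "distinct cs" "apply_roots (X m) cs (intertwiner m z) = 0"
        using ss m intertwiner_V[OF b g zV] unfolding semisimple_def by fastforce
      have Ai: "X m (intertwiner m z) = d *s intertwiner m z"
        using AiJ J by (intro no_jordan_block[OF linear_X cs]) simp
      then have iy: "intertwiner m y = 0"
        using X_i(2)[OF zV] by (simp add: y_def intertwiner_minus intertwiner_scale)
      then have "((v * c m - d) * (v * d - c m)) *s y = 0"
        using intertwiner_twice_weight[OF b g yV Ay By] by simp
      then have "v * c m - d = 0 \<or> v * d - c m = 0"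
        using \<open>y \<noteq> 0\<close> by (simp only: scale_eq_0_iff mult_eq_0_iff) simp
      then have d: "d = v * c m \<or> d = c m / v"
        using v_nz by (auto simp: field_simps)
      have iz: "intertwiner m z = 0"
      proof (rule ccontr)
        assume ni: "intertwiner m z \<noteq> 0"
        obtain m' where m': "m = Suc m'" using m by (cases m) auto
        have "X a (intertwiner m z) = c a *s intertwiner m z" if "a \<in> {1..m'}" for a
        proof -
          have "X a (intertwiner m z) = intertwiner m (X a z)"
            using that m' m X_commute[of a m] X_commute[of a "Suc m"] X_G_apart[of m a]
            by (simp add: intertwiner_def X_add X_scale X_minus)
          then show ?thesis using that z m' by (simp add: weight_vectors_def intertwiner_scale)
        qed
        then have "intertwiner m z \<in> weight_vectors m (c(m := d)) \<gamma>"
          using Ai intertwiner_V[OF b g zV] m' by (auto simp: weight_vectors_def le_Suc_eq)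
        with ni have w': "weight m (c(m := d)) \<gamma>" by (auto simp: weight_def)
        have ss': "\<forall>a\<in>{1..m'}. semisimple a" using ss m' by auto
        have mn: "Suc m' \<le> n" using m m' by simp
        show False
          using d weight_continuation[OF wz[unfolded m'] w'[unfolded m'] mn ss']
            weight_continuation[OF w'[unfolded m'] wz[unfolded m'] mn ss'] v_nz
          by (auto simp: m')
      qed
      have "y = 0"
        by (rule no_jordan_block_neighbours[OF b g zV Az a _ By yV Ay iz iy d]) (simp add: y_def)
      with \<open>y \<noteq> 0\<close> show False by simp
    qed
    then show "?B z = d *s z" by (simp add: y_def)
  qed (use m ss x in \<open>auto simp: W_def X_add scale_right_distrib\<close>)
qed

text \<open>
  The intertwiner also bounds the spectrum: an eigenvalue of \<open>X\<^sub>m\<^sub>+\<^sub>1\<close> is an eigenvalue of \<open>X\<^sub>m\<close>, or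
  \<open>v\<close> or \<open>v\<^sup>-\<^sup>1\<close> times one. With Jordan blocks excluded, these roots suffice with multiplicity 1.
\<close>

lemma semisimple_Suc:
  assumes m: "1 \<le> m" "Suc m \<le> n" and ss: "\<forall>a\<in>{1..m}. semisimple a"
  shows "semisimple (Suc m)"
proof -
  let ?B = "X (Suc m)"
  have b: "m \<in> {1..<n}" using m by auto
  have "semisimple m" using ss m by auto
  then obtain cs where cs: "distinct cs" "\<And>\<gamma> x. x \<in> V \<gamma> \<Longrightarrow> apply_roots (X m) cs x = 0"
    unfolding semisimple_def by blast
  define ds where "ds = cs @ map (\<lambda>c. v * c) cs @ map (\<lambda>c. c / v) cs"
  have "apply_roots ?B (remdups ds) x = 0" if x: "x \<in> V \<gamma>" for x \<gamma>
  proof (cases "\<gamma> m = \<gamma> (Suc m)")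
    case False
    have *: "G m (apply_roots ?B cs x) = apply_roots (X m) cs (G m x) \<and> apply_roots ?B cs x \<in> V \<gamma>"
      by (rule apply_roots_transfer[where W = "V \<gamma>"])
        (use x m Suc_X_G_diff(2)[OF b False] in \<open>auto intro: X_V V_closed\<close>)
    then have "apply_roots ?B cs x = 0"
      using cs(2)[OF G_V[OF x b]] G_inj[OF b, of "apply_roots ?B cs x" \<gamma>] by simp
    moreover have "mset cs \<subseteq># mset (remdups ds)"
      using cs(1) by (rule subset_mset_remdups) (auto simp: ds_def)
    ultimately show ?thesis using apply_roots_superset_0[OF linear_X] by blast
  next
    case True
    have "apply_roots ?B ds x = 0"
    proof (rule weight_vector_induct[where m = m and W = "V \<gamma>" and \<gamma> = \<gamma> and x = x])
      fix y c assume y: "y \<in> V \<gamma>" "y \<in> weight_vectors m c \<gamma>"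
      have Ay: "X m y = c m *s y" using y m by (simp add: weight_vectors_def)
      show "apply_roots ?B ds y = 0"
      proof (cases "c m \<in> set cs")
        case False
        then have "y = 0" using apply_roots_eigenvector_distinct[OF linear_X Ay False] cs(2) y by blast
        then show ?thesis using linear_opD(3)[OF linear_apply_roots[OF linear_X]] by simp
      next
        case c: True
        let ?z = "apply_roots ?B cs y"
        have i: "intertwiner m ?z = apply_roots (X m) cs (intertwiner m y) \<and> ?z \<in> V \<gamma>"
          by (rule apply_roots_transfer[where W = "V \<gamma>"])
            (use y m X_intertwiner(2)[OF b True] in \<open>auto intro: X_V V_closed\<close>)
        have "X m ?z = apply_roots ?B cs (X m y) \<and> ?z \<in> V \<gamma>"
          by (rule apply_roots_transfer[where W = "V \<gamma>"])
            (use y m X_commute[of m "Suc m"] in \<open>auto intro: X_V V_closed\<close>)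
        then have Az: "X m ?z = c m *s ?z"
          using Ay linear_opD(2)[OF linear_apply_roots[OF linear_X]] by simp
        have "intertwiner m ?z = 0" using i cs(2)[OF intertwiner_V[OF b True y(1)]] by simp
        then have "(v * c m) *s (v *s ?B ?z - c m *s ?z) - ?B (v *s ?B ?z - c m *s ?z) = 0"
          using intertwiner_twice[OF b True _ Az] i by simp
        moreover have "v *s ?B ?z - c m *s ?z = v *s (?B ?z - (c m / v) *s ?z)"
          using v_nz by (simp add: scale_right_diff_distrib)
        ultimately have "v *s (?B (?B ?z - (c m / v) *s ?z) - (v * c m) *s (?B ?z - (c m / v) *s ?z)) = 0"
          by (simp add: X_scale X_minus algebra_simps)
        then have "apply_roots ?B ([v * c m, c m / v] @ cs) y = 0"
          using v_nz by (simp add: apply_roots_append)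
        moreover have "mset ([v * c m, c m / v] @ cs) \<subseteq># mset ds"
        proof -
          have "mset [v * c m] \<subseteq># mset (map (\<lambda>c. v * c) cs)" "mset [c m / v] \<subseteq># mset (map (\<lambda>c. c / v) cs)"
            using c by (auto simp: single_subset_iff)
          from subset_mset.add_mono[OF this] 
          have "mset [v * c m, c m / v] \<subseteq># mset (map (\<lambda>c. v * c) cs @ map (\<lambda>c. c / v) cs)"
            by (simp add: add_mset_commute)
          from subset_mset.add_mono[OF this subset_mset.order_refl[of "mset cs"]] show ?thesis
            by (simp add: ds_def add.commute add.left_commute)
        qed
        ultimately show ?thesis using apply_roots_superset_0[OF linear_X] by blast
      qed
    next
      fix y z assume "apply_roots ?B ds y = 0" "apply_roots ?B ds z = 0"
      then show "apply_roots ?B ds (y + z) = 0"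
        using linear_opD(1)[OF linear_apply_roots[OF linear_X]] by simp
    qed (use x m ss linear_opD(3)[OF linear_apply_roots[OF linear_X]] in \<open>auto intro: X_V V_closed\<close>)
    then show ?thesis
      using x m semisimple_Suc_no_jordan_block[OF m ss True]
      by (intro distinct_roots[where W = "V \<gamma>"] linear_X) (auto intro: X_V V_closed)
  qed
  then show ?thesis unfolding semisimple_def by (intro exI[of _ "remdups ds"]) auto
qed

lemma semisimple_all: "a \<in> {1..n} \<Longrightarrow> semisimple a"
proof (induction a rule: less_induct)
  case (less a)
  show ?case
  proof (cases "a = 1")
    case True
    then show ?thesis unfolding semisimple_def by (intro exI[of _ "[1]"]) simp
  next
    case False
    then obtain m where "a = Suc m" "1 \<le> m" using less.prems by (cases a) auto
    then show ?thesis using less by (auto intro!: semisimple_Suc)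
  qed
qed

text \<open>
  The form in which the decomposition into weight vectors is used: as an induction rule for statements
  that are closed under sums.
\<close>

theorem weight_space_induct [consumes 1, case_names zero add weight]:
  assumes x: "x \<in> V \<gamma>" and zero: "P 0" and add: "\<And>y z. P y \<Longrightarrow> P z \<Longrightarrow> P (y + z)"
    and weight: "\<And>y k. y \<in> V \<gamma> \<Longrightarrow> (\<And>a. a \<in> {1..n} \<Longrightarrow> X a y = (v powi k a) *s y) \<Longrightarrow>
        balanced n (\<lambda>a. (k a, \<gamma> a)) \<Longrightarrow> P y"
  shows "P x"
proof (rule weight_vector_induct[where m = n and W = "V \<gamma>" and \<gamma> = \<gamma> and x = x])
  fix y c assume y: "y \<in> V \<gamma>" "y \<in> weight_vectors n c \<gamma>"
  show "P y"
  proof (cases "y = 0")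
    case False
    then have w: "weight n c \<gamma>" using y by (auto simp: weight_def)
    from weight_contents[OF w order_refl] obtain k
      where k: "\<And>a. a \<in> {1..n} \<Longrightarrow> c a = v powi k a" "balanced n (\<lambda>a. (k a, \<gamma> a))"
      using semisimple_all by auto
    show ?thesis using y k by (intro weight[of y k]) (auto simp: weight_vectors_def)
  qed (simp add: zero)
qed (use x zero add semisimple_all in \<open>auto intro: X_V V_closed\<close>)

end

section \<open>Standard multitableaux and balanced sequences\<close>

text \<open>
  Content and component of the node that contains an entry, with the content in its exponent form. These
  pairs are the letters of the sequences studied above.
\<close>

definition diagonal_letter :: "multitableau \<Rightarrow> nat \<Rightarrow> int \<times> nat" where
  "diagonal_letter t a = (case node_of t a of (r, c, p) \<Rightarrow> (int c - int r, p))"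

lemma content_diagonal_letter:
  "content n v z t a =
     (if a \<le> n then v powi fst (diagonal_letter t a) else z ^ snd (diagonal_letter t (a - n)))"
  by (simp add: content_def diagonal_letter_def split: prod.splits)

lemma StdD:
  assumes "t \<in> Std d n"
  shows "multipartition d n (fst t)" "snd t \<in> extensional (diagram (fst t))"
    "bij_betw (snd t) (diagram (fst t)) {1..n}"
    "\<And>r c c' p. (r, c, p) \<in> diagram (fst t) \<Longrightarrow> (r, c', p) \<in> diagram (fst t) \<Longrightarrow> c < c' \<Longrightarrow>
       snd t (r, c, p) < snd t (r, c', p)"
    "\<And>r r' c p. (r, c, p) \<in> diagram (fst t) \<Longrightarrow> (r', c, p) \<in> diagram (fst t) \<Longrightarrow> r < r' \<Longrightarrow>
       snd t (r, c, p) < snd t (r', c, p)"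
  using assms by (auto simp: Std_def)

lemma diagram_positive: "(r, c, p) \<in> diagram \<Lambda> \<Longrightarrow> 1 \<le> r \<and> 1 \<le> c \<and> 1 \<le> p \<and> p \<le> length \<Lambda>"
  by (auto simp: diagram_def)

lemma diagram_down_closed:
  assumes "multipartition d n \<Lambda>" "(r, c, p) \<in> diagram \<Lambda>" "1 \<le> r'" "r' \<le> r" "1 \<le> c'" "c' \<le> c"
  shows "(r', c', p) \<in> diagram \<Lambda>"
proof -
  let ?\<mu> = "\<Lambda> ! (p - 1)"
  have p: "p - 1 < length \<Lambda>" using assms(2) by (auto simp: diagram_def)
  then have sorted: "sorted_wrt (\<ge>) ?\<mu>" using assms(1) by (auto simp: multipartition_def)
  have "?\<mu> ! (r - 1) \<le> ?\<mu> ! (r' - 1)"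
  proof (cases "r' = r")
    case False
    then show ?thesis
      using sorted_wrt_nth_less[OF sorted, of "r' - 1" "r - 1"] assms by (auto simp: diagram_def)
  qed simp
  then show ?thesis using assms by (auto simp: diagram_def)
qed

lemma node_of_Std:
  assumes "t \<in> Std d n"
  shows "a \<in> {1..n} \<Longrightarrow> node_of t a \<in> diagram (fst t)"
    and "a \<in> {1..n} \<Longrightarrow> snd t (node_of t a) = a"
    and "x \<in> diagram (fst t) \<Longrightarrow> node_of t (snd t x) = x"
    and "x \<in> diagram (fst t) \<Longrightarrow> snd t x \<in> {1..n}"
proof -
  have b: "inj_on (snd t) (diagram (fst t))" "snd t ` diagram (fst t) = {1..n}"
    using StdD(3)[OF assms] by (auto simp: bij_betw_def)
  show "node_of t a \<in> diagram (fst t)" "snd t (node_of t a) = a" if "a \<in> {1..n}"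
    using that unfolding node_of_def b(2)[symmetric] by (rule inv_into_into, rule f_inv_into_f)
  show "node_of t (snd t x) = x" if "x \<in> diagram (fst t)"
    using that b(1) by (simp add: node_of_def)
  show "snd t x \<in> {1..n}" if "x \<in> diagram (fst t)" using that b(2) by blast
qed

lemma Std_increasing:
  assumes t: "t \<in> Std d n" and D: "(r, c, p) \<in> diagram (fst t)" "(r', c', p) \<in> diagram (fst t)"
    and le: "r \<le> r'" "c \<le> c'" "(r, c) \<noteq> (r', c')"
  shows "snd t (r, c, p) < snd t (r', c', p)"
proof -
  have D': "(r, c', p) \<in> diagram (fst t)"
    using diagram_down_closed[OF StdD(1)[OF t] D(2)] le diagram_positive[OF D(1)] diagram_positive[OF D(2)] by auto
  have "snd t (r, c, p) \<le> snd t (r, c', p)" "snd t (r, c', p) \<le> snd t (r', c', p)"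
    using StdD(4)[OF t D(1) D'] StdD(5)[OF t D' D(2)] le by (cases "c = c'"; cases "r = r'"; simp)+
  moreover have "snd t (r, c, p) \<noteq> snd t (r', c', p)"
    using StdD(3)[OF t] D le by (auto simp: bij_betw_def dest: inj_onD)
  ultimately show ?thesis by simp
qed

text \<open>
  The entries on a diagonal increase and the diagonal has no gaps, so a node is determined by
  its diagonal and the number of smaller entries there.
\<close>

lemma occurrences_diagonal_letter:
  assumes t: "t \<in> Std d n" and a: "a \<in> {1..n}" and node: "node_of t a = (r, c, p)"
  shows "occurrences (diagonal_letter t) (diagonal_letter t a) a = min r c"
proof -
  have D: "(r, c, p) \<in> diagram (fst t)" using node_of_Std(1)[OF t a] node by simp
  have fa: "snd t (r, c, p) = a" using node_of_Std(2)[OF t a] node by simp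
  let ?h = "\<lambda>i. snd t (r - i, c - i, p)"
  have Di: "(r - i, c - i, p) \<in> diagram (fst t)" if "i < min r c" for i
    using diagram_down_closed[OF StdD(1)[OF t] D, of "r - i" "c - i"] that by auto
  have "{b \<in> {1..a}. diagonal_letter t b = diagonal_letter t a} = ?h ` {..<min r c}"
  proof (intro equalityI subsetI)
    fix b assume "b \<in> {b \<in> {1..a}. diagonal_letter t b = diagonal_letter t a}"
    then have b: "b \<in> {1..n}" "b \<le> a" "diagonal_letter t b = diagonal_letter t a" using a by auto
    obtain r' c' p' where n': "node_of t b = (r', c', p')" by (cases "node_of t b") auto
    then have eq: "p' = p" "int c' - int r' = int c - int r"
      using b(3) node by (auto simp: diagonal_letter_def)
    have D': "(r', c', p) \<in> diagram (fst t)" using node_of_Std(1)[OF t b(1)] n' eq by simp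
    have fb: "snd t (r', c', p) = b" using node_of_Std(2)[OF t b(1)] n' eq by simp
    have "r' \<le> r"
    proof (rule ccontr)
      assume "\<not> r' \<le> r"
      then have "a < b" using Std_increasing[OF t D D'] eq(2) fa fb by auto
      then show False using b(2) by simp
    qed
    then have "r' = r - (r - r')" "c' = c - (r - r')" "r - r' < min r c"
      using eq(2) diagram_positive[OF D'] by auto
    then show "b \<in> ?h ` {..<min r c}"
      by (intro image_eqI[of _ _ "r - r'"]) (simp_all add: fb flip: \<open>r' = _\<close> \<open>c' = _\<close>)
  next
    fix b assume "b \<in> ?h ` {..<min r c}"
    then obtain i where i: "i < min r c" "b = ?h i" by auto
    have "b \<le> a" using Std_increasing[OF t Di[OF i(1)] D] fa i by (cases "i = 0") auto
    moreover have "diagonal_letter t b = diagonal_letter t a"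
      using node_of_Std(3)[OF t Di[OF i(1)]] i node by (simp add: diagonal_letter_def)
    ultimately show "b \<in> {b \<in> {1..a}. diagonal_letter t b = diagonal_letter t a}"
      using node_of_Std(4)[OF t Di[OF i(1)]] i by auto
  qed
  moreover have "inj_on ?h {..<min r c}"
  proof (rule inj_onI)
    fix i j assume "i \<in> {..<min r c}" "j \<in> {..<min r c}" "?h i = ?h j"
    then have "(r - i, c - i, p) = (r - j, c - j, p)"
      using StdD(3)[OF t] Di by (auto simp: bij_betw_def dest: inj_onD)
    then show "i = j" using \<open>i \<in> _\<close> \<open>j \<in> _\<close> by auto
  qed
  ultimately show ?thesis by (simp add: occurrences_def card_image)
qed

lemma diagram_inj:
  assumes "multipartition d n \<Lambda>" "multipartition d n' \<Lambda>'" "diagram \<Lambda> = diagram \<Lambda>'"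
  shows "\<Lambda> = \<Lambda>'"
proof (rule nth_equalityI)
  show len: "length \<Lambda> = length \<Lambda>'" using assms by (simp add: multipartition_def)
  fix p assume p: "p < length \<Lambda>"
  have mem: "(r, c, Suc p) \<in> diagram M \<longleftrightarrow> r \<in> {1..length (M ! p)} \<and> c \<in> {1..M ! p ! (r - 1)}"
    if "length M = length \<Lambda>" for M r c
    using p that by (simp add: diagram_def)
  have eq: "r \<in> {1..length (\<Lambda> ! p)} \<and> c \<in> {1..\<Lambda> ! p ! (r - 1)} \<longleftrightarrow>
      r \<in> {1..length (\<Lambda>' ! p)} \<and> c \<in> {1..\<Lambda>' ! p ! (r - 1)}" for r c
    using mem[of \<Lambda> r c] mem[of \<Lambda>' r c] assms(3) len by simp
  have pos: "0 < M ! p ! r" if "multipartition d m M" "r < length (M ! p)" "length M = length \<Lambda>" for M m r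
    using that p unfolding multipartition_def by (metis gr0I nth_mem)
  have row: "r \<in> {1..length (M ! p)} \<longleftrightarrow> r \<in> {1..length (M ! p)} \<and> 1 \<in> {1..M ! p ! (r - 1)}"
    if "multipartition d m M" "length M = length \<Lambda>" for M m r
    using pos[of m M "r - 1"] that by (auto simp: Suc_le_eq)
  have rows: "r \<in> {1..length (\<Lambda> ! p)} \<longleftrightarrow> r \<in> {1..length (\<Lambda>' ! p)}" for r
    using row[OF assms(1) refl, of r] row[OF assms(2) len[symmetric], of r] eq[of r 1] by blast
  have lenp: "length (\<Lambda> ! p) = length (\<Lambda>' ! p)"
  proof -
    have "{1..length (\<Lambda> ! p)} = {1..length (\<Lambda>' ! p)}" using rows by blast
    then have "card {1..length (\<Lambda> ! p)} = card {1..length (\<Lambda>' ! p)}" by (rule arg_cong)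
    then show ?thesis by simp
  qed
  show "\<Lambda> ! p = \<Lambda>' ! p"
  proof (rule nth_equalityI[OF lenp])
    fix r assume r: "r < length (\<Lambda> ! p)"
    have "c \<in> {1..\<Lambda> ! p ! r} \<longleftrightarrow> c \<in> {1..\<Lambda>' ! p ! r}" for c
      using eq[of "Suc r" c] r lenp by simp
    then have "{1..\<Lambda> ! p ! r} = {1..\<Lambda>' ! p ! r}" by blast
    then have "card {1..\<Lambda> ! p ! r} = card {1..\<Lambda>' ! p ! r}" by (rule arg_cong)
    then show "\<Lambda> ! p ! r = \<Lambda>' ! p ! r" by simp
  qed
qed

theorem Std_determined_by_letters:
  assumes s: "s \<in> Std d n" and t: "t \<in> Std d n"
    and eq: "\<And>a. a \<in> {1..n} \<Longrightarrow> diagonal_letter s a = diagonal_letter t a"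
  shows "s = t"
proof -
  have node: "node_of s a = node_of t a" if a: "a \<in> {1..n}" for a
  proof -
    obtain r c p where sa: "node_of s a = (r, c, p)" by (cases "node_of s a") auto
    obtain r' c' p' where ta: "node_of t a = (r', c', p')" by (cases "node_of t a") auto
    have "occurrences (diagonal_letter s) l a = occurrences (diagonal_letter t) l a" for l
      unfolding occurrences_def using eq a by (intro arg_cong[of _ _ card]) auto
    then have "min r c = min r' c'"
      using occurrences_diagonal_letter[OF s a sa] occurrences_diagonal_letter[OF t a ta] eq[OF a] by simp
    then show ?thesis using eq[OF a] by (auto simp: sa ta diagonal_letter_def min_def split: if_splits)
  qed
  have diag: "diagram (fst u) = node_of u ` {1..n}" if u: "u \<in> Std d n" for u
    using node_of_Std[OF u] by (force intro: rev_image_eqI)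
  have D: "diagram (fst s) = diagram (fst t)"
    unfolding diag[OF s] diag[OF t] using node by (rule image_cong[OF refl])
  have "fst s = fst t" using diagram_inj[OF StdD(1)[OF s] StdD(1)[OF t] D] .
  moreover have "snd s = snd t"
  proof (rule extensionalityI[OF StdD(2)[OF s]])
    show "snd t \<in> extensional (diagram (fst s))" using StdD(2)[OF t] D by simp
    fix x assume x: "x \<in> diagram (fst s)"
    have a: "snd s x \<in> {1..n}" using node_of_Std(4)[OF s x] .
    have "node_of t (snd s x) = x" using node[OF a] node_of_Std(3)[OF s x] by simp
    then show "snd s x = snd t x" using node_of_Std(2)[OF t a] by simp
  qed
  ultimately show ?thesis by (simp add: prod_eq_iff)
qed

lemma card_diagram: "card (diagram \<Lambda>) = sum_list (map sum_list \<Lambda>)"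
proof -
  let ?S = "SIGMA p : {..<length \<Lambda>}. SIGMA r : {..<length (\<Lambda> ! p)}. {..<\<Lambda> ! p ! r}"
  have "bij_betw (\<lambda>(p, r, c). (Suc r, Suc c, Suc p)) ?S (diagram \<Lambda>)"
  proof (rule bij_betw_imageI)
    show "(\<lambda>(p, r, c). (Suc r, Suc c, Suc p)) ` ?S = diagram \<Lambda>"
    proof (intro equalityI subsetI)
      fix x assume "x \<in> diagram \<Lambda>"
      then obtain r c p where x: "x = (r, c, p)" "p \<in> {1..length \<Lambda>}" "r \<in> {1..length (\<Lambda> ! (p - 1))}"
        "c \<in> {1..\<Lambda> ! (p - 1) ! (r - 1)}" by (auto simp: diagram_def)
      then show "x \<in> (\<lambda>(p, r, c). (Suc r, Suc c, Suc p)) ` ?S"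
        by (intro image_eqI[of _ _ "(p - 1, r - 1, c - 1)"]) auto
    qed (auto simp: diagram_def)
  qed (auto simp: inj_on_def)
  then have "card (diagram \<Lambda>) = card ?S" by (rule bij_betw_same_card[symmetric])
  also have "\<dots> = (\<Sum>p<length \<Lambda>. \<Sum>r<length (\<Lambda> ! p). \<Lambda> ! p ! r)" by simp
  also have "\<dots> = sum_list (map sum_list \<Lambda>)"
    by (simp add: sum_list_sum_nth atLeast0LessThan)
  finally show ?thesis .
qed

lemma initial_segment:
  assumes "finite A" "0 \<notin> A" "\<And>x. x \<in> A \<Longrightarrow> 1 < x \<Longrightarrow> x - 1 \<in> A"
  shows "A = {1..card A}"
proof (cases "A = {}")
  case False
  define m where "m = Max A"
  have m: "m \<in> A" "\<And>x. x \<in> A \<Longrightarrow> x \<le> m"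
    using assms(1) False by (simp_all add: m_def)
  have down: "i \<in> A" if "i \<le> m" "1 \<le> i" for i
    using that
  proof (induction i rule: inc_induct)
    case base
    then show ?case using m(1) by simp
  next
    case (step i)
    then show ?case using assms(3)[of "Suc i"] by simp
  qed
  have "x \<in> A \<longleftrightarrow> x \<in> {1..m}" for x
    using m(2)[of x] down[of x] assms(2) by (cases x) auto
  then have "A = {1..m}" by blast
  then show ?thesis by simp
qed simp

text \<open>
  Each row of each component is an initial segment of the positive integers, and so is the first
  column; their sizes give the partitions.
\<close>

lemma down_closed_diagram:
  assumes fin: "finite D" and pos: "\<And>r c p. (r, c, p) \<in> D \<Longrightarrow> 1 \<le> r \<and> 1 \<le> c \<and> p \<in> {1..d}"
    and left: "\<And>r c p. (r, c, p) \<in> D \<Longrightarrow> 1 < c \<Longrightarrow> (r, c - 1, p) \<in> D"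
    and up: "\<And>r c p. (r, c, p) \<in> D \<Longrightarrow> 1 < r \<Longrightarrow> (r - 1, c, p) \<in> D"
  shows "\<exists>\<Lambda>. multipartition d (card D) \<Lambda> \<and> diagram \<Lambda> = D"
proof -
  define row where "row p r = {c. (r, c, p) \<in> D}" for p r
  define col where "col p = {r. (r, 1, p) \<in> D}" for p
  have finr: "finite (row p r)" for p r
    by (rule finite_subset[OF _ finite_imageI[OF fin, of "\<lambda>(r, c, p). c"]]) (force simp: row_def)
  have finc: "finite (col p)" for p
    by (rule finite_subset[OF _ finite_imageI[OF fin, of "\<lambda>(r, c, p). r"]]) (force simp: col_def)
  have row: "row p r = {1..card (row p r)}" for p r
    by (rule initial_segment[OF finr]) (use pos left in \<open>force simp: row_def\<close>)+
  have col: "col p = {1..card (col p)}" for p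
    by (rule initial_segment[OF finc]) (use pos up in \<open>force simp: col_def\<close>)+
  have row_iff: "(r, c, p) \<in> D \<longleftrightarrow> c \<in> {1..card (row p r)}" for r c p
    using row[of p r] by (auto simp: row_def)
  have col_iff: "(r, 1, p) \<in> D \<longleftrightarrow> r \<in> {1..card (col p)}" for r p
    using col[of p] by (auto simp: col_def)
  have first: "(r, 1, p) \<in> D" if "(r, c, p) \<in> D" for r c p
    using that unfolding row_iff by auto
  have rows_decrease: "row p (Suc r) \<subseteq> row p r" if "1 \<le> r" for p r
    using up[of "Suc r" _ p] that by (auto simp: row_def)
  have rows_decrease': "row p r' \<subseteq> row p r" if "1 \<le> r" "r \<le> r'" for p r r'
    using that(2)
  proof (induction r' rule: dec_induct)
    case (step r')
    then show ?case using rows_decrease[of r' p] that(1) by auto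
  qed simp
  define \<Lambda> where "\<Lambda> = map (\<lambda>p. map (\<lambda>r. card (row p r)) [1..<Suc (card (col p))]) [1..<Suc d]"
  have len: "length \<Lambda> = d" by (simp add: \<Lambda>_def)
  have nth: "\<Lambda> ! (p - 1) = map (\<lambda>r. card (row p r)) [1..<Suc (card (col p))]" if "p \<in> {1..d}" for p
    unfolding \<Lambda>_def using that by (subst nth_map) (auto simp del: upt_Suc)
  have D: "diagram \<Lambda> = D"
  proof (intro equalityI subsetI)
    fix x assume "x \<in> diagram \<Lambda>"
    then obtain r c p where x: "x = (r, c, p)" "p \<in> {1..d}" "r \<in> {1..card (col p)}"
      "c \<in> {1..\<Lambda> ! (p - 1) ! (r - 1)}" using nth by (auto simp: diagram_def len simp del: upt_Suc)
    moreover have "\<Lambda> ! (p - 1) ! (r - 1) = card (row p r)"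
      unfolding nth[OF x(2)] using x(3) by (subst nth_map) (auto simp del: upt_Suc)
    ultimately show "x \<in> D" by (simp add: row_iff)
  next
    fix x assume "x \<in> D"
    then obtain r c p where x: "x = (r, c, p)" "(r, c, p) \<in> D" by (cases x) auto
    have p: "p \<in> {1..d}" using pos x by blast
    have r: "r \<in> {1..card (col p)}" using first[OF x(2)] col_iff by blast
    have "\<Lambda> ! (p - 1) ! (r - 1) = card (row p r)"
      unfolding nth[OF p] using r by (subst nth_map) (auto simp del: upt_Suc)
    then show "x \<in> diagram \<Lambda>"
      using x p r row_iff[of r c p] nth[OF p] by (simp add: diagram_def len del: upt_Suc)
  qed
  have "multipartition d (card D) \<Lambda>"
    unfolding multipartition_def
  proof (intro conjI ballI)
    show "sum_list (map sum_list \<Lambda>) = card D" using card_diagram[of \<Lambda>] D by simp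
    fix \<mu> assume "\<mu> \<in> set \<Lambda>"
    then obtain p where \<mu>: "\<mu> = map (\<lambda>r. card (row p r)) [1..<Suc (card (col p))]"
      by (auto simp: \<Lambda>_def simp del: upt_Suc)
    show "sorted_wrt (\<ge>) \<mu>"
      unfolding \<mu> sorted_wrt_map
    proof (rule sorted_wrt_mono_rel[OF _ sorted_wrt_upt])
      fix x y assume xy: "x \<in> set [1..<Suc (card (col p))]" "x < y"
      then have "1 \<le> x" by (simp del: upt_Suc)
      then show "card (row p y) \<le> card (row p x)"
        using xy(2) by (intro card_mono[OF finr] rows_decrease') auto
    qed
    show "0 \<notin> set \<mu>"
    proof
      assume "0 \<in> set \<mu>"
      then obtain r where "r \<in> {1..card (col p)}" "card (row p r) = 0"
        by (auto simp: \<mu> atLeastLessThanSuc_atLeastAtMost simp del: upt_Suc)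
      then show False using col_iff[of r p] row_iff[of r 1 p] by simp
    qed
  qed (rule len)
  then show ?thesis using D by blast
qed

lemma occurrence_number:
  "1 \<le> i \<Longrightarrow> i \<le> occurrences s l a \<Longrightarrow> \<exists>b\<in>{1..a}. s b = l \<and> occurrences s l b = i"
proof (induction a)
  case (Suc a)
  show ?case
  proof (cases "i \<le> occurrences s l a")
    case True
    then show ?thesis using Suc by fastforce
  next
    case False
    then have "s (Suc a) = l" "occurrences s l (Suc a) = i" using Suc.prems by (auto split: if_splits)
    then show ?thesis by (intro bexI[of _ "Suc a"]) auto
  qed
qed simp

text \<open>
  The \<open>i\<close>-th occurrence of the diagonal \<open>k\<close> is placed in the \<open>i\<close>-th node of that diagonal, which is
  \<open>(i, i + k)\<close> for \<open>k \<ge> 0\<close> and \<open>(i - k, i)\<close> for \<open>k \<le> 0\<close>. Balance says that the left and the upper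
  neighbour of each node have been filled before.
\<close>

theorem balanced_Std:
  assumes bal: "balanced n s" and col: "\<And>a. a \<in> {1..n} \<Longrightarrow> snd (s a) \<in> {1..d}"
  shows "\<exists>t\<in>Std d n. \<forall>a\<in>{1..n}. diagonal_letter t a = s a"
proof -
  define nd where "nd a = (let i = occurrences s (s a) a; k = fst (s a) in
      (i + nat (- k), i + nat k, snd (s a)))" for a
  define D where "D = nd ` {1..n}"
  have occ_pos: "1 \<le> occurrences s (s a) a" if "a \<in> {1..n}" for a
    using that by (auto simp: Suc_le_eq occurrences_pos_iff)
  have letter: "s a = (int c - int r, p)" if "nd a = (r, c, p)" for a r c p
    using that by (auto simp: nd_def Let_def prod_eq_iff)
  have index: "occurrences s (s a) a = min r c" if "nd a = (r, c, p)" for a r c p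
    using that by (auto simp: nd_def Let_def)
  have occ_less: "occurrences s (s b) a < occurrences s (s b) b" if "a < b" for a b
  proof -
    have "occurrences s (s b) a \<le> occurrences s (s b) (b - 1)" using that by (intro occurrences_mono) simp
    also have "\<dots> < occurrences s (s b) b" using that by (cases b) auto
    finally show ?thesis .
  qed
  have inj: "inj_on nd {1..n}"
  proof (rule inj_onI)
    fix a b assume "nd a = nd b"
    obtain r c p where "nd a = (r, c, p)" by (cases "nd a") auto
    then have "s a = s b" "occurrences s (s a) a = occurrences s (s b) b"
      using \<open>nd a = nd b\<close> letter[of a] letter[of b] index[of a] index[of b] by auto
    then show "a = b" using occ_less[of a b] occ_less[of b a] by (cases a b rule: linorder_cases) auto
  qed
  have cardD: "card D = n" using card_image[OF inj] by (simp add: D_def)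
  have find: "\<exists>b\<in>{1..<a}. nd b = (i + nat (- k), i + nat k, p)"
    if h: "1 \<le> i" "i \<le> occurrences s (k, p) a" "s a \<noteq> (k, p)" for i k p a
  proof -
    obtain b where b: "b \<in> {1..a}" "s b = (k, p)" "occurrences s (k, p) b = i"
      using occurrence_number[OF h(1,2)] by blast
    then have "b \<noteq> a" using h(3) by auto
    then show ?thesis using b by (intro bexI[of _ b]) (auto simp: nd_def Let_def)
  qed
  have left: "\<exists>b\<in>{1..<a}. nd b = (r, c - 1, p)" if a: "a \<in> {1..n}" and nd: "nd a = (r, c, p)" and c: "1 < c" for a r c p
  proof -
    define k where "k = int c - int r"
    have sa: "s a = (k, p)" using letter[OF nd] by (simp add: k_def)
    have i: "occurrences s (k, p) a = min r c" using index[OF nd] sa by simp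
    have i1: "1 \<le> min r c" using occ_pos[OF a] i sa by simp
    show ?thesis
    proof (cases "1 \<le> k")
      case True
      then have "min r c \<le> occurrences s (k - 1, p) a"
        using bal[unfolded balanced_def, rule_format, of a "k - 1" p] a i by simp
      then have "\<exists>b\<in>{1..<a}. nd b = (min r c + nat (- (k - 1)), min r c + nat (k - 1), p)"
        using i1 sa by (intro find) auto
      moreover have "min r c + nat (- (k - 1)) = r" "min r c + nat (k - 1) = c - 1"
        using True c by (auto simp: k_def)
      ultimately show ?thesis by simp
    next
      case False
      then have "min r c - 1 \<le> occurrences s (k - 1, p) a"
        using bal[unfolded balanced_def, rule_format, of a k p] a i by (simp add: le_diff_conv)
      moreover have "1 \<le> min r c - 1" using False c by (simp add: k_def)
      ultimately have "\<exists>b\<in>{1..<a}. nd b = (min r c - 1 + nat (- (k - 1)), min r c - 1 + nat (k - 1), p)"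
        using sa by (intro find) auto
      moreover have "min r c - 1 + nat (- (k - 1)) = r" "min r c - 1 + nat (k - 1) = c - 1"
        using False c by (auto simp: k_def)
      ultimately show ?thesis by simp
    qed
  qed
  have up: "\<exists>b\<in>{1..<a}. nd b = (r - 1, c, p)" if a: "a \<in> {1..n}" and nd: "nd a = (r, c, p)" and r: "1 < r" for a r c p
  proof -
    define k where "k = int c - int r"
    have sa: "s a = (k, p)" using letter[OF nd] by (simp add: k_def)
    have i: "occurrences s (k, p) a = min r c" using index[OF nd] sa by simp
    have i1: "1 \<le> min r c" using occ_pos[OF a] i sa by simp
    show ?thesis
    proof (cases "k \<le> - 1")
      case True
      then have "min r c \<le> occurrences s (k + 1, p) a"
        using bal[unfolded balanced_def, rule_format, of a "k + 1" p] a i by simp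
      then have "\<exists>b\<in>{1..<a}. nd b = (min r c + nat (- (k + 1)), min r c + nat (k + 1), p)"
        using i1 sa by (intro find) auto
      moreover have "min r c + nat (- (k + 1)) = r - 1" "min r c + nat (k + 1) = c"
        using True r by (auto simp: k_def)
      ultimately show ?thesis by simp
    next
      case False
      then have "min r c - 1 \<le> occurrences s (k + 1, p) a"
        using bal[unfolded balanced_def, rule_format, of a k p] a i by (simp add: le_diff_conv)
      moreover have "1 \<le> min r c - 1" using False r by (simp add: k_def)
      ultimately have "\<exists>b\<in>{1..<a}. nd b = (min r c - 1 + nat (- (k + 1)), min r c - 1 + nat (k + 1), p)"
        using sa by (intro find) auto
      moreover have "min r c - 1 + nat (- (k + 1)) = r - 1" "min r c - 1 + nat (k + 1) = c"
        using False r by (auto simp: k_def)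
      ultimately show ?thesis by simp
    qed
  qed
  have pos: "1 \<le> r \<and> 1 \<le> c \<and> p \<in> {1..d}" if "(r, c, p) \<in> D" for r c p
  proof -
    obtain a where a: "a \<in> {1..n}" "nd a = (r, c, p)" using \<open>(r, c, p) \<in> D\<close> by (auto simp: D_def)
    then show ?thesis using occ_pos[of a] index[of a] letter[of a] col[of a] by auto
  qed
  have leftD: "(r, c - 1, p) \<in> D" if "(r, c, p) \<in> D" "1 < c" for r c p
  proof -
    obtain a where a: "a \<in> {1..n}" "nd a = (r, c, p)" using \<open>(r, c, p) \<in> D\<close> by (auto simp: D_def)
    obtain b where "b \<in> {1..<a}" "nd b = (r, c - 1, p)" using left[OF a \<open>1 < c\<close>] by blast
    then show ?thesis using a unfolding D_def by (intro image_eqI[of _ _ b]) auto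
  qed
  have upD: "(r - 1, c, p) \<in> D" if "(r, c, p) \<in> D" "1 < r" for r c p
  proof -
    obtain a where a: "a \<in> {1..n}" "nd a = (r, c, p)" using \<open>(r, c, p) \<in> D\<close> by (auto simp: D_def)
    obtain b where "b \<in> {1..<a}" "nd b = (r - 1, c, p)" using up[OF a \<open>1 < r\<close>] by blast
    then show ?thesis using a unfolding D_def by (intro image_eqI[of _ _ b]) auto
  qed
  have "finite D" by (simp add: D_def)
  from down_closed_diagram[OF this pos leftD upD] obtain \<Lambda>
    where \<Lambda>: "multipartition d n \<Lambda>" "diagram \<Lambda> = D" by (auto simp: cardD)
  define f where "f = restrict (inv_into {1..n} nd) D"
  have f: "f (nd a) = a" if "a \<in> {1..n}" for a
    using that inj by (simp add: f_def D_def)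
  have bij: "bij_betw f D {1..n}"
    unfolding f_def D_def using bij_betw_inv_into[of nd "{1..n}" "nd ` {1..n}"] inj
    by (subst bij_betw_restrict_eq) (simp add: bij_betw_def)
  have f_left: "f (r, c - 1, p) < f (r, c, p)" if "(r, c, p) \<in> D" "1 < c" for r c p
  proof -
    obtain a where a: "a \<in> {1..n}" "nd a = (r, c, p)" using \<open>(r, c, p) \<in> D\<close> by (auto simp: D_def)
    obtain b where b: "b \<in> {1..<a}" "nd b = (r, c - 1, p)" using left[OF a \<open>1 < c\<close>] by blast
    then show ?thesis using f[of a] f[of b] a by auto
  qed
  have f_up: "f (r - 1, c, p) < f (r, c, p)" if "(r, c, p) \<in> D" "1 < r" for r c p
  proof -
    obtain a where a: "a \<in> {1..n}" "nd a = (r, c, p)" using \<open>(r, c, p) \<in> D\<close> by (auto simp: D_def)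
    obtain b where b: "b \<in> {1..<a}" "nd b = (r - 1, c, p)" using up[OF a \<open>1 < r\<close>] by blast
    then show ?thesis using f[of a] f[of b] a by auto
  qed
  have row: "f (r, c, p) < f (r, c', p)" if h: "c < c'" "(r, c', p) \<in> D" "1 \<le> c" for r c c' p
  proof -
    from h(1) have "Suc c \<le> c'" by simp
    then show ?thesis using h(2)
    proof (induction c' rule: dec_induct)
      case base
      then show ?case using f_left[of r "Suc c" p] h(3) by simp
    next
      case (step c')
      then show ?case using f_left[of r "Suc c'" p] leftD[of r "Suc c'" p] by auto
    qed
  qed
  have column: "f (r, c, p) < f (r', c, p)" if h: "r < r'" "(r', c, p) \<in> D" "1 \<le> r" for r r' c p
  proof -
    from h(1) have "Suc r \<le> r'" by simp
    then show ?thesis using h(2)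
    proof (induction r' rule: dec_induct)
      case base
      then show ?case using f_up[of "Suc r" c p] h(3) by simp
    next
      case (step r')
      then show ?case using f_up[of "Suc r'" c p] upD[of "Suc r'" c p] by auto
    qed
  qed
  have t: "(\<Lambda>, f) \<in> Std d n"
    unfolding Std_def
  proof (intro CollectI case_prodI conjI allI impI)
    show "f \<in> extensional (diagram \<Lambda>)" by (simp add: f_def \<Lambda>)
    show "bij_betw f (diagram \<Lambda>) {1..n}" using bij \<Lambda> by simp
    show "f (r, c, p) < f (r, c', p)"
      if "(r, c, p) \<in> diagram \<Lambda> \<and> (r, c', p) \<in> diagram \<Lambda> \<and> c < c'" for r c c' p
      using row[of c c' r p] pos[of r c p] that \<Lambda> by simp
    show "f (r, c, p) < f (r', c, p)"
      if "(r, c, p) \<in> diagram \<Lambda> \<and> (r', c, p) \<in> diagram \<Lambda> \<and> r < r'" for r r' c p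
      using column[of r r' c p] pos[of r c p] that \<Lambda> by simp
  qed (rule \<Lambda>)
  have "diagonal_letter (\<Lambda>, f) a = s a" if a: "a \<in> {1..n}" for a
  proof -
    have "nd a \<in> diagram \<Lambda>" using a \<Lambda> by (simp add: D_def)
    then have "node_of (\<Lambda>, f) a = nd a" using node_of_Std(3)[OF t, of "nd a"] f[OF a] by simp
    then show ?thesis using letter[of a] by (cases "nd a") (simp add: diagonal_letter_def)
  qed
  then show ?thesis using t by blast
qed

lemma Std_node_bounds:
  assumes t: "t \<in> Std d n" and D: "(r, c, p) \<in> diagram (fst t)"
  shows "r \<le> n" "c \<le> n" "p \<in> {1..d}"
proof -
  have fin: "finite (diagram (fst t))" and card: "card (diagram (fst t)) = n"
    using bij_betw_finite[OF StdD(3)[OF t]] bij_betw_same_card[OF StdD(3)[OF t]] by simp_all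
  have "card ((\<lambda>x. (r, x, p)) ` {1..c}) \<le> card (diagram (fst t))"
    using diagram_down_closed[OF StdD(1)[OF t] D] diagram_positive[OF D] by (intro card_mono[OF fin]) auto
  then show "c \<le> n" by (simp add: card card_image inj_on_def)
  have "card ((\<lambda>x. (x, c, p)) ` {1..r}) \<le> card (diagram (fst t))"
    using diagram_down_closed[OF StdD(1)[OF t] D] diagram_positive[OF D] by (intro card_mono[OF fin]) auto
  then show "r \<le> n" by (simp add: card card_image inj_on_def)
  show "p \<in> {1..d}" using diagram_positive[OF D] StdD(1)[OF t] by (simp add: multipartition_def)
qed

lemma diagonal_letter_component:
  assumes "t \<in> Std d n" "a \<in> {1..n}"
  shows "snd (diagonal_letter t a) \<in> {1..d}"
  using node_of_Std(1)[OF assms] Std_node_bounds(3)[OF assms(1)]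
  by (cases "node_of t a") (auto simp: diagonal_letter_def)

lemma finite_Std: "finite (Std d n)"
proof (rule finite_imageD)
  let ?h = "\<lambda>t. restrict (diagonal_letter t) {1..n}"
  show "inj_on ?h (Std d n)"
    by (rule inj_onI) (metis Std_determined_by_letters restrict_apply')
  have "?h ` Std d n \<subseteq> {1..n} \<rightarrow>\<^sub>E {- int n..int n} \<times> {1..d}"
  proof (intro image_subsetI PiE_I)
    fix t a assume t: "t \<in> Std d n" and a: "a \<in> {1..n}"
    obtain r c p where x: "node_of t a = (r, c, p)" by (cases "node_of t a") auto
    then have "(r, c, p) \<in> diagram (fst t)" using node_of_Std(1)[OF t a] by simp
    from Std_node_bounds[OF t this] show "?h t a \<in> {- int n..int n} \<times> {1..d}"
      using a x by (auto simp: diagonal_letter_def)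
  qed auto
  then show "finite (?h ` Std d n)" by (rule finite_subset) (auto intro: finite_PiE)
qed

section \<open>The valuation ring and its residue map\<close>

lemma fract_const_hom:
  "fract_const 0 = 0" "fract_const 1 = 1" "fract_const (a + b) = fract_const a + fract_const b"
  "fract_const (a - b) = fract_const a - fract_const b" "fract_const (a * b) = fract_const a * fract_const b"
  by (simp_all add: fract_const_def Zero_fract_def One_fract_def pCons_one mult.commute)

lemma fract_const_power: "fract_const (a ^ m) = fract_const a ^ m"
  by (induction m) (simp_all add: fract_const_hom)

lemma fract_const_of_nat: "fract_const (of_nat m) = of_nat m"
  by (induction m) (simp_all add: fract_const_hom)

lemma fract_const_eq_iff: "fract_const a = fract_const b \<longleftrightarrow> a = b"
  by (simp add: fract_const_def eq_fract)

lemma qhat_power: "qhat ^ m = Fract (monom 1 m) (1 :: 'k::field poly)"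
proof (induction m)
  case (Suc m)
  have "[:0, 1:] * monom 1 m = (monom 1 (Suc m) :: 'k poly)"
    by (simp add: monom_Suc)
  then show ?case using Suc by (simp add: qhat_def)
qed (simp add: One_fract_def)

lemma qhat_nz: "qhat \<noteq> (0 :: 'k::field poly fract)"
  by (simp add: qhat_def Zero_fract_def eq_fract)

lemma qhat_generic: "0 < m \<Longrightarrow> qhat ^ m \<noteq> (1 :: 'k::field poly fract)"
  by (simp add: qhat_power One_fract_def eq_fract monom_eq_1_iff)

lemma qhat_minus_const: "qhat - fract_const q = Fract [:- q, 1:] 1"
  by (simp add: qhat_def fract_const_def)

context
  fixes q :: "'k::field"
  assumes q: "q \<noteq> 0"
begin

lemma laurent_iff: "x \<in> laurent \<longleftrightarrow> (\<exists>p m. x = Fract p (monom (1 :: 'k) m))"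
  by (auto simp: laurent_def qhat_power divide_fract)

text \<open>
  The powers of \<open>qhat\<close> do not vanish at \<open>q\<close>, so inverting them first changes nothing: the ring consists
  of the fractions whose denominator does not vanish at \<open>q\<close>, and the residue is the value at \<open>q\<close>.
\<close>

lemma in_local_ring_iff: "x \<in> local_ring q \<longleftrightarrow> (\<exists>p r. x = Fract p r \<and> poly r q \<noteq> 0)"
proof
  assume "x \<in> local_ring q"
  then obtain a b where x: "x = a / b" "a \<in> laurent" "b \<in> laurent" "b \<notin> laurent_prime q"
    by (auto simp: local_ring_def)
  obtain p m where a: "a = Fract p (monom 1 m)" using x by (auto simp: laurent_iff)
  obtain p' m' where b: "b = Fract p' (monom 1 m')" using x by (auto simp: laurent_iff)
  have "poly p' q \<noteq> 0"
  proof
    assume "poly p' q = 0"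
    then obtain s where "p' = [:- q, 1:] * s" by (auto simp: poly_eq_0_iff_dvd)
    then have "b = (qhat - fract_const q) * Fract s (monom 1 m')"
      by (simp add: b qhat_minus_const)
    then show False using x(4) laurent_iff[of "Fract s (monom 1 m')"] by (auto simp: laurent_prime_def)
  qed
  then have "poly (monom 1 m * p') q \<noteq> 0" using q by (simp add: poly_monom)
  then show "\<exists>p r. x = Fract p r \<and> poly r q \<noteq> 0"
    unfolding x a b divide_fract by blast
next
  assume "\<exists>p r. x = Fract p r \<and> poly r q \<noteq> 0"
  then obtain p r where x: "x = Fract p r" and r: "poly r q \<noteq> 0" by blast
  have L: "Fract p 1 \<in> laurent" "Fract r 1 \<in> laurent"
    unfolding laurent_iff by (metis monom_eq_1)+
  have "Fract r 1 \<notin> laurent_prime q"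
  proof
    assume "Fract r 1 \<in> laurent_prime q"
    then obtain y where "y \<in> laurent" "Fract r 1 = (qhat - fract_const q) * y"
      by (auto simp: laurent_prime_def)
    then obtain s m where "Fract r 1 = Fract ([:- q, 1:] * s) (monom 1 m)"
      by (auto simp: laurent_iff qhat_minus_const)
    then have "r * monom 1 m = [:- q, 1:] * s" by (simp add: eq_fract)
    then have "poly (r * monom 1 m) q = poly ([:- q, 1:] * s) q" by simp
    then show False using r q by (simp add: poly_monom)
  qed
  moreover have "x = Fract p 1 / Fract r 1" by (simp add: x divide_fract)
  ultimately show "x \<in> local_ring q" using L unfolding local_ring_def by blast
qed

lemma residue_map_Fract:
  assumes "poly r q \<noteq> 0"
  shows "residue_map q (Fract p r) = poly p q / poly r q"
  unfolding residue_map_def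
proof (rule the_equality)
  have r: "r \<noteq> 0" using assms by auto
  let ?c = "poly p q / poly r q"
  have "poly (p - [:?c:] * r) q = 0" using assms by simp
  then have "[:- q, 1:] dvd p - [:?c:] * r" by (simp only: poly_eq_0_iff_dvd)
  then obtain s where s: "p - [:?c:] * r = [:- q, 1:] * s" by (rule dvdE)
  have "Fract p r - fract_const ?c = Fract (p - [:?c:] * r) r"
    using r by (simp add: fract_const_def)
  also have "\<dots> = (qhat - fract_const q) * Fract s r"
    unfolding s qhat_minus_const by simp
  finally have "Fract p r - fract_const ?c = (qhat - fract_const q) * Fract s r" .
  moreover have "Fract s r \<in> local_ring q" using assms by (auto simp: in_local_ring_iff)
  ultimately show "\<exists>y\<in>local_ring q. Fract p r - fract_const ?c = (qhat - fract_const q) * y" by blast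
  fix c assume "\<exists>y\<in>local_ring q. Fract p r - fract_const c = (qhat - fract_const q) * y"
  then obtain y where y0: "y \<in> local_ring q" "Fract p r - fract_const c = (qhat - fract_const q) * y"
    by blast
  then obtain s' r' where "y = Fract s' r'" "poly r' q \<noteq> 0"
    unfolding in_local_ring_iff by blast
  with y0(2) have y: "Fract p r - fract_const c = (qhat - fract_const q) * Fract s' r'" "poly r' q \<noteq> 0"
    by simp_all
  have r': "r' \<noteq> 0" using y(2) by auto
  have "Fract (p - [:c:] * r) r = Fract ([:- q, 1:] * s') r'"
    using y(1) r unfolding qhat_minus_const by (simp add: fract_const_def)
  then have "(p - [:c:] * r) * r' = ([:- q, 1:] * s') * r" using r r' by (simp add: eq_fract)
  then have "poly ((p - [:c:] * r) * r') q = poly (([:- q, 1:] * s') * r) q" by simp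
  then show "c = ?c" using y(2) assms by (simp add: field_simps)
qed

lemma local_ring_cases:
  assumes "x \<in> local_ring q"
  obtains p r where "x = Fract p r" "poly r q \<noteq> 0" "r \<noteq> 0"
proof -
  from assms obtain p r where *: "x = Fract p r" "poly r q \<noteq> 0" unfolding in_local_ring_iff by blast
  then have "r \<noteq> 0" by auto
  with * show ?thesis by (rule that)
qed

lemma residue_add:
  assumes "x \<in> local_ring q" "y \<in> local_ring q"
  shows "x + y \<in> local_ring q" "residue_map q (x + y) = residue_map q x + residue_map q y"
proof -
  obtain p r p' r' where *: "x = Fract p r" "poly r q \<noteq> 0" "r \<noteq> 0" "y = Fract p' r'" "poly r' q \<noteq> 0" "r' \<noteq> 0"
    using assms by (metis local_ring_cases)
  then have s: "x + y = Fract (p * r' + p' * r) (r * r')" by simp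
  show "x + y \<in> local_ring q" unfolding s in_local_ring_iff using * by (metis poly_mult no_zero_divisors)
  show "residue_map q (x + y) = residue_map q x + residue_map q y"
    unfolding s using * by (simp add: residue_map_Fract field_simps)
qed

lemma residue_mult:
  assumes "x \<in> local_ring q" "y \<in> local_ring q"
  shows "x * y \<in> local_ring q" "residue_map q (x * y) = residue_map q x * residue_map q y"
proof -
  obtain p r p' r' where *: "x = Fract p r" "poly r q \<noteq> 0" "r \<noteq> 0" "y = Fract p' r'" "poly r' q \<noteq> 0" "r' \<noteq> 0"
    using assms by (metis local_ring_cases)
  then have s: "x * y = Fract (p * p') (r * r')" by simp
  show "x * y \<in> local_ring q" unfolding s in_local_ring_iff using * by (metis poly_mult no_zero_divisors)
  show "residue_map q (x * y) = residue_map q x * residue_map q y"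
    unfolding s using * by (simp add: residue_map_Fract)
qed

lemma residue_const: "fract_const c \<in> local_ring q" "residue_map q (fract_const c) = c"
proof -
  have "poly 1 q \<noteq> 0" by simp
  then show "fract_const c \<in> local_ring q" unfolding in_local_ring_iff fract_const_def by blast
  show "residue_map q (fract_const c) = c" by (simp add: fract_const_def residue_map_Fract)
qed

lemma residue_qhat: "qhat \<in> local_ring q" "residue_map q qhat = q"
proof -
  have "poly 1 q \<noteq> 0" by simp
  then show "qhat \<in> local_ring q" unfolding in_local_ring_iff qhat_def by blast
  show "residue_map q qhat = q" by (simp add: qhat_def residue_map_Fract)
qed

lemma residue_0_1: "0 \<in> local_ring q" "1 \<in> local_ring q" "residue_map q 0 = 0" "residue_map q 1 = 1"
  using residue_const[of 0] residue_const[of 1] by (simp_all add: fract_const_hom)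

lemma residue_uminus:
  assumes "x \<in> local_ring q"
  shows "- x \<in> local_ring q" "residue_map q (- x) = - residue_map q x"
proof -
  have "fract_const (- 1) = (- 1 :: 'k poly fract)"
    using fract_const_hom(4)[of 0 "1 :: 'k"] by (simp add: fract_const_hom)
  then have "- x = fract_const (- 1) * x" by (simp only: mult_minus1)
  then show "- x \<in> local_ring q" "residue_map q (- x) = - residue_map q x"
    using residue_mult[OF residue_const(1) assms, of "- 1"] by (simp_all add: residue_const)
qed

lemma residue_diff:
  assumes "x \<in> local_ring q" "y \<in> local_ring q"
  shows "x - y \<in> local_ring q" "residue_map q (x - y) = residue_map q x - residue_map q y"
  using residue_add[OF assms(1) residue_uminus(1)[OF assms(2)]] residue_uminus[OF assms(2)] by simp_all

lemma residue_inverse: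
  assumes "x \<in> local_ring q" "residue_map q x \<noteq> 0"
  shows "inverse x \<in> local_ring q" "residue_map q (inverse x) = inverse (residue_map q x)"
proof -
  obtain p r where *: "x = Fract p r" "poly r q \<noteq> 0" "r \<noteq> 0"
    using assms(1) by (metis local_ring_cases)
  then have p: "poly p q \<noteq> 0" using assms(2) by (simp add: residue_map_Fract)
  have i: "inverse x = Fract r p" by (simp add: *(1))
  show "inverse x \<in> local_ring q" unfolding i in_local_ring_iff using p by blast
  show "residue_map q (inverse x) = inverse (residue_map q x)"
    unfolding i using * p by (simp add: residue_map_Fract)
qed

lemma residue_power:
  assumes "x \<in> local_ring q"
  shows "x ^ m \<in> local_ring q" "residue_map q (x ^ m) = residue_map q x ^ m"
proof -
  have "x ^ m \<in> local_ring q \<and> residue_map q (x ^ m) = residue_map q x ^ m"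
    by (induction m) (simp_all add: residue_0_1 residue_mult assms)
  then show "x ^ m \<in> local_ring q" "residue_map q (x ^ m) = residue_map q x ^ m" by auto
qed

lemma residue_prod:
  assumes "\<And>i. i \<in> I \<Longrightarrow> f i \<in> local_ring q"
  shows "prod f I \<in> local_ring q" "residue_map q (prod f I) = (\<Prod>i\<in>I. residue_map q (f i))"
proof -
  have "prod f I \<in> local_ring q \<and> residue_map q (prod f I) = (\<Prod>i\<in>I. residue_map q (f i))"
    using assms by (induction I rule: infinite_finite_induct) (simp_all add: residue_0_1 residue_mult)
  then show "prod f I \<in> local_ring q" "residue_map q (prod f I) = (\<Prod>i\<in>I. residue_map q (f i))" by auto
qed

lemma residue_qhat_powi: "qhat powi i \<in> local_ring q" "residue_map q (qhat powi i) = q powi i"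
  using residue_power[OF residue_qhat(1)] residue_power[OF residue_inverse(1)[OF residue_qhat(1)]]
    residue_inverse[OF residue_qhat(1)] q
  by (auto simp: power_int_def residue_qhat)

end

section \<open>Change of the coefficient ring\<close>

locale yh_change = source: yh_coeffs S d n v \<xi> + target: yh_coeffs S' d n v' \<xi>'
  for S :: "'r::field set" and S' :: "'s::field set" and d n v v' \<xi> \<xi>' +
  fixes \<phi> :: "'r \<Rightarrow> 's"
  assumes \<phi>_S: "a \<in> S \<Longrightarrow> \<phi> a \<in> S'"
    and \<phi>_0: "\<phi> 0 = 0" and \<phi>_1: "\<phi> 1 = 1" and \<phi>_v: "\<phi> v = v'"
    and \<phi>_add: "a \<in> S \<Longrightarrow> b \<in> S \<Longrightarrow> \<phi> (a + b) = \<phi> a + \<phi> b"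
    and \<phi>_mult: "a \<in> S \<Longrightarrow> b \<in> S \<Longrightarrow> \<phi> (a * b) = \<phi> a * \<phi> b"
begin

abbreviation \<Phi> :: "(yh_gen list \<Rightarrow>\<^sub>0 'r) \<Rightarrow> (yh_gen list \<Rightarrow>\<^sub>0 's)" where
  "\<Phi> \<equiv> Poly_Mapping.map \<phi>"

lemma lookup_\<Phi>: "Poly_Mapping.lookup (\<Phi> f) w = \<phi> (Poly_Mapping.lookup f w)"
  by (simp add: Poly_Mapping.map.rep_eq when_def \<phi>_0)

lemma \<Phi>_A [intro, simp]: "f \<in> carrier source.A \<Longrightarrow> \<Phi> f \<in> carrier target.A"
proof -
  assume f: "f \<in> carrier source.A"
  have "Poly_Mapping.keys (\<Phi> f) \<subseteq> Poly_Mapping.keys f"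
    by (auto simp: in_keys_iff lookup_\<Phi> \<phi>_0)
  then show ?thesis
    using f unfolding source.in_A_iff target.in_A_iff lookup_\<Phi> by (blast intro: \<phi>_S)
qed

lemma \<Phi>_add: "f \<in> carrier source.A \<Longrightarrow> g \<in> carrier source.A \<Longrightarrow> \<Phi> (f + g) = \<Phi> f + \<Phi> g"
  by (rule poly_mapping_eqI) (auto simp: lookup_\<Phi> lookup_add source.in_A_iff \<phi>_add)

lemma \<Phi>_0 [simp]: "\<Phi> 0 = 0"
  by (rule poly_mapping_eqI) (simp add: lookup_\<Phi> \<phi>_0)

lemma \<Phi>_uminus: "f \<in> carrier source.A \<Longrightarrow> \<Phi> (- f) = - \<Phi> f"
  using \<Phi>_add[of f "- f"] by (simp add: eq_neg_iff_add_eq_0 add.commute)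

lemma \<Phi>_diff: "f \<in> carrier source.A \<Longrightarrow> g \<in> carrier source.A \<Longrightarrow> \<Phi> (f - g) = \<Phi> f - \<Phi> g"
  using \<Phi>_add[of f "- g"] \<Phi>_uminus[of g] by simp

lemma \<Phi>_sum: "(\<And>i. i \<in> I \<Longrightarrow> f i \<in> carrier source.A) \<Longrightarrow> \<Phi> (sum f I) = (\<Sum>i\<in>I. \<Phi> (f i))"
  by (induction I rule: infinite_finite_induct) (simp_all add: \<Phi>_add)

lemma \<Phi>_single: "\<Phi> (Poly_Mapping.single u c) = Poly_Mapping.single u (\<phi> c)"
  by (rule poly_mapping_eqI) (simp add: lookup_\<Phi> lookup_single when_def \<phi>_0)

lemma \<Phi>_const [simp]: "\<Phi> (const c) = const (\<phi> c)"
  and \<Phi>_var [simp]: "\<Phi> (var x) = var x"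
  by (simp_all only: const_def var_def \<Phi>_single \<phi>_1)

lemma \<Phi>_1 [simp]: "\<Phi> 1 = 1"
  using \<Phi>_const[of 1] by (simp add: const_simps \<phi>_1)

lemma \<Phi>_mult:
  assumes "f \<in> carrier source.A" "g \<in> carrier source.A"
  shows "\<Phi> (f * g) = \<Phi> f * \<Phi> g"
proof -
  have f: "Poly_Mapping.lookup f u \<in> S" "Poly_Mapping.lookup g u \<in> S" for u
    using assms by (simp_all add: source.in_A_iff)
  have k: "u \<in> lists (yh_gens n)" if "u \<in> Poly_Mapping.keys f \<or> u \<in> Poly_Mapping.keys g" for u
    using that assms by (auto simp: source.in_A_iff)
  have expand: "\<Phi> h = (\<Sum>u\<in>Poly_Mapping.keys h. Poly_Mapping.single u (\<phi> (Poly_Mapping.lookup h u)))"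
    if "h \<in> carrier source.A" for h
  proof -
    have "Poly_Mapping.single u (Poly_Mapping.lookup h u) \<in> carrier source.A" if "u \<in> Poly_Mapping.keys h" for u
      using \<open>h \<in> _\<close> that by (intro source.A_single) (auto simp: source.in_A_iff)
    from \<Phi>_sum[OF this, of "Poly_Mapping.keys h" "\<lambda>u. u"] show ?thesis
      using poly_mapping_sum_singles[of h] by (simp add: \<Phi>_single)
  qed
  have "\<Phi> (f * g) = (\<Sum>u\<in>Poly_Mapping.keys f. \<Sum>w\<in>Poly_Mapping.keys g.
           \<Phi> (Poly_Mapping.single (u + w) (Poly_Mapping.lookup f u * Poly_Mapping.lookup g w)))"
    unfolding times_sum_singles[of f g]
    by (subst \<Phi>_sum, (intro source.A_sum source.A_single; simp add: plus_list_def f source.S_mult k flip: in_lists_conv_set))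
      (intro sum.cong refl \<Phi>_sum source.A_single; simp add: plus_list_def f source.S_mult k flip: in_lists_conv_set)
  also have "\<dots> = \<Phi> f * \<Phi> g"
    unfolding expand[OF assms(1)] expand[OF assms(2)]
    by (simp add: \<Phi>_single sum_distrib_left sum_distrib_right mult_single \<phi>_mult f
        sum.swap[of _ "Poly_Mapping.keys g"])
  finally show ?thesis .
qed

lemma \<Phi>_power: "f \<in> carrier source.A \<Longrightarrow> \<Phi> (f ^ m) = \<Phi> f ^ m"
  by (induction m) (simp_all add: \<Phi>_mult)

lemma \<phi>_d: "\<phi> (1 / of_nat d) = 1 / of_nat d"
proof -
  have S: "of_nat m \<in> S" for m by (induction m) (simp_all add: source.S_0 source.S_1 source.S_add)
  have of_nat: "\<phi> (of_nat m) = of_nat m" for m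
    by (induction m) (simp_all add: \<phi>_0 \<phi>_1 \<phi>_add S source.S_1)
  have "\<phi> (1 / of_nat d) * \<phi> (of_nat d) = \<phi> (1 / of_nat d * of_nat d)"
    using \<phi>_mult[OF source.d_inv_S S[of d]] by (rule sym)
  then have "\<phi> (1 / of_nat d) * of_nat d = 1" using source.d_nz by (simp add: of_nat \<phi>_1)
  then show ?thesis using target.d_nz by (simp add: field_simps)
qed

lemma \<Phi>_e: "a \<in> {1..<n} \<Longrightarrow> \<Phi> (free_e d a) = free_e d a"
proof -
  assume a: "a \<in> {1..<n}"
  have t: "free_t a \<in> carrier source.A" "free_t (a + 1) \<in> carrier source.A"
    using a by (auto intro!: source.A_t)
  show ?thesis
    unfolding free_e_def
    using t source.d_inv_S by (simp add: \<Phi>_mult \<Phi>_sum \<Phi>_power \<phi>_d)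
qed

lemma \<Phi>_rel: "yh_rel d n v f g \<Longrightarrow> yh_rel d n v' (\<Phi> f) (\<Phi> g)"
proof (induction rule: yh_rel.induct)
  case (t_order a)
  then show ?case using yh_rel.t_order[of a n d v'] by (simp add: \<Phi>_power del: One_nat_def)
next
  case (t_commute a b)
  then show ?case using yh_rel.t_commute[of a n b d v'] by (simp add: \<Phi>_mult del: One_nat_def)
next
  case (t_g a b)
  then show ?case using yh_rel.t_g[of a n b d v'] source.transpose_range[of a b]
    by (simp add: \<Phi>_mult del: One_nat_def)
next
  case (quadratic a)
  have "\<phi> (v - 1) = v' - 1"
    using \<phi>_add[of "v - 1" 1] source.v_S source.S_1 source.S_diff by (simp add: \<phi>_v \<phi>_1)
  then show ?case using yh_rel.quadratic[of a n d v'] quadratic source.v_S source.S_1 source.S_diff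
    by (simp add: \<Phi>_power \<Phi>_add \<Phi>_mult \<Phi>_e \<phi>_v source.A_mult source.A_const source.A_e del: One_nat_def)
next
  case (braid a b)
  then show ?case using yh_rel.braid[of a n b d v'] by (simp add: \<Phi>_mult del: One_nat_def)
next
  case (g_commute a b)
  then show ?case using yh_rel.g_commute[of a n b d v'] by (simp add: \<Phi>_mult del: One_nat_def)
qed

lemma \<Phi>_ideal: "f \<in> source.\<I> \<Longrightarrow> \<Phi> f \<in> target.\<I>"
proof -
  assume f: "f \<in> source.\<I>"
  let ?J = "{f \<in> carrier source.A. \<Phi> f \<in> target.\<I>}"
  have "ideal ?J source.A"
  proof (rule idealI[OF source.ring_A])
    show "subgroup ?J (add_monoid source.A)"
    proof (rule source.A.add.subgroupI)
      show "?J \<noteq> {}" using target.\<I>.zero_closed by (auto intro!: exI[of _ 0])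
      fix f assume f: "f \<in> ?J"
      then have "\<ominus>\<^bsub>source.A\<^esub> f = - f" by (intro source.A.minus_equality) auto
      moreover have "- \<Phi> f \<in> target.\<I>"
      proof -
        have "\<ominus>\<^bsub>target.A\<^esub> \<Phi> f = - \<Phi> f" using f by (intro target.A.minus_equality) auto
        then show ?thesis using target.\<I>.a_inv_closed[of "\<Phi> f"] f by simp
      qed
      ultimately show "\<ominus>\<^bsub>source.A\<^esub> f \<in> ?J" using f by (auto simp: \<Phi>_uminus)
      fix g assume g: "g \<in> ?J"
      then show "f \<oplus>\<^bsub>source.A\<^esub> g \<in> ?J"
        using f target.\<I>.a_closed[of "\<Phi> f" "\<Phi> g"] by (auto simp: \<Phi>_add)
    qed auto
    fix f g assume "f \<in> ?J" "g \<in> carrier source.A"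
    then show "g \<otimes>\<^bsub>source.A\<^esub> f \<in> ?J" "f \<otimes>\<^bsub>source.A\<^esub> g \<in> ?J"
      using target.\<I>.I_l_closed[of "\<Phi> f" "\<Phi> g"] target.\<I>.I_r_closed[of "\<Phi> f" "\<Phi> g"]
      by (auto simp: \<Phi>_mult)
  qed
  moreover have "{x - y |x y. yh_rel d n v x y} \<subseteq> ?J"
  proof clarify
    fix x y assume r: "yh_rel d n v x y"
    have "target.cls (\<Phi> x) = target.cls (\<Phi> y)" by (rule target.cls_eqI_rel[OF \<Phi>_rel[OF r]])
    then show "x - y \<in> carrier source.A \<and> \<Phi> (x - y) \<in> target.\<I>"
      using source.yh_rel_A[OF r] by (simp add: \<Phi>_diff target.cls_eq_iff)
  qed
  ultimately have "source.\<I> \<subseteq> ?J"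
    unfolding yh_ideal_def by (rule source.A.genideal_minimal)
  then show "\<Phi> f \<in> target.\<I>" using f by auto
qed

lemma cls_\<Phi>:
  assumes "f \<in> carrier source.A" "g \<in> carrier source.A" "source.cls f = source.cls g"
  shows "target.cls (\<Phi> f) = target.cls (\<Phi> g)"
  using \<Phi>_ideal[of "f - g"] assms by (simp add: source.cls_eq_iff target.cls_eq_iff \<Phi>_diff)

text \<open>
  Applying \<open>\<phi>\<close> to coefficients maps one ideal into the other, so the union defining the base change is
  over equal cosets.
\<close>

lemma base_change_cls:
  assumes f: "f \<in> carrier source.A"
  shows "yh_base_change \<phi> S' d n v' (source.cls f) = target.cls (\<Phi> f)"
proof -
  have "f \<in> source.cls f"
    unfolding yh_class_def by (rule source.\<I>.a_rcos_self[OF f])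
  moreover have "target.cls (\<Phi> g) = target.cls (\<Phi> f)" if g: "g \<in> source.cls f" for g
  proof -
    obtain h where h: "h \<in> source.\<I>" "g = h + f"
      using g by (auto simp: yh_class_def a_r_coset_def r_coset_def)
    then have "g \<in> carrier source.A" using f source.\<I>.a_Hcarr by auto
    moreover from this have "source.cls g = source.cls f"
      using f h by (simp add: source.cls_eq_iff)
    ultimately show ?thesis using f by (intro cls_\<Phi>)
  qed
  ultimately show ?thesis unfolding yh_base_change_def by (intro UN_constant_eq ballI)
qed

end

section \<open>The tensor space decomposes into tableau weight spaces\<close>

lemma tensor_gg:
  "tensor_g v \<xi> b (tensor_g v \<xi> b F) w =
     v * F w + (if \<xi> ^ w b = \<xi> ^ w (Suc b) then (v - 1) * tensor_g v \<xi> b F w else 0)"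
  by (auto simp: tensor_g_def swap_letters_def algebra_simps)

text \<open>
  Here \<open>v\<close> is not a root of unity, which holds for the indeterminate but may fail for its specialisation.
\<close>

locale yh_generic = yh_coeffs S d n v \<xi>
  for S :: "'r::field set" and d n v \<xi> +
  assumes v_generic: "0 < i \<Longrightarrow> v ^ i \<noteq> 1"
begin

sublocale M: yh_module "\<lambda>c F w. c * F w" "tensor_g v \<xi>" "tensor_t \<xi>" n v
proof
  fix b x y assume b: "b \<in> {1..<n}"
  show "tensor_g v \<xi> b (tensor_g v \<xi> b x) = (\<lambda>w. v * x w) + (\<lambda>w. (v - 1) * tensor_g v \<xi> b x w)"
    if t: "tensor_t \<xi> b x = tensor_t \<xi> (Suc b) x"
  proof
    fix w
    have t0: "\<xi> ^ w b = \<xi> ^ w (Suc b) \<or> x w = 0" for w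
      using fun_cong[OF t, of w] by (auto simp: tensor_t_def)
    have "tensor_g v \<xi> b x w = 0" if "\<xi> ^ w b \<noteq> \<xi> ^ w (Suc b)"
      using t0[of w] t0[of "swap_letters b w"] that by (auto simp: tensor_g_def swap_letters_def)
    then show "tensor_g v \<xi> b (tensor_g v \<xi> b x) w = ((\<lambda>w. v * x w) + (\<lambda>w. (v - 1) * tensor_g v \<xi> b x w)) w"
      by (auto simp: tensor_gg)
  qed
  show "tensor_g v \<xi> b (tensor_g v \<xi> b x) = (\<lambda>w. v * x w)"
    if t: "tensor_t \<xi> b x = (\<lambda>w. c * x w)" "tensor_t \<xi> (Suc b) x = (\<lambda>w. c' * x w)" "c \<noteq> c'" for c c'
  proof
    fix w
    have t0: "x w = 0" if "\<xi> ^ w b = \<xi> ^ w (Suc b)" for w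
      using fun_cong[OF t(1), of w] fun_cong[OF t(2), of w] t(3) that by (auto simp: tensor_t_def)
    have "tensor_g v \<xi> b x w = 0" if "\<xi> ^ w b = \<xi> ^ w (Suc b)"
      using t0[of w] t0[of "swap_letters b w"] that by (auto simp: tensor_g_def swap_letters_def)
    then show "tensor_g v \<xi> b (tensor_g v \<xi> b x) w = v * x w"
      by (auto simp: tensor_gg)
  qed
next
  fix a b x assume "a \<in> {1..n}" "b \<in> {1..<n}"
  show "tensor_t \<xi> a (tensor_g v \<xi> b x) = tensor_g v \<xi> b (tensor_t \<xi> (transpose b (Suc b) a) x)"
    by (rule tensor_t_g)
next
  show "tensor_g v \<xi> b (tensor_g v \<xi> (Suc b) (tensor_g v \<xi> b x)) =
      tensor_g v \<xi> (Suc b) (tensor_g v \<xi> b (tensor_g v \<xi> (Suc b) x))" for b x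
    by (rule tensor_braid)
  show "Suc a < b \<Longrightarrow> tensor_g v \<xi> a (tensor_g v \<xi> b x) = tensor_g v \<xi> b (tensor_g v \<xi> a x)" for a b x
    by (rule tensor_g_commute)
qed (use tensor_gen_linear[of v \<xi> "Braid _"] tensor_gen_linear[of v \<xi> "Framing _"] v_nz v_generic in
     \<open>auto simp: fun_eq_iff algebra_simps\<close>)

lemma rep_X: "rep (free_X a) F = M.X a F"
proof (induction a arbitrary: F rule: free_X.induct)
  case (3 a)
  then show ?case
    by (simp add: tensor_rep_mult tensor_rep_const rep_g M.X.simps(3))
qed (simp_all add: tensor_rep_1)

definition tableau_vectors :: "multitableau \<Rightarrow> ((nat \<Rightarrow> nat) \<Rightarrow> 'r) set" where
  "tableau_vectors t = {F. \<forall>a\<in>{1..2 * n}. rep (free_L a) F = (\<lambda>w. content n v \<xi> t a * F w)}"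

lemma colour_exists:
  "\<exists>p\<in>{1..d}. \<xi> ^ p = \<xi> ^ j"
proof -
  have "\<xi> ^ (j mod d) = \<xi> ^ j"
    by (metis mod_mult_div_eq mult.right_neutral power_add power_mult power_one xi_d)
  then show ?thesis
  proof (cases "j mod d = 0")
    case True
    then show ?thesis using \<open>\<xi> ^ (j mod d) = \<xi> ^ j\<close> d_pos xi_d by (intro bexI[of _ d]) auto
  next
    case False
    then show ?thesis using \<open>\<xi> ^ (j mod d) = \<xi> ^ j\<close> d_pos by (intro bexI[of _ "j mod d"]) (auto intro: less_imp_le)
  qed
qed

lemma colour_inj:
  assumes "p \<in> {1..d}" "p' \<in> {1..d}" "\<xi> ^ p = \<xi> ^ p'"
  shows "p = p'"
proof -
  have "\<xi> * \<xi> ^ (p - 1) = \<xi> * \<xi> ^ (p' - 1)"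
    using assms by (cases p; cases p') auto
  then have "\<xi> ^ (p - 1) = \<xi> ^ (p' - 1)" using xi_nz by simp
  then have "p - 1 = p' - 1"
    using assms d_pos by (intro primitive_root_power_inj[OF xi_prim d_pos]) auto
  then show ?thesis using assms by auto
qed

lemma colour_induct:
  assumes zero: "P 0" and add: "\<And>F H. P F \<Longrightarrow> P H \<Longrightarrow> P (F + H)"
    and V: "\<And>F \<gamma>. (\<And>a. a \<in> {1..n} \<Longrightarrow> \<gamma> a \<in> {1..d}) \<Longrightarrow> F \<in> M.V (\<lambda>a. \<xi> ^ \<gamma> a) \<Longrightarrow> P F"
  shows "P F"
proof -
  let ?\<Gamma> = "{1..n} \<rightarrow>\<^sub>E {1..d}"
  define part where "part \<gamma> w = (if \<forall>a\<in>{1..n}. \<xi> ^ w a = \<xi> ^ \<gamma> a then F w else 0)" for \<gamma> :: "nat \<Rightarrow> nat" and w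
  have fin: "finite ?\<Gamma>" by (intro finite_PiE) auto
  have "F = (\<Sum>\<gamma>\<in>?\<Gamma>. part \<gamma>)"
  proof
    fix w
    obtain h where h: "\<And>j. h j \<in> {1..d} \<and> \<xi> ^ h j = \<xi> ^ j" using colour_exists by metis
    define \<delta> where "\<delta> = restrict (\<lambda>a. h (w a)) {1..n}"
    have \<delta>: "\<delta> \<in> ?\<Gamma>" using h by (auto simp: \<delta>_def)
    have "part \<gamma> w = (if \<gamma> = \<delta> then F w else 0)" if "\<gamma> \<in> ?\<Gamma>" for \<gamma>
    proof -
      have "(\<forall>a\<in>{1..n}. \<xi> ^ w a = \<xi> ^ \<gamma> a) \<longleftrightarrow> \<gamma> = \<delta>"
      proof
        assume *: "\<forall>a\<in>{1..n}. \<xi> ^ w a = \<xi> ^ \<gamma> a"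
        show "\<gamma> = \<delta>"
        proof (rule PiE_ext[OF that \<delta>])
          fix a assume a: "a \<in> {1..n}"
          show "\<gamma> a = \<delta> a"
            using a * h[of "w a"] that by (intro colour_inj) (auto simp: \<delta>_def)
        qed
      qed (use h in \<open>auto simp: \<delta>_def\<close>)
      then show ?thesis by (simp add: part_def)
    qed
    then have "(\<Sum>\<gamma>\<in>?\<Gamma>. part \<gamma> w) = (\<Sum>\<gamma>\<in>?\<Gamma>. if \<gamma> = \<delta> then F w else 0)"
      by (intro sum.cong) auto
    also have "\<dots> = F w" using \<delta> fin by (subst sum.delta) auto
    finally show "F w = (\<Sum>\<gamma>\<in>?\<Gamma>. part \<gamma>) w" by (simp only: sum_fun_apply)
  qed
  moreover have "P (\<Sum>\<gamma>\<in>G. part \<gamma>)" if "finite G" "G \<subseteq> ?\<Gamma>" for G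
    using that
  proof (induction G rule: finite_induct)
    case empty
    show ?case by (simp only: sum.empty zero)
  next
    case (insert \<gamma> G)
    have "part \<gamma> \<in> M.V (\<lambda>a. \<xi> ^ \<gamma> a)"
      by (auto simp: M.V_def part_def tensor_t_def fun_eq_iff)
    then have "P (part \<gamma>)" using insert.prems by (intro V[of \<gamma>]) auto
    moreover have "P (\<Sum>\<gamma>\<in>G. part \<gamma>)" using insert by simp
    ultimately show ?case unfolding sum.insert[OF insert.hyps] by (rule add)
  qed
  ultimately show ?thesis using fin by (metis order_refl)
qed

text \<open>
  Tensor space is spanned by vectors on which all the \<open>L\<^sub>a\<close> act through the contents of a standard
  multitableau: split by colours, then by weights of the modules so obtained.
\<close>

theorem tableau_vectors_induct:
  assumes zero: "P 0" and add: "\<And>F H. P F \<Longrightarrow> P H \<Longrightarrow> P (F + H)"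
    and tab: "\<And>F t. t \<in> Std d n \<Longrightarrow> F \<in> tableau_vectors t \<Longrightarrow> P F"
  shows "P F"
proof (rule colour_induct[OF zero add])
  fix F \<gamma> assume \<gamma>: "\<And>a. a \<in> {1..n} \<Longrightarrow> \<gamma> a \<in> {1..d}" and F: "F \<in> M.V (\<lambda>a. \<xi> ^ \<gamma> a)"
  from F show "P F"
  proof (induction rule: M.weight_space_induct)
    case zero
    then show ?case using assms(1) .
  next
    case (add y z)
    then show ?case using assms(2) by blast
  next
    case (weight F k)
    have occ: "occurrences (\<lambda>a. (k a, \<gamma> a)) (e, p) j = 
        (if p \<in> {1..d} then occurrences (\<lambda>a. (k a, \<xi> ^ \<gamma> a)) (e, \<xi> ^ p) j else 0)" if "j \<le> n" for e p j
    proof -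
      have "{a \<in> {1..j}. (k a, \<gamma> a) = (e, p)} = 
          (if p \<in> {1..d} then {a \<in> {1..j}. (k a, \<xi> ^ \<gamma> a) = (e, \<xi> ^ p)} else {})"
      proof -
        have "\<gamma> a = p \<longleftrightarrow> p \<in> {1..d} \<and> \<xi> ^ \<gamma> a = \<xi> ^ p" if "a \<in> {1..j}" for a
          using \<gamma>[of a] colour_inj[of "\<gamma> a" p] that \<open>j \<le> n\<close> by auto
        then show ?thesis by auto
      qed
      then show ?thesis by (simp add: occurrences_def)
    qed
    have "balanced n (\<lambda>a. (k a, \<gamma> a))"
      using weight(3) unfolding balanced_def by (simp add: occ)
    from balanced_Std[OF this, of d] \<gamma> obtain t
      where t: "t \<in> Std d n" "\<forall>a\<in>{1..n}. diagonal_letter t a = (k a, \<gamma> a)" by auto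
    have "rep (free_L a) F = (\<lambda>w. content n v \<xi> t a * F w)" if a: "a \<in> {1..2 * n}" for a
    proof (cases "a \<le> n")
      case True
      then show ?thesis
        using a t(2) weight(2)[of a] by (simp add: free_L_def rep_X content_diagonal_letter)
    next
      case False
      then have "a - n \<in> {1..n}" using a by auto
      then show ?thesis
        using False t(2) weight(1) by (simp add: free_L_def tensor_rep_var content_diagonal_letter M.V_def)
    qed
    then have "F \<in> tableau_vectors t" by (simp add: tableau_vectors_def)
    then show ?case using tab t(1) by blast
  qed
qed

text \<open>
  \<open>acts f \<chi>\<close> says that \<open>f\<close> acts diagonally on the tableau vectors; since these span the faithful
  module, the function \<open>\<chi>\<close> determines the class of \<open>f\<close>.
\<close>

definition acts :: "(yh_gen list \<Rightarrow>\<^sub>0 'r) \<Rightarrow> (multitableau \<Rightarrow> 'r) \<Rightarrow> bool" where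
  "acts f \<chi> \<longleftrightarrow> f \<in> carrier A \<and>
     (\<forall>t\<in>Std d n. \<forall>F\<in>tableau_vectors t. rep f F = (\<lambda>w. \<chi> t * F w))"

lemma acts_A: "acts f \<chi> \<Longrightarrow> f \<in> carrier A"
  by (simp add: acts_def)

lemma acts_cong: "acts f \<chi> \<Longrightarrow> (\<And>t. t \<in> Std d n \<Longrightarrow> \<chi> t = \<chi>' t) \<Longrightarrow> acts f \<chi>'"
  by (simp add: acts_def)

lemma acts_const: "c \<in> S \<Longrightarrow> acts (const c) (\<lambda>_. c)"
  by (simp add: acts_def tensor_rep_const)

lemma acts_1: "acts 1 (\<lambda>_. 1)"
  using acts_const[OF S_1] by (simp add: const_simps)

lemma acts_L: "a \<in> {1..2 * n} \<Longrightarrow> acts (free_L a) (\<lambda>t. content n v \<xi> t a)"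
  by (simp add: acts_def tableau_vectors_def)

lemma acts_add: "acts f \<chi> \<Longrightarrow> acts g \<chi>' \<Longrightarrow> acts (f + g) (\<lambda>t. \<chi> t + \<chi>' t)"
  by (auto simp: acts_def tensor_rep_add fun_eq_iff distrib_right)

lemma acts_diff: "acts f \<chi> \<Longrightarrow> acts g \<chi>' \<Longrightarrow> acts (f - g) (\<lambda>t. \<chi> t - \<chi>' t)"
  by (auto simp: acts_def tensor_rep_diff fun_eq_iff left_diff_distrib)

lemma acts_mult: "acts f \<chi> \<Longrightarrow> acts g \<chi>' \<Longrightarrow> acts (f * g) (\<lambda>t. \<chi> t * \<chi>' t)"
  unfolding acts_def
proof (intro conjI ballI)
  assume f: "f \<in> carrier A \<and> (\<forall>t\<in>Std d n. \<forall>F\<in>tableau_vectors t. rep f F = (\<lambda>w. \<chi> t * F w))"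
    and g: "g \<in> carrier A \<and> (\<forall>t\<in>Std d n. \<forall>F\<in>tableau_vectors t. rep g F = (\<lambda>w. \<chi>' t * F w))"
  show "f * g \<in> carrier A" using f g by simp
  fix t F assume t: "t \<in> Std d n" "F \<in> tableau_vectors t"
  have "rep (f * g) F = rep f (\<lambda>w. \<chi>' t * F w)" using g t by (simp add: tensor_rep_mult)
  also have "\<dots> = (\<lambda>w. \<chi>' t * rep f F w)" by (rule tensor_rep_linear(2))
  also have "\<dots> = (\<lambda>w. \<chi> t * \<chi>' t * F w)" using f t by (simp add: mult_ac)
  finally show "rep (f * g) F = (\<lambda>w. \<chi> t * \<chi>' t * F w)" .
qed

lemma acts_0: "acts 0 (\<lambda>_. 0)"
  using acts_const[OF S_0] by (simp add: const_simps)

lemma acts_sum: "finite I \<Longrightarrow> (\<And>i. i \<in> I \<Longrightarrow> acts (f i) (\<chi> i)) \<Longrightarrow> acts (\<Sum>i\<in>I. f i) (\<lambda>t. \<Sum>i\<in>I. \<chi> i t)"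
  by (induction I rule: finite_induct) (auto simp: acts_0 intro: acts_add)

lemma acts_prod_list: 
  "(\<And>i. i \<in> set is \<Longrightarrow> acts (f i) (\<chi> i)) \<Longrightarrow> acts (prod_list (map f is)) (\<lambda>t. prod_list (map (\<lambda>i. \<chi> i t) is))"
  by (induction "is") (auto simp: acts_1 intro: acts_mult)

theorem acts_cls_eq:
  assumes f: "acts f \<chi>" and g: "acts g \<chi>'" and eq: "\<And>t. t \<in> Std d n \<Longrightarrow> \<chi> t = \<chi>' t"
  shows "cls f = cls g"
proof -
  have "rep f F = rep g F" for F
  proof (induction F rule: tableau_vectors_induct)
    case (2 F H)
    then show ?case by (simp only: tensor_rep_linear(1))
  next
    case (3 F t)
    then show ?case using f g eq by (simp add: acts_def)
  qed (simp only: tensor_rep_arg_0)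
  then show ?thesis using cls_eq_iff_rep f g by (simp add: acts_def)
qed

end

section \<open>Products of commuting factors\<close>

text \<open>
  In a noncommutative monoid the fold that defines a finite product is still independent of the order
  when the factors commute with each other, and then any enumeration of the index set computes it.
\<close>

lemma (in Group.monoid) finprod_commuting:
  assumes xs: "distinct xs" "set xs = I"
    and g: "\<And>i. i \<in> I \<Longrightarrow> f i = g i" "\<And>i. i \<in> I \<Longrightarrow> g i \<in> carrier G"
    and comm: "\<And>i j. i \<in> I \<Longrightarrow> j \<in> I \<Longrightarrow> g i \<otimes> g j = g j \<otimes> g i"
  shows "finprod G f I = foldr (\<lambda>i z. g i \<otimes> z) xs \<one>"
proof -
  interpret LCD I "carrier G" "mult G \<circ> f"
  proof
    fix x y z assume "x \<in> I" "y \<in> I" "z \<in> carrier G"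
    then show "(mult G \<circ> f) x ((mult G \<circ> f) y z) = (mult G \<circ> f) y ((mult G \<circ> f) x z)"
      using comm[of x y] g by (simp flip: m_assoc)
  qed (use g in auto)
  have "(set ys, foldr (\<lambda>i z. g i \<otimes> z) ys \<one>) \<in> foldSetD (carrier G) (mult G \<circ> f) \<one>"
    if "distinct ys" "set ys \<subseteq> I" for ys
    using that
  proof (induction ys)
    case (Cons i ys)
    have closed: "foldr (\<lambda>i z. g i \<otimes> z) ys \<one> \<in> carrier G"
      using Cons.prems g by (induction ys) auto
    have "(insert i (set ys), (mult G \<circ> f) i (foldr (\<lambda>i z. g i \<otimes> z) ys \<one>)) \<in> foldSetD (carrier G) (mult G \<circ> f) \<one>"
      using Cons closed g by (intro foldSetD.insertI) auto
    then show ?case using Cons.prems g by (simp add: comp_def)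
  next
    case Nil
    show ?case using foldSetD.emptyI[OF one_closed] by simp
  qed
  then have "foldD (carrier G) (mult G \<circ> f) \<one> I = foldr (\<lambda>i z. g i \<otimes> z) xs \<one>"
    using xs by (intro foldD_equality) auto
  moreover have "finite I" using xs by auto
  ultimately show ?thesis by (simp add: finprod_def)
qed

context yh_generic
begin

lemma finprod_cls:
  assumes "distinct xs" "set xs = I"
    and g: "\<And>i. i \<in> I \<Longrightarrow> g i = cls (f i)" and f: "\<And>i. i \<in> I \<Longrightarrow> acts (f i) (\<chi> i)"
  shows "finprod Y g I = cls (prod_list (map f xs))"
proof -
  have "finprod Y g I = foldr (\<lambda>i z. cls (f i) \<otimes>\<^bsub>Y\<^esub> z) xs \<one>\<^bsub>Y\<^esub>"
  proof (rule Y.finprod_commuting[OF assms(1,2) g])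
    fix i j assume ij: "i \<in> I" "j \<in> I"
    have "cls (f i * f j) = cls (f j * f i)"
      by (rule acts_cls_eq[OF acts_mult[OF f[OF ij(1)] f[OF ij(2)]] acts_mult[OF f[OF ij(2)] f[OF ij(1)]]])
        (simp add: mult.commute)
    then show "cls (f i) \<otimes>\<^bsub>Y\<^esub> cls (f j) = cls (f j) \<otimes>\<^bsub>Y\<^esub> cls (f i)"
      using ij by (simp add: cls_mult acts_A[OF f])
  qed (use acts_A[OF f] in auto)
  also have "\<dots> = cls (prod_list (map f xs))"
  proof -
    have "foldr (\<lambda>i z. cls (f i) \<otimes>\<^bsub>Y\<^esub> z) ys \<one>\<^bsub>Y\<^esub> = cls (prod_list (map f ys))" if "set ys \<subseteq> I" for ys
      using that
    proof (induction ys)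
      case (Cons i ys)
      have "prod_list (map f ys) \<in> carrier A" using Cons.prems acts_A[OF f] by (intro A_prod_list) auto
      then show ?case using Cons acts_A[OF f, of i] by (simp add: cls_mult)
    qed (simp add: cls_1)
    then show ?thesis using assms(2) by simp
  qed
  finally show ?thesis .
qed

text \<open>
  As \<open>v\<close> is not a root of unity and \<open>\<xi>\<close> is primitive, the values determine the diagonals and the
  components.
\<close>

lemma content_separates:
  assumes s: "s \<in> Std d n" and t: "t \<in> Std d n"
    and eq: "\<And>a. a \<in> {1..2 * n} \<Longrightarrow> content n v \<xi> s a = content n v \<xi> t a"
  shows "s = t"
proof (rule Std_determined_by_letters[OF s t])
  fix a assume a: "a \<in> {1..n}"
  have "v powi fst (diagonal_letter s a) = v powi fst (diagonal_letter t a)"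
    using eq[of a] a by (simp add: content_diagonal_letter)
  then have "fst (diagonal_letter s a) = fst (diagonal_letter t a)" by (simp add: M.powi_inj)
  moreover have "\<xi> ^ snd (diagonal_letter s a) = \<xi> ^ snd (diagonal_letter t a)"
    using eq[of "n + a"] a by (simp add: content_diagonal_letter)
  then have "snd (diagonal_letter s a) = snd (diagonal_letter t a)"
    using diagonal_letter_component[OF s a] diagonal_letter_component[OF t a] by (intro colour_inj)
  ultimately show "diagonal_letter s a = diagonal_letter t a" by (simp add: prod_eq_iff)
qed

end

section \<open>Class idempotents\<close>

text \<open>
  The algebras over the rational functions, the valuation ring and the ground field are the
  interpretations \<open>K\<close>, \<open>O\<close> and \<open>k\<close>; reduction and inclusion of coefficients are \<open>red\<close> and \<open>inc\<close>.
\<close>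

locale yh_reduction =
  fixes q \<xi> :: "'k::field" and d n :: nat
  assumes d_pos: "0 < d" and char: "CHAR('k) = 0 \<or> coprime d CHAR('k)"
    and xi_prim: "primitive_root_of_unity d \<xi>" and q_nz: "q \<noteq> 0" and q_1: "q \<noteq> 1"
begin

abbreviation \<zeta> :: "'k poly fract" where "\<zeta> \<equiv> fract_const \<xi>"
abbreviation res_map :: "'k poly fract \<Rightarrow> 'k" where "res_map \<equiv> residue_map q"
abbreviation "\<O> \<equiv> local_ring q"

lemma d_nz: "of_nat d \<noteq> (0 :: 'k)"
proof
  assume "of_nat d = (0 :: 'k)"
  then have "CHAR('k) dvd d" by (simp add: of_nat_eq_0_iff_char_dvd)
  then show False using char d_pos by (auto dest: coprime_common_divisor)
qed

lemma zeta_prim: "primitive_root_of_unity d \<zeta>"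
  using xi_prim fract_const_eq_iff[of _ 1]
  by (auto simp: primitive_root_of_unity_def fract_const_hom simp flip: fract_const_power)

lemma d_nz_fract: "of_nat d \<noteq> (0 :: 'k poly fract)"
  using d_nz fract_const_eq_iff[of "of_nat d :: 'k" 0]
  by (simp only: fract_const_of_nat fract_const_hom(1)) simp

sublocale K: yh_generic UNIV d n "qhat :: 'k poly fract" \<zeta>
  by unfold_locales (use d_pos zeta_prim d_nz_fract qhat_nz qhat_generic in auto)

lemma d_inv_local: "1 / of_nat d \<in> \<O>"
proof -
  have "inverse (fract_const (of_nat d)) \<in> \<O>"
    using d_nz by (intro residue_inverse(1)[OF q_nz]) (simp_all add: residue_const[OF q_nz])
  then show ?thesis by (simp add: fract_const_of_nat inverse_eq_divide)
qed

sublocale O: yh_generic \<O> d n "qhat :: 'k poly fract" \<zeta>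
  by unfold_locales
    (use d_pos zeta_prim d_nz_fract qhat_nz qhat_generic d_inv_local residue_0_1[OF q_nz]
      residue_add(1)[OF q_nz] residue_mult(1)[OF q_nz] residue_uminus(1)[OF q_nz] residue_qhat[OF q_nz]
      residue_inverse(1)[OF q_nz] residue_const[OF q_nz] q_nz in auto)

sublocale k: yh_coeffs UNIV d n q \<xi>
  by unfold_locales (use d_pos xi_prim d_nz q_nz in auto)

sublocale red: yh_change \<O> UNIV d n qhat q \<zeta> \<xi> res_map
  by unfold_locales (use residue_0_1[OF q_nz] residue_add(2)[OF q_nz] residue_mult(2)[OF q_nz]
      residue_qhat(2)[OF q_nz] in auto)

sublocale inc: yh_change \<O> UNIV d n qhat qhat \<zeta> \<zeta> id
  by unfold_locales auto

lemma inc_\<Phi>: "inc.\<Phi> f = f"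
  by (rule poly_mapping_eqI) (simp add: inc.lookup_\<Phi>)

lemma O_A_K: "f \<in> carrier O.A \<Longrightarrow> f \<in> carrier K.A"
  by (simp add: O.in_A_iff K.in_A_iff)

lemma acts_O_K: "O.acts f \<chi> \<Longrightarrow> K.acts f \<chi>"
  by (auto simp: O.acts_def K.acts_def O_A_K)

abbreviation ct :: "multitableau \<Rightarrow> nat \<Rightarrow> 'k poly fract" where
  "ct t a \<equiv> content n qhat \<zeta> t a"

definition contents :: "nat \<Rightarrow> 'k poly fract set" where
  "contents a = (\<lambda>u. ct u a) ` Std d n"

lemma finite_contents: "finite (contents a)"
  unfolding contents_def by (intro finite_imageI finite_Std)

definition listing :: "'a set \<Rightarrow> 'a list" where
  "listing C = (SOME cs. set cs = C \<and> distinct cs)"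

text \<open>
  The products of the generic idempotents, but over arbitrary finite sets \<open>C a\<close> of contents to be
  removed; this also covers the product needed for the integral lift.
\<close>

definition interpolation :: "multitableau \<Rightarrow> (nat \<Rightarrow> 'k poly fract set) \<Rightarrow> (yh_gen list \<Rightarrow>\<^sub>0 'k poly fract)" where
  "interpolation t C = prod_list (map (\<lambda>a. prod_list (map
     (\<lambda>c. const (1 / (ct t a - c)) * (K.free_L a - const c)) (listing (C a)))) [1..<Suc (2 * n)])"

lemma enumeration:
  assumes "finite C"
  shows "distinct (listing C)" "set (listing C) = C"
  using someI_ex[OF finite_distinct_list[OF assms]] by (simp_all add: listing_def)

lemma acts_factor: "a \<in> {1..2 * n} \<Longrightarrow>
    K.acts (const (1 / (ct t a - c)) * (K.free_L a - const c)) (\<lambda>s. (1 / (ct t a - c)) * (ct s a - c))"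
  by (intro K.acts_mult K.acts_diff K.acts_const K.acts_L) auto

lemma acts_factor_O: "a \<in> {1..2 * n} \<Longrightarrow> c \<in> \<O> \<Longrightarrow> 1 / (ct t a - c) \<in> \<O> \<Longrightarrow>
    O.acts (const (1 / (ct t a - c)) * (K.free_L a - const c)) (\<lambda>s. (1 / (ct t a - c)) * (ct s a - c))"
  by (intro O.acts_mult O.acts_diff O.acts_const O.acts_L) auto

definition interpolation_value :: "multitableau \<Rightarrow> (nat \<Rightarrow> 'k poly fract set) \<Rightarrow> multitableau \<Rightarrow> 'k poly fract" where
  "interpolation_value t C s = (\<Prod>a\<in>{1..2 * n}. \<Prod>c\<in>C a. (1 / (ct t a - c)) * (ct s a - c))"

lemma prod_list_interpolation_value:
  assumes "\<And>a. a \<in> {1..2 * n} \<Longrightarrow> finite (C a)"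
  shows "prod_list (map (\<lambda>a. prod_list (map (\<lambda>c. (1 / (ct t a - c)) * (ct s a - c))
      (listing (C a)))) [1..<Suc (2 * n)]) = interpolation_value t C s"
proof -
  have "prod_list (map (\<lambda>c. (1 / (ct t a - c)) * (ct s a - c)) (listing (C a))) =
      (\<Prod>c\<in>C a. (1 / (ct t a - c)) * (ct s a - c))" if "a \<in> {1..2 * n}" for a
    using prod.distinct_set_conv_list[OF enumeration(1)[OF assms[OF that]], of "\<lambda>c. (1 / (ct t a - c)) * (ct s a - c)"]
      enumeration(2)[OF assms[OF that]] by simp
  then have "map (\<lambda>a. prod_list (map (\<lambda>c. (1 / (ct t a - c)) * (ct s a - c)) (listing (C a)))) [1..<Suc (2 * n)] =
      map (\<lambda>a. \<Prod>c\<in>C a. (1 / (ct t a - c)) * (ct s a - c)) [1..<Suc (2 * n)]"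
    by (intro map_cong) auto
  moreover have "prod_list (map (\<lambda>a. \<Prod>c\<in>C a. (1 / (ct t a - c)) * (ct s a - c)) [1..<Suc (2 * n)]) = interpolation_value t C s"
    unfolding interpolation_value_def
    by (subst prod.distinct_set_conv_list[symmetric]) (auto simp: atLeastLessThanSuc_atLeastAtMost simp del: upt_Suc)
  ultimately show ?thesis by (simp only:)
qed

lemma acts_interpolation:
  assumes "\<And>a. a \<in> {1..2 * n} \<Longrightarrow> finite (C a)"
  shows "K.acts (interpolation t C) (interpolation_value t C)"
proof (rule K.acts_cong)
  show "K.acts (interpolation t C) (\<lambda>s. prod_list (map (\<lambda>a. prod_list (map (\<lambda>c. (1 / (ct t a - c)) * (ct s a - c))
      (listing (C a)))) [1..<Suc (2 * n)]))"
    unfolding interpolation_def by (intro K.acts_prod_list acts_factor) auto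
qed (rule prod_list_interpolation_value[OF assms])

lemma acts_interpolation_O:
  assumes fin: "\<And>a. a \<in> {1..2 * n} \<Longrightarrow> finite (C a)"
    and C: "\<And>a c. a \<in> {1..2 * n} \<Longrightarrow> c \<in> C a \<Longrightarrow> c \<in> \<O> \<and> 1 / (ct t a - c) \<in> \<O>"
  shows "O.acts (interpolation t C) (interpolation_value t C)"
proof (rule O.acts_cong)
  show "O.acts (interpolation t C) (\<lambda>s. prod_list (map (\<lambda>a. prod_list (map (\<lambda>c. (1 / (ct t a - c)) * (ct s a - c))
      (listing (C a)))) [1..<Suc (2 * n)]))"
    unfolding interpolation_def
  proof (intro O.acts_prod_list acts_factor_O)
    fix a c assume a: "a \<in> set [1..<Suc (2 * n)]" and c: "c \<in> set (listing (C a))"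
    then show a': "a \<in> {1..2 * n}" by auto
    then have "c \<in> C a" using c enumeration(2)[OF fin[OF a']] by simp
    then show "c \<in> \<O>" "1 / (ct t a - c) \<in> \<O>" using C[OF a'] by auto
  qed
qed (rule prod_list_interpolation_value[OF fin])

abbreviation other_contents :: "multitableau \<Rightarrow> nat \<Rightarrow> 'k poly fract set" where
  "other_contents t a \<equiv> {c \<in> contents a. c \<noteq> ct t a}"

lemma generic_idempotent_cls:
  "generic_idempotent \<xi> d n t = K.cls (interpolation t (other_contents t))"
proof -
  have inner: "finprod K.Y (\<lambda>c. yh_scalar UNIV d n qhat (1 / (ct t a - c)) \<otimes>\<^bsub>K.Y\<^esub>
              (yh_L UNIV d n qhat a \<ominus>\<^bsub>K.Y\<^esub> yh_scalar UNIV d n qhat c)) (other_contents t a) =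
      K.cls (prod_list (map (\<lambda>c. const (1 / (ct t a - c)) * (K.free_L a - const c))
        (listing (other_contents t a))))"
    if a: "a \<in> {1..2 * n}" for a
  proof (rule K.finprod_cls)
    have fin: "finite (other_contents t a)" using finite_contents by simp
    show "distinct (listing (other_contents t a))"
      "set (listing (other_contents t a)) = other_contents t a"
      by (rule enumeration[OF fin])+
    fix c
    show "yh_scalar UNIV d n qhat (1 / (ct t a - c)) \<otimes>\<^bsub>K.Y\<^esub> (yh_L UNIV d n qhat a \<ominus>\<^bsub>K.Y\<^esub> yh_scalar UNIV d n qhat c) =
      K.cls (const (1 / (ct t a - c)) * (K.free_L a - const c))"
      using a by (simp add: yh_scalar_def K.yh_L_cls K.cls_mult K.cls_diff)
    show "K.acts (const (1 / (ct t a - c)) * (K.free_L a - const c)) (\<lambda>s. (1 / (ct t a - c)) * (ct s a - c))"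
      by (rule acts_factor[OF a])
  qed
  have set_eq: "{c. c \<in> (\<lambda>u. generic_content n \<xi> u a) ` Std d n \<and> c \<noteq> generic_content n \<xi> t a} = other_contents t a" for a
    by (auto simp: generic_content_def contents_def)
  have "generic_idempotent \<xi> d n t = finprod K.Y (\<lambda>a. finprod K.Y
      (\<lambda>c. yh_scalar UNIV d n qhat (1 / (ct t a - c)) \<otimes>\<^bsub>K.Y\<^esub>
         (yh_L UNIV d n qhat a \<ominus>\<^bsub>K.Y\<^esub> yh_scalar UNIV d n qhat c)) (other_contents t a)) {1..2 * n}"
    unfolding generic_idempotent_def Let_def set_eq by (simp only: generic_content_def)
  also have "\<dots> = K.cls (interpolation t (other_contents t))"
    unfolding interpolation_def
  proof (rule K.finprod_cls[OF _ _ inner])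
    show "set [1..<Suc (2 * n)] = {1..2 * n}"
      by (simp add: atLeastLessThanSuc_atLeastAtMost del: upt_Suc)
    show "K.acts (prod_list (map (\<lambda>c. const (1 / (ct t a - c)) * (K.free_L a - const c)) (listing (other_contents t a))))
        (\<lambda>s. prod_list (map (\<lambda>c. (1 / (ct t a - c)) * (ct s a - c)) (listing (other_contents t a))))"
      if "a \<in> {1..2 * n}" for a
      using that by (intro K.acts_prod_list acts_factor)
  qed simp
  finally show ?thesis .
qed

lemma interpolation_value_other:
  assumes s: "s \<in> Std d n" and t: "t \<in> Std d n"
  shows "interpolation_value t (other_contents t) s = (if s = t then 1 else 0)"
proof (cases "s = t")
  case True
  then show ?thesis by (auto simp: interpolation_value_def intro!: prod.neutral)
next
  case False
  then obtain a where a: "a \<in> {1..2 * n}" "ct s a \<noteq> ct t a"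
    using K.content_separates[OF s t] by blast
  then have "ct s a \<in> other_contents t a" using s by (auto simp: contents_def)
  then have "(\<Prod>c\<in>other_contents t a. (1 / (ct t a - c)) * (ct s a - c)) = 0"
    using finite_contents by (intro prod_zero) auto
  then show ?thesis using False a(1) by (auto simp: interpolation_value_def)
qed

lemma acts_generic_idempotent:
  "t \<in> Std d n \<Longrightarrow> K.acts (interpolation t (other_contents t)) (\<lambda>s. if s = t then 1 else 0)"
  by (rule K.acts_cong[OF acts_interpolation]) (auto simp: finite_contents interpolation_value_other)

lemma generic_class_idempotent_cls:
  assumes T: "T \<subseteq> Std d n" and f: "K.acts f (\<lambda>s. if s \<in> T then 1 else 0)"
  shows "generic_class_idempotent \<xi> d n T = K.cls f"
proof -
  have fin: "finite T" using T finite_Std by (rule finite_subset)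
  let ?e = "\<lambda>t. interpolation t (other_contents t)"
  have e: "K.acts (?e t) (\<lambda>s. if s = t then 1 else 0)" if "t \<in> T" for t
    using that T by (intro acts_generic_idempotent) auto
  have "generic_class_idempotent \<xi> d n T = finsum K.Y (\<lambda>t. K.cls (?e t)) T"
    unfolding generic_class_idempotent_def
    using K.acts_A[OF e] by (intro K.Y.finsum_cong') (auto simp: generic_idempotent_cls)
  also have "\<dots> = K.cls (\<Sum>t\<in>T. ?e t)"
    using K.acts_A[OF e] fin by (intro K.cls_sum[symmetric]) auto
  also have "\<dots> = K.cls f"
    using fin by (intro K.acts_cls_eq[OF K.acts_sum[OF fin e] f]) (auto simp: sum.delta)
  finally show ?thesis .
qed

lemma ct_local: "ct t a \<in> \<O>" "res_map (ct t a) = content n q \<xi> t a"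
  using residue_qhat_powi[OF q_nz] residue_const[OF q_nz]
  by (auto simp: content_diagonal_letter simp flip: fract_const_power)

abbreviation tableau_classes :: "multitableau set set" where
  "tableau_classes \<equiv> Std d n // content_equiv q \<xi> d n"

lemma equiv_content: "equiv (Std d n) (content_equiv q \<xi> d n)"
  by (auto simp: content_equiv_def intro!: equivI refl_onI symI transI)

lemma class_iff:
  assumes "T \<in> tableau_classes" "t \<in> T"
  shows "s \<in> T \<longleftrightarrow> s \<in> Std d n \<and> (\<forall>a\<in>{1..2 * n}. content n q \<xi> s a = content n q \<xi> t a)"
    and "t \<in> Std d n"
proof -
  from assms(1) obtain x where x: "T = content_equiv q \<xi> d n `` {x}" by (rule quotientE)
  then have "(x, t) \<in> content_equiv q \<xi> d n" using assms(2) by simp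
  then have T: "T = content_equiv q \<xi> d n `` {t}"
    unfolding x by (rule equiv_class_eq[OF equiv_content])
  show "t \<in> Std d n" using assms T by (auto simp: content_equiv_def)
  then show "s \<in> T \<longleftrightarrow> s \<in> Std d n \<and> (\<forall>a\<in>{1..2 * n}. content n q \<xi> s a = content n q \<xi> t a)"
    unfolding T by (auto simp: content_equiv_def)
qed

lemma class_nonempty: "T \<in> tableau_classes \<Longrightarrow> \<exists>t. t \<in> T"
  using in_quotient_imp_non_empty[OF equiv_content] by blast

lemma class_subset: "T \<in> tableau_classes \<Longrightarrow> T \<subseteq> Std d n"
  using in_quotient_imp_subset[OF equiv_content] by blast

text \<open>
  An interpolation product over the contents that differ from those of the class even after
  reduction has coefficients in the valuation ring. It vanishes outside the class, but on the class
  it takes values \<open>\<phi>\<^sub>u\<close> that are only congruent to 1; they are units, so \<open>1 - \<Prod>\<^sub>u (1 - F / \<phi>\<^sub>u)\<close>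
  corrects them to 1.
\<close>

lemma integral_lift:
  assumes T: "T \<in> tableau_classes"
  shows "\<exists>f. O.acts f (\<lambda>s. if s \<in> T then 1 else 0)"
proof -
  obtain t where t: "t \<in> T" using class_nonempty[OF T] by blast
  define C where "C a = {c \<in> contents a. res_map c \<noteq> res_map (ct t a)}" for a
  define \<phi> where "\<phi> = interpolation_value t C"
  have C: "c \<in> \<O> \<and> 1 / (ct t a - c) \<in> \<O> \<and> res_map (1 / (ct t a - c)) = 1 / (res_map (ct t a) - res_map c)
      \<and> res_map (ct t a) - res_map c \<noteq> 0" if "c \<in> C a" for a c
  proof -
    have c: "c \<in> \<O>" using that ct_local by (auto simp: C_def contents_def)
    have r: "res_map (ct t a - c) = res_map (ct t a) - res_map c"
      by (rule residue_diff(2)[OF q_nz ct_local(1) c])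
    have nz: "res_map (ct t a - c) \<noteq> 0" using that unfolding r by (auto simp: C_def)
    from residue_inverse[OF q_nz residue_diff(1)[OF q_nz ct_local(1) c] nz] nz c show ?thesis
      by (simp add: r inverse_eq_divide)
  qed
  have F: "O.acts (interpolation t C) \<phi>"
    unfolding \<phi>_def using C finite_contents by (intro acts_interpolation_O) (auto simp: C_def)
  have outside: "\<phi> s = 0" if s: "s \<in> Std d n" "s \<notin> T" for s
  proof -
    obtain a where a: "a \<in> {1..2 * n}" "content n q \<xi> s a \<noteq> content n q \<xi> t a"
      using class_iff(1)[OF T t, of s] s by blast
    then have "ct s a \<in> C a" using s ct_local by (auto simp: C_def contents_def)
    then have "(\<Prod>c\<in>C a. (1 / (ct t a - c)) * (ct s a - c)) = 0"
      using finite_contents by (intro prod_zero) (auto simp: C_def)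
    then show ?thesis using a(1) by (auto simp: \<phi>_def interpolation_value_def)
  qed
  have inside: "\<phi> s \<in> \<O> \<and> res_map (\<phi> s) = 1" if s: "s \<in> T" for s
  proof -
    have factor: "(1 / (ct t a - c)) * (ct s a - c) \<in> \<O> \<and> res_map ((1 / (ct t a - c)) * (ct s a - c)) = 1"
      if a: "a \<in> {1..2 * n}" and c: "c \<in> C a" for a c
    proof -
      have "res_map (ct s a) = res_map (ct t a)"
        using class_iff(1)[OF T t, of s] s a ct_local by simp
      moreover have d: "ct s a - c \<in> \<O>" "res_map (ct s a - c) = res_map (ct s a) - res_map c"
        using residue_diff[OF q_nz ct_local(1)] C[OF c] by auto
      ultimately show ?thesis
        using residue_mult[OF q_nz _ d(1), of "1 / (ct t a - c)"] C[OF c] by simp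
    qed
    have inner: "(\<Prod>c\<in>C a. (1 / (ct t a - c)) * (ct s a - c)) \<in> \<O> \<and>
        res_map (\<Prod>c\<in>C a. (1 / (ct t a - c)) * (ct s a - c)) = 1" if a: "a \<in> {1..2 * n}" for a
      using residue_prod[OF q_nz, of "C a" "\<lambda>c. (1 / (ct t a - c)) * (ct s a - c)"] factor[OF a] by simp
    show ?thesis
      using residue_prod[OF q_nz, of "{1..2 * n}" "\<lambda>a. \<Prod>c\<in>C a. (1 / (ct t a - c)) * (ct s a - c)"] inner
      by (simp add: \<phi>_def interpolation_value_def)
  qed
  have unit: "1 / \<phi> s \<in> \<O>" "\<phi> s \<noteq> 0" if "s \<in> T" for s
    using residue_inverse(1)[OF q_nz, of "\<phi> s"] inside[OF that] residue_0_1(3)[OF q_nz]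
    by (auto simp: inverse_eq_divide)
  have "finite T" using finite_subset[OF class_subset[OF T] finite_Std] .
  then obtain us where us: "set us = T" using finite_list by blast
  have E: "O.acts (1 - prod_list (map (\<lambda>u. 1 - const (1 / \<phi> u) * interpolation t C) us))
      (\<lambda>s. 1 - prod_list (map (\<lambda>u. 1 - (1 / \<phi> u) * \<phi> s) us))"
    using us unit by (intro O.acts_diff O.acts_1 O.acts_prod_list O.acts_mult O.acts_const F) auto
  have "1 - prod_list (map (\<lambda>u. 1 - (1 / \<phi> u) * \<phi> s) us) = (if s \<in> T then 1 else 0)"
    if s: "s \<in> Std d n" for s
  proof (cases "s \<in> T")
    case True
    then have "prod_list (map (\<lambda>u. 1 - (1 / \<phi> u) * \<phi> s) us) = 0"
      using us unit(2)[OF True] by (auto simp: prod_list_zero_iff intro!: image_eqI[of _ _ s])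
    then show ?thesis using True by simp
  next
    case False
    have "prod_list (map (\<lambda>u. 1 - (1 / \<phi> u) * \<phi> s) us) = 1"
      using outside[OF s False] by (induction us) auto
    then show ?thesis using False by simp
  qed
  from O.acts_cong[OF E this] show ?thesis by blast
qed

definition lift :: "multitableau set \<Rightarrow> (yh_gen list \<Rightarrow>\<^sub>0 'k poly fract)" where
  "lift T = (SOME f. O.acts f (\<lambda>s. if s \<in> T then 1 else 0))"

lemma acts_lift: "T \<in> tableau_classes \<Longrightarrow> O.acts (lift T) (\<lambda>s. if s \<in> T then 1 else 0)"
  unfolding lift_def by (rule someI_ex) (rule integral_lift)

text \<open>
  Existence of the lift is the previous construction. Uniqueness holds since the algebras over the
  valuation ring and over its fraction field act faithfully on the same space.
\<close>

lemma integral_class_idempotent_cls: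
  assumes T: "T \<in> tableau_classes"
  shows "integral_class_idempotent q \<xi> d n T = O.cls (lift T)"
  unfolding integral_class_idempotent_def
proof (rule the_equality)
  have A: "lift T \<in> carrier O.A" using O.acts_A[OF acts_lift[OF T]] .
  have g: "generic_class_idempotent \<xi> d n T = K.cls (lift T)"
    by (rule generic_class_idempotent_cls[OF class_subset[OF T] acts_O_K[OF acts_lift[OF T]]])
  show "O.cls (lift T) \<in> carrier O.Y \<and>
      yh_base_change id UNIV d n qhat (O.cls (lift T)) = generic_class_idempotent \<xi> d n T"
    using A inc.base_change_cls[OF A] by (simp add: g inc_\<Phi>)
  fix x assume x: "x \<in> carrier O.Y \<and> yh_base_change id UNIV d n qhat x = generic_class_idempotent \<xi> d n T"
  then obtain f where f: "f \<in> carrier O.A" "x = O.cls f" by (auto simp: O.carrier_Y)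
  then have "K.cls f = K.cls (lift T)"
    using x inc.base_change_cls[OF f(1)] by (simp add: g inc_\<Phi>)
  then have "\<forall>F. K.rep f F = K.rep (lift T) F"
    using K.cls_eq_iff_rep f(1) A O_A_K by blast
  then show "x = O.cls (lift T)" using O.cls_eq_iff_rep f A by simp
qed

lemma class_idempotent_cls:
  assumes T: "T \<in> tableau_classes"
  shows "class_idempotent q \<xi> d n T = k.cls (red.\<Phi> (lift T))"
  unfolding class_idempotent_def integral_class_idempotent_cls[OF T]
  by (rule red.base_change_cls[OF O.acts_A[OF acts_lift[OF T]]])

end

section \<open>Weights and their idempotents\<close>

lemma power_int_primitive_root:
  assumes "primitive_root_of_unity e z" "0 < e"
  shows "z powi i = z powi j \<longleftrightarrow> i mod int e = j mod int e"
proof -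
  have z: "z \<noteq> 0" using assms by (auto simp: primitive_root_of_unity_def power_0_left)
  have ze: "z ^ e = 1" using assms by (simp add: primitive_root_of_unity_def)
  have red: "z powi i = z ^ nat (i mod int e)" for i
  proof -
    have "z powi (int e * (i div int e) + i mod int e) = z powi (int e * (i div int e)) * z powi (i mod int e)"
      using z by (intro power_int_add) auto
    also have "z powi (int e * (i div int e)) = 1" by (simp add: power_int_mult ze)
    also have "z powi (i mod int e) = z ^ nat (i mod int e)" using assms(2) by (simp add: power_int_def)
    finally show ?thesis by simp
  qed
  have "z ^ nat (i mod int e) = z ^ nat (j mod int e) \<longleftrightarrow> nat (i mod int e) = nat (j mod int e)"
    using primitive_root_power_inj[OF assms, of "nat (i mod int e)" "nat (j mod int e)"] assms(2)
    by (auto simp: nat_less_iff)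
  then show ?thesis using assms(2) by (simp add: red eq_nat_nat_iff)
qed

lemma power_int_quantum_char:
  fixes q :: "'k::field"
  assumes "q \<noteq> 0" "q \<noteq> 1"
  shows "q powi i = q powi j \<longleftrightarrow> i mod int (quantum_char q) = j mod int (quantum_char q)"
proof -
  have geo: "(\<Sum>i<m. q ^ i) = 0 \<longleftrightarrow> q ^ m = 1" for m
    using geometric_sum[of q m] assms by simp
  show ?thesis
  proof (cases "\<exists>m\<ge>1. q ^ m = 1")
    case False
    then have "quantum_char q = 0" by (auto simp: quantum_char_def geo)
    moreover have "q ^ m \<noteq> 1" if "0 < m" for m using False that by (metis Suc_leI One_nat_def)
    ultimately show ?thesis using power_int_generic_inj[of q i j] assms by auto
  next
    case True
    define e where "e = quantum_char q"
    have e: "e = (LEAST m. m \<ge> 1 \<and> q ^ m = 1)" using True by (simp add: e_def quantum_char_def geo)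
    have "e \<ge> 1 \<and> q ^ e = 1" unfolding e using True by (rule LeastI_ex)
    moreover have "q ^ m \<noteq> 1" if "0 < m" "m < e" for m
      using not_less_Least[OF that(2)[unfolded e]] that(1) by (simp add: Suc_le_eq)
    ultimately have "primitive_root_of_unity e q" "0 < e" by (auto simp: primitive_root_of_unity_def)
    from power_int_primitive_root[OF this] show ?thesis by (simp add: e_def)
  qed
qed

lemma int_residues_mod: "i mod int m \<in> int_residues m"
  by (simp add: int_residues_def)

context yh_coeffs
begin

lemma eqv_0_iff: "f \<in> carrier A \<Longrightarrow> f \<approx> 0 \<longleftrightarrow> cls f = \<zero>\<^bsub>Y\<^esub>"
  by (auto simp: eqv_def cls_0)

lemma eigenvector_power:
  assumes "z \<in> carrier A" "f \<in> carrier A" "\<alpha> \<in> S" "\<beta> \<in> S" "(z - const \<alpha>) * f \<approx> 0"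
  shows "(z - const \<beta>) ^ m * f \<approx> const ((\<alpha> - \<beta>) ^ m) * f"
proof (induction m)
  case 0
  then show ?case using assms by (simp add: const_simps)
next
  case (Suc m)
  have zA: "z - const \<beta> \<in> carrier A" using assms by auto
  have cA: "const ((\<alpha> - \<beta>) ^ m) \<in> carrier A" using assms by (intro A_const S_power S_diff)
  have "(z - const \<beta>) * f = (z - const \<alpha>) * f + const (\<alpha> - \<beta>) * f"
    by (simp add: const_simps algebra_simps)
  also have "\<dots> \<approx> 0 + const (\<alpha> - \<beta>) * f"
    using assms by (intro eqv_add assms(5)) (auto intro!: eqv_refl A_mult A_const S_diff)
  finally have 1: "(z - const \<beta>) * f \<approx> const (\<alpha> - \<beta>) * f" by simp
  have "(z - const \<beta>) ^ Suc m * f \<approx> (z - const \<beta>) * (const ((\<alpha> - \<beta>) ^ m) * f)"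
    using eqv_left[OF zA Suc] by (simp add: mult.assoc)
  also have "\<dots> = const ((\<alpha> - \<beta>) ^ m) * ((z - const \<beta>) * f)"
    by (rule const_left_commute)
  also have "\<dots> \<approx> const ((\<alpha> - \<beta>) ^ m) * (const (\<alpha> - \<beta>) * f)"
    by (rule eqv_left[OF cA 1])
  also have "\<dots> = const ((\<alpha> - \<beta>) ^ Suc m) * f"
    by (simp add: const_simps mult.assoc[symmetric] mult.commute[of _ "\<alpha> - \<beta>"] const_commute)
  finally show ?case .
qed

text \<open>
  Generalized eigenspaces for different eigenvalues meet in 0: by induction the vector is a genuine
  eigenvector for \<open>\<alpha>\<close>, on which \<open>z - \<beta>\<close> is invertible.
\<close>

lemma distinct_eigenvalues_0:
  assumes "z \<in> carrier A" "f \<in> carrier A" "\<alpha> \<in> S" "\<beta> \<in> S" "\<alpha> \<noteq> \<beta>" "inverse (\<alpha> - \<beta>) \<in> S"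
    and "(z - const \<alpha>) ^ N * f \<approx> 0" "(z - const \<beta>) ^ M * f \<approx> 0"
  shows "f \<approx> 0"
  using assms(2,7,8)
proof (induction N arbitrary: f)
  case (Suc N)
  have zA: "z - const \<alpha> \<in> carrier A" "z - const \<beta> \<in> carrier A" using assms by auto
  have comm: "(z - const \<beta>) ^ M * (z - const \<alpha>) = (z - const \<alpha>) * (z - const \<beta>) ^ M"
    by (rule power_commuting_commutes) (simp add: algebra_simps const_commute[of _ z] const_commute[of \<alpha> "const \<beta>"])
  have "(z - const \<alpha>) * f \<approx> 0"
  proof (rule Suc.IH)
    show "(z - const \<alpha>) ^ N * ((z - const \<alpha>) * f) \<approx> 0"
      using Suc.prems(2) by (simp add: power_Suc2 mult.assoc del: power_Suc)
    have "(z - const \<beta>) ^ M * ((z - const \<alpha>) * f) = (z - const \<alpha>) * ((z - const \<beta>) ^ M * f)"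
      by (simp only: mult.assoc[symmetric] comm)
    then show "(z - const \<beta>) ^ M * ((z - const \<alpha>) * f) \<approx> 0"
      using eqv_left[OF zA(1) Suc.prems(3)] by simp
  qed (use zA Suc.prems in auto)
  from eqv_trans[OF eqv_sym[OF eigenvector_power[OF assms(1) Suc.prems(1) assms(3,4) this]] Suc.prems(3)]
  have "const ((\<alpha> - \<beta>) ^ M) * f \<approx> 0" .
  from eqv_left[OF A_const[OF S_power[OF assms(6), of M]] this]
  have "const (inverse (\<alpha> - \<beta>) ^ M * (\<alpha> - \<beta>) ^ M) * f \<approx> 0"
    by (simp add: const_simps mult.assoc)
  moreover have "inverse (\<alpha> - \<beta>) ^ M * (\<alpha> - \<beta>) ^ M = 1"
    using assms(5) by (simp flip: power_mult_distrib)
  ultimately show ?case by (simp add: const_simps)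
qed simp

end

text \<open>
  Orthogonal idempotents summing to 1 are determined by the right ideals they generate: if
  \<open>f\<^sub>l = e\<^sub>l y\<close> for all \<open>l\<close>, then \<open>e\<^sub>k = \<Sum>\<^sub>l e\<^sub>k f\<^sub>l = f\<^sub>k\<close>.
\<close>

lemma (in ring) idempotent_family_unique:
  assumes e: "e \<in> K \<rightarrow>\<^sub>E carrier R" "\<And>k l. k \<in> K \<Longrightarrow> l \<in> K \<Longrightarrow> e k \<otimes> e l = (if k = l then e k else \<zero>)"
    and f: "f \<in> K \<rightarrow>\<^sub>E carrier R" "finite {k \<in> K. f k \<noteq> \<zero>}" "finsum R f {k \<in> K. f k \<noteq> \<zero>} = \<one>"
    and same: "\<And>k. k \<in> K \<Longrightarrow> (\<lambda>y. e k \<otimes> y) ` carrier R = (\<lambda>y. f k \<otimes> y) ` carrier R"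
  shows "e = f"
proof (rule PiE_ext[OF e(1) f(1)])
  fix k assume k: "k \<in> K"
  have eR: "e l \<in> carrier R" and fR: "f l \<in> carrier R" if "l \<in> K" for l
    using that e(1) f(1) by auto
  have ef: "e k \<otimes> f l = (if k = l then f l else \<zero>)" if l: "l \<in> K" for l
  proof -
    have "f l \<otimes> \<one> \<in> (\<lambda>y. e l \<otimes> y) ` carrier R" unfolding same[OF l] by blast
    then obtain y where y: "y \<in> carrier R" "f l = e l \<otimes> y" using fR[OF l] by auto
    then have "e k \<otimes> f l = (e k \<otimes> e l) \<otimes> y" using eR k l by (simp add: m_assoc)
    then show ?thesis using e(2)[OF k l] y by auto
  qed
  let ?N = "{k \<in> K. f k \<noteq> \<zero>}"
  have "e k = e k \<otimes> finsum R f ?N" using f(3) eR[OF k] by simp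
  also have "\<dots> = finsum R (\<lambda>l. e k \<otimes> f l) ?N"
    using f(2) eR[OF k] fR by (intro finsum_rdistr) auto
  also have "\<dots> = finsum R (\<lambda>l. if k = l then f l else \<zero>) ?N"
    using fR by (intro finsum_cong') (auto simp: ef)
  also have "\<dots> = f k"
  proof (cases "f k = \<zero>")
    case False
    then show ?thesis using k f(2) fR by (intro add.finprod_singleton) auto
  next
    case True
    have "finsum R (\<lambda>l. if k = l then f l else \<zero>) ?N = finsum R (\<lambda>l. \<zero>) ?N"
      using True by (intro finsum_cong') auto
    then show ?thesis using True by simp
  qed
  finally show "e k = f k" .
qed

context yh_reduction
begin

abbreviation eqv_k (infix "\<sim>" 50) where "eqv_k \<equiv> k.eqv"

definition E :: "multitableau set \<Rightarrow> (yh_gen list \<Rightarrow>\<^sub>0 'k)" where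
  "E T = red.\<Phi> (lift T)"

lemma lift_A: "T \<in> tableau_classes \<Longrightarrow> lift T \<in> carrier O.A"
  by (rule O.acts_A[OF acts_lift])

lemma E_A [intro, simp]: "T \<in> tableau_classes \<Longrightarrow> E T \<in> carrier k.A"
  unfolding E_def by (intro red.\<Phi>_A lift_A)

text \<open>
  Over the valuation ring an equality of diagonal elements is tested on content vectors; once it holds
  there, it can be reduced.
\<close>

lemma acts_reduce:
  assumes "O.acts f \<chi>" "O.acts g \<chi>'" "\<And>s. s \<in> Std d n \<Longrightarrow> \<chi> s = \<chi>' s"
  shows "red.\<Phi> f \<sim> red.\<Phi> g"
  using red.cls_\<Phi>[OF O.acts_A[OF assms(1)] O.acts_A[OF assms(2)] O.acts_cls_eq[OF assms]]
    O.acts_A[OF assms(1)] O.acts_A[OF assms(2)]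
  by (simp add: k.eqv_def)

lemma \<Phi>_X: "a \<le> n \<Longrightarrow> red.\<Phi> (O.free_X a) = k.free_X a"
proof (induction a rule: O.free_X.induct)
  case (3 a)
  have A: "O.free_X (Suc a) \<in> carrier O.A" "free_g (Suc a) \<in> carrier O.A"
    "const (inverse qhat) \<in> carrier O.A"
    using 3 by (auto intro: O.v_inv_S)
  have "res_map (inverse qhat) = inverse q"
    using residue_inverse(2)[OF q_nz residue_qhat(1)[OF q_nz]] residue_qhat(2)[OF q_nz] q_nz by simp
  then show ?case
    using 3 A by (simp add: red.\<Phi>_mult)
qed simp_all

lemma \<Phi>_L: "a \<le> 2 * n \<Longrightarrow> red.\<Phi> (O.free_L a) = k.free_L a"
  by (simp add: O.free_L_def k.free_L_def \<Phi>_X)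

lemma E_orthogonal:
  assumes "T \<in> tableau_classes" "T' \<in> tableau_classes"
  shows "E T * E T' \<sim> (if T = T' then E T else 0)"
proof -
  have "red.\<Phi> (lift T * lift T') \<sim> red.\<Phi> (if T = T' then lift T else 0)"
  proof (rule acts_reduce[OF O.acts_mult[OF acts_lift[OF assms(1)] acts_lift[OF assms(2)]]])
    show "O.acts (if T = T' then lift T else 0) (\<lambda>s. if T = T' \<and> s \<in> T then 1 else 0)"
      using acts_lift[OF assms(1)] O.acts_0 by auto
    show "(if s \<in> T then 1 else 0) * (if s \<in> T' then 1 else 0) = (if T = T' \<and> s \<in> T then 1 else (0 :: 'k poly fract))" for s
      using quotient_disj[OF equiv_content assms] by auto
  qed
  then show ?thesis
    using lift_A[OF assms(1)] lift_A[OF assms(2)] by (auto simp: E_def red.\<Phi>_mult split: if_splits)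
qed

lemma finite_tableau_classes: "finite tableau_classes"
  by (rule finite_quotient[OF finite_Std]) (auto simp: content_equiv_def)

lemma E_sum: "(\<Sum>T\<in>tableau_classes. E T) \<sim> 1"
proof -
  have "red.\<Phi> (\<Sum>T\<in>tableau_classes. lift T) \<sim> red.\<Phi> 1"
  proof (rule acts_reduce[OF O.acts_sum[OF finite_tableau_classes acts_lift] O.acts_1])
    fix s assume s: "s \<in> Std d n"
    let ?T = "content_equiv q \<xi> d n `` {s}"
    have T: "?T \<in> tableau_classes" "s \<in> ?T"
      using quotientI[OF s] equiv_class_self[OF equiv_content s] by auto
    have "(\<Sum>T\<in>tableau_classes. if s \<in> T then 1 else 0) = (\<Sum>T\<in>tableau_classes. if T = ?T then 1 else (0 :: 'k poly fract))"
      using quotient_disj[OF equiv_content _ T(1)] T(2) by (intro sum.cong) auto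
    also have "\<dots> = 1" using T(1) finite_tableau_classes by (subst sum.delta) auto
    finally show "(\<Sum>T\<in>tableau_classes. if s \<in> T then 1 else 0) = (1 :: 'k poly fract)" .
  qed
  then show ?thesis using lift_A by (simp add: red.\<Phi>_sum E_def)
qed

lemma E_L_commute:
  assumes T: "T \<in> tableau_classes" and a: "a \<in> {1..2 * n}"
  shows "E T * k.free_L a \<sim> k.free_L a * E T"
proof -
  have "red.\<Phi> (lift T * O.free_L a) \<sim> red.\<Phi> (O.free_L a * lift T)"
    by (rule acts_reduce[OF O.acts_mult[OF acts_lift[OF T] O.acts_L[OF a]] O.acts_mult[OF O.acts_L[OF a] acts_lift[OF T]]])
      (simp add: mult.commute)
  then show ?thesis
    using lift_A[OF T] a \<Phi>_L[of a] by (simp add: red.\<Phi>_mult E_def O.A_L del: One_nat_def)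
qed

text \<open>
  Generically \<open>\<Prod>\<^sub>u (L\<^sub>a - c\<^sub>u(a))\<close>, over the tableaux \<open>u\<close> of the class, kills the class idempotent. After
  reduction all these factors become equal.
\<close>

lemma E_nilpotent:
  assumes T: "T \<in> tableau_classes" and t: "t \<in> T" and a: "a \<in> {1..2 * n}"
  shows "(k.free_L a - const (content n q \<xi> t a)) ^ card T * E T \<sim> 0"
proof -
  have "finite T" using finite_subset[OF class_subset[OF T] finite_Std] .
  then obtain us where us: "set us = T" "distinct us" using finite_distinct_list by blast
  have "O.acts (prod_list (map (\<lambda>u. O.free_L a - const (ct u a)) us) * lift T)
      (\<lambda>s. prod_list (map (\<lambda>u. ct s a - ct u a) us) * (if s \<in> T then 1 else 0))"
    by (intro O.acts_mult O.acts_prod_list O.acts_diff O.acts_L O.acts_const acts_lift T a ct_local)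
  from acts_reduce[OF this O.acts_0]
  have "red.\<Phi> (prod_list (map (\<lambda>u. O.free_L a - const (ct u a)) us) * lift T) \<sim> red.\<Phi> 0"
    using us by (auto simp: prod_list_zero_iff intro!: image_eqI)
  moreover have "red.\<Phi> (prod_list (map (\<lambda>u. O.free_L a - const (ct u a)) us')) = (k.free_L a - const (content n q \<xi> t a)) ^ length us' \<and>
      prod_list (map (\<lambda>u. O.free_L a - const (ct u a)) us') \<in> carrier O.A" if "set us' \<subseteq> T" for us'
    using that
  proof (induction us')
    case (Cons u us')
    have "O.free_L a - const (ct u a) \<in> carrier O.A" using a ct_local by (intro O.A_diff O.A_L O.A_const)
    moreover have "red.\<Phi> (O.free_L a - const (ct u a)) = k.free_L a - const (content n q \<xi> t a)"
      using Cons.prems a class_iff(1)[OF T t, of u] ct_local \<Phi>_L[of a]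
      by (subst red.\<Phi>_diff) (auto intro!: O.A_L O.A_const)
    ultimately show ?case using Cons by (simp add: red.\<Phi>_mult)
  qed simp
  from this[of us] us have "red.\<Phi> (prod_list (map (\<lambda>u. O.free_L a - const (ct u a)) us)) = (k.free_L a - const (content n q \<xi> t a)) ^ card T"
    "prod_list (map (\<lambda>u. O.free_L a - const (ct u a)) us) \<in> carrier O.A"
    using distinct_card[OF us(2)] by auto
  ultimately show ?thesis using lift_A[OF T] by (simp add: red.\<Phi>_mult E_def)
qed

text \<open>
  The colours of the tableaux in a class agree before reduction already, so one factor kills all of them.
\<close>

lemma E_colour:
  assumes T: "T \<in> tableau_classes" and t: "t \<in> T" and a: "a \<in> {n + 1..2 * n}"
  shows "(k.free_L a - const (content n q \<xi> t a)) * E T \<sim> 0"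
proof -
  have a': "a \<in> {1..2 * n}" using a by auto
  have ct: "ct s a = fract_const (content n q \<xi> s a)" for s
    using a by (simp add: content_diagonal_letter fract_const_power)
  have "O.acts ((O.free_L a - const (ct t a)) * lift T) (\<lambda>s. (ct s a - ct t a) * (if s \<in> T then 1 else 0))"
    by (intro O.acts_mult O.acts_diff O.acts_L O.acts_const acts_lift T a' ct_local)
  from acts_reduce[OF this O.acts_0]
  have "red.\<Phi> ((O.free_L a - const (ct t a)) * lift T) \<sim> red.\<Phi> 0"
    using class_iff(1)[OF T t] a' by (auto simp: ct)
  then show ?thesis
    using lift_A[OF T] a' ct_local \<Phi>_L[of a]
    by (simp add: red.\<Phi>_mult red.\<Phi>_diff E_def O.A_L O.A_const del: One_nat_def)
qed

lemma weight_of_class: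
  assumes T: "T \<in> tableau_classes"
  shows "\<exists>!w. w \<in> weights q d n \<and> (\<forall>t\<in>T. \<forall>a\<in>{1..n}.
     content n q \<xi> t a = q powi fst (w a) \<and> content n q \<xi> t (n + a) = \<xi> powi snd (w a))"
proof -
  obtain t where t: "t \<in> T" using class_nonempty[OF T] by blast
  let ?e = "quantum_char q"
  define w where "w = restrict (\<lambda>a. (fst (diagonal_letter t a) mod int ?e, int (snd (diagonal_letter t a)) mod int d)) {1..n}"
  have w: "w \<in> weights q d n" by (auto simp: w_def weights_def int_residues_mod)
  have qp: "q powi (i mod int ?e) = q powi i" for i
    by (subst power_int_quantum_char[OF q_nz q_1]) simp
  have xp: "\<xi> powi (i mod int d) = \<xi> powi i" for i
    by (subst power_int_primitive_root[OF xi_prim d_pos]) simp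
  have wt: "content n q \<xi> t a = q powi fst (w a) \<and> content n q \<xi> t (n + a) = \<xi> powi snd (w a)" if "a \<in> {1..n}" for a
    using that by (simp add: w_def content_diagonal_letter qp xp)
  have wT: "content n q \<xi> s a = q powi fst (w a) \<and> content n q \<xi> s (n + a) = \<xi> powi snd (w a)"
    if "s \<in> T" "a \<in> {1..n}" for s a
    using class_iff(1)[OF T t, of s] that wt[of a] by auto
  show ?thesis
  proof (rule ex1I[of _ w])
    fix w' assume w': "w' \<in> weights q d n \<and> (\<forall>t\<in>T. \<forall>a\<in>{1..n}.
     content n q \<xi> t a = q powi fst (w' a) \<and> content n q \<xi> t (n + a) = \<xi> powi snd (w' a))"
    show "w' = w"
    proof (rule PiE_ext)
      fix a assume a: "a \<in> {1..n}"
      have "q powi fst (w' a) = q powi fst (w a)" "\<xi> powi snd (w' a) = \<xi> powi snd (w a)"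
        using w' wt[OF a] t a by auto
      then have "fst (w' a) mod int ?e = fst (w a) mod int ?e" "snd (w' a) mod int d = snd (w a) mod int d"
        using power_int_quantum_char[OF q_nz q_1] power_int_primitive_root[OF xi_prim d_pos] by blast+
      moreover have "fst x \<in> int_residues ?e" "snd x \<in> int_residues d" if "x = w a \<or> x = w' a" for x
        using that w w' a by (auto simp: weights_def PiE_iff mem_Times_iff)
      ultimately show "w' a = w a" by (auto simp: int_residues_def prod_eq_iff)
    qed (use w w' in \<open>auto simp: weights_def\<close>)
  qed (use w wT in auto)
qed

lemma res_class:
  assumes "T \<in> tableau_classes"
  shows "res q \<xi> d n T \<in> weights q d n"
    and "t \<in> T \<Longrightarrow> a \<in> {1..n} \<Longrightarrow> content n q \<xi> t a = q powi fst (res q \<xi> d n T a)"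
    and "t \<in> T \<Longrightarrow> a \<in> {1..n} \<Longrightarrow> content n q \<xi> t (n + a) = \<xi> powi snd (res q \<xi> d n T a)"
  using theI'[OF weight_of_class[OF assms]] unfolding res_def[symmetric] by auto

lemma res_inj: "inj_on (res q \<xi> d n) tableau_classes"
proof (rule inj_onI)
  fix T T' assume T: "T \<in> tableau_classes" "T' \<in> tableau_classes" and eq: "res q \<xi> d n T = res q \<xi> d n T'"
  obtain t t' where t: "t \<in> T" "t' \<in> T'" using class_nonempty T by blast
  have "content n q \<xi> t' a = content n q \<xi> t a" if a: "a \<in> {1..2 * n}" for a
  proof (cases "a \<le> n")
    case True
    then show ?thesis using a res_class(2)[OF T(1) t(1), of a] res_class(2)[OF T(2) t(2), of a] eq by simp
  next
    case False
    then have "a - n \<in> {1..n}" using a by auto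
    then show ?thesis
      using False res_class(3)[OF T(1) t(1), of "a - n"] res_class(3)[OF T(2) t(2), of "a - n"] eq by simp
  qed
  then have "t' \<in> T" using class_iff[OF T(1) t(1)] class_iff(2)[OF T(2) t(2)] by auto
  then show "T = T'" using quotient_disj[OF equiv_content T] t(2) by auto
qed

lemma weight_separates:
  assumes "w \<in> weights q d n" "w' \<in> weights q d n" "w \<noteq> w'"
  shows "\<exists>a\<in>{1..n}. q powi fst (w a) \<noteq> q powi fst (w' a) \<or> \<xi> powi snd (w a) \<noteq> \<xi> powi snd (w' a)"
proof (rule ccontr)
  assume *: "\<not> ?thesis"
  have "w = w'"
  proof (rule PiE_ext)
    fix a assume a: "a \<in> {1..n}"
    then have "fst (w a) mod int (quantum_char q) = fst (w' a) mod int (quantum_char q)"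
      "snd (w a) mod int d = snd (w' a) mod int d"
      using * power_int_quantum_char[OF q_nz q_1] power_int_primitive_root[OF xi_prim d_pos] by blast+
    moreover have "fst x \<in> int_residues (quantum_char q)" "snd x \<in> int_residues d" if "x = w a \<or> x = w' a" for x
      using that assms a by (auto simp: weights_def PiE_iff mem_Times_iff)
    ultimately show "w a = w' a" by (auto simp: int_residues_def prod_eq_iff)
  qed (use assms in \<open>auto simp: weights_def\<close>)
  then show False using assms(3) by simp
qed

lemma in_weight_space_iff:
  assumes f: "f \<in> carrier k.A"
  shows "k.cls f \<in> weight_space q \<xi> d n w \<longleftrightarrow> (\<exists>N\<^sub>0. \<forall>N\<ge>N\<^sub>0. \<forall>a\<in>{1..n}.
    (k.free_L a - const (q powi fst (w a))) ^ N * f \<sim> 0 \<and>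
    (k.free_L (n + a) - const (\<xi> powi snd (w a))) * f \<sim> 0)"
proof -
  have "(yh_X UNIV d n q a \<ominus>\<^bsub>k.Y\<^esub> yh_scalar UNIV d n q c) [^]\<^bsub>k.Y\<^esub> N \<otimes>\<^bsub>k.Y\<^esub> k.cls f = \<zero>\<^bsub>k.Y\<^esub> \<longleftrightarrow>
      (k.free_L a - const c) ^ N * f \<sim> 0"
    "(yh_t UNIV d n q a \<ominus>\<^bsub>k.Y\<^esub> yh_scalar UNIV d n q c) \<otimes>\<^bsub>k.Y\<^esub> k.cls f = \<zero>\<^bsub>k.Y\<^esub> \<longleftrightarrow>
      (k.free_L (n + a) - const c) * f \<sim> 0" if a: "a \<in> {1..n}" for a c and N :: nat
  proof -
    have X: "k.free_X a \<in> carrier k.A" "free_t a \<in> carrier k.A" "const c \<in> carrier k.A" using a by auto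
    have L: "k.free_L a = k.free_X a" "k.free_L (n + a) = free_t a" using a by (auto simp: k.free_L_def)
    show "(yh_X UNIV d n q a \<ominus>\<^bsub>k.Y\<^esub> yh_scalar UNIV d n q c) [^]\<^bsub>k.Y\<^esub> N \<otimes>\<^bsub>k.Y\<^esub> k.cls f = \<zero>\<^bsub>k.Y\<^esub> \<longleftrightarrow>
      (k.free_L a - const c) ^ N * f \<sim> 0"
      using a X f by (simp add: L k.yh_X_cls yh_scalar_def k.eqv_0_iff k.cls_mult k.cls_power k.cls_diff)
    show "(yh_t UNIV d n q a \<ominus>\<^bsub>k.Y\<^esub> yh_scalar UNIV d n q c) \<otimes>\<^bsub>k.Y\<^esub> k.cls f = \<zero>\<^bsub>k.Y\<^esub> \<longleftrightarrow>
      (k.free_L (n + a) - const c) * f \<sim> 0"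
      using a X f by (simp add: L yh_t_def yh_scalar_def k.eqv_0_iff k.cls_mult k.cls_diff)
  qed
  then show ?thesis using f unfolding weight_space_def Let_def by auto
qed

lemma E_in_weight_space:
  assumes T: "T \<in> tableau_classes" and g: "g \<in> carrier k.A"
  shows "k.cls (E T * g) \<in> weight_space q \<xi> d n (res q \<xi> d n T)"
proof -
  obtain t where t: "t \<in> T" using class_nonempty[OF T] by blast
  let ?w = "res q \<xi> d n T"
  have X: "(k.free_L a - const (q powi fst (?w a))) ^ N * (E T * g) \<sim> 0"
    if N: "card T \<le> N" and a: "a \<in> {1..n}" for N a
  proof -
    let ?z = "k.free_L a - const (q powi fst (?w a))"
    have z: "?z \<in> carrier k.A" using a by (intro k.A_diff k.A_L k.A_const) auto
    have "?z ^ card T * E T \<sim> 0"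
      using E_nilpotent[OF T t, of a] res_class(2)[OF T t a] a by simp
    from k.eqv_right[OF g k.eqv_left[OF k.A_power[OF z] this, of "N - card T"]]
    have "?z ^ (N - card T) * (?z ^ card T * E T) * g \<sim> 0" by simp
    moreover have "?z ^ N = ?z ^ (N - card T) * ?z ^ card T" using N by (simp flip: power_add)
    ultimately show ?thesis by (simp add: mult.assoc)
  qed
  have t: "(k.free_L (n + a) - const (\<xi> powi snd (?w a))) * (E T * g) \<sim> 0" if a: "a \<in> {1..n}" for a
  proof -
    have "(k.free_L (n + a) - const (\<xi> powi snd (?w a))) * E T \<sim> 0"
      using E_colour[OF T t, of "n + a"] res_class(3)[OF T t a] a by simp
    from k.eqv_right[OF g this] show ?thesis by (simp add: mult.assoc)
  qed
  show ?thesis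
    using X t T g by (subst in_weight_space_iff) (auto intro!: exI[of _ "card T"])
qed

lemma E_kills_other_weights:
  assumes T: "T \<in> tableau_classes" and f: "f \<in> carrier k.A" and w: "w \<in> weights q d n"
    and space: "k.cls f \<in> weight_space q \<xi> d n w" and ne: "res q \<xi> d n T \<noteq> w"
  shows "E T * f \<sim> 0"
proof -
  obtain t where t: "t \<in> T" using class_nonempty[OF T] by blast
  let ?r = "res q \<xi> d n T"
  obtain N where N: "\<And>a. a \<in> {1..n} \<Longrightarrow> (k.free_L a - const (q powi fst (w a))) ^ N * f \<sim> 0"
      "\<And>a. a \<in> {1..n} \<Longrightarrow> (k.free_L (n + a) - const (\<xi> powi snd (w a))) * f \<sim> 0"
    using space unfolding in_weight_space_iff[OF f] by blast
  have kill: "E T * f \<sim> 0"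
    if a: "a \<in> {1..2 * n}" and c: "content n q \<xi> t a \<noteq> c" and M: "(k.free_L a - const c) ^ M * f \<sim> 0" for a c M
  proof (rule k.distinct_eigenvalues_0)
    show L: "k.free_L a \<in> carrier k.A" using a by (rule k.A_L)
    show "E T * f \<in> carrier k.A" using T f by auto
    show "content n q \<xi> t a \<noteq> c" by (rule c)
    show "(k.free_L a - const (content n q \<xi> t a)) ^ card T * (E T * f) \<sim> 0"
      using k.eqv_right[OF f E_nilpotent[OF T t a]] by (simp add: mult.assoc)
    have z: "k.free_L a - const c \<in> carrier k.A" using L by auto
    have "(k.free_L a - const c) * E T \<sim> E T * (k.free_L a - const c)"
    proof -
      have "k.free_L a * E T - const c * E T \<sim> E T * k.free_L a - const c * E T"
        using k.eqv_add[OF k.eqv_sym[OF E_L_commute[OF T a]] k.eqv_refl[of "- (const c * E T)"]] T by simp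
      then show ?thesis by (simp add: algebra_simps const_commute)
    qed
    from k.commutes_power[OF E_A[OF T] this z]
    have "(k.free_L a - const c) ^ M * E T \<sim> E T * (k.free_L a - const c) ^ M" .
    from k.eqv_right[OF f this]
    have "(k.free_L a - const c) ^ M * (E T * f) \<sim> E T * ((k.free_L a - const c) ^ M * f)" by (simp add: mult.assoc)
    also have "\<dots> \<sim> E T * 0" by (rule k.eqv_left[OF E_A[OF T] M])
    finally show "(k.free_L a - const c) ^ M * (E T * f) \<sim> 0" by simp
  qed auto
  obtain a where a: "a \<in> {1..n}" "q powi fst (?r a) \<noteq> q powi fst (w a) \<or> \<xi> powi snd (?r a) \<noteq> \<xi> powi snd (w a)"
    using weight_separates[OF res_class(1)[OF T] w ne] by blast
  from a(2) show ?thesis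
  proof
    assume "q powi fst (?r a) \<noteq> q powi fst (w a)"
    then show ?thesis using kill[of a _ N] N(1)[OF a(1)] res_class(2)[OF T t a(1)] a(1) by auto
  next
    assume "\<xi> powi snd (?r a) \<noteq> \<xi> powi snd (w a)"
    then show ?thesis using kill[of "n + a" _ 1] N(2)[OF a(1)] res_class(3)[OF T t a(1)] a(1) by auto
  qed
qed

text \<open>
  Weights that are not residues of a class carry the idempotent 0: their weight spaces vanish because
  the class idempotents sum to 1.
\<close>

definition class_family :: "(nat \<Rightarrow> int \<times> int) \<Rightarrow> (yh_gen list \<Rightarrow>\<^sub>0 'k) set" where
  "class_family = restrict (\<lambda>w. if w \<in> res q \<xi> d n ` tableau_classes
     then k.cls (E (inv_into tableau_classes (res q \<xi> d n) w)) else k.cls 0) (weights q d n)"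

lemma class_family_res: "T \<in> tableau_classes \<Longrightarrow> class_family (res q \<xi> d n T) = k.cls (E T)"
  using res_class(1) res_inj by (simp add: class_family_def)

lemma class_family_other:
  "w \<in> weights q d n \<Longrightarrow> w \<notin> res q \<xi> d n ` tableau_classes \<Longrightarrow> class_family w = \<zero>\<^bsub>k.Y\<^esub>"
  by (simp add: class_family_def k.cls_0)

lemma class_family_cases:
  assumes "w \<in> weights q d n"
  obtains T where "T \<in> tableau_classes" "w = res q \<xi> d n T" "class_family w = k.cls (E T)"
    | "w \<notin> res q \<xi> d n ` tableau_classes" "class_family w = k.cls 0"
  using assms class_family_res by (cases "w \<in> res q \<xi> d n ` tableau_classes") (auto simp: class_family_def)

lemma class_family_closed: "w \<in> weights q d n \<Longrightarrow> class_family w \<in> carrier k.Y"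
  by (erule class_family_cases) auto

text \<open>
  A vector of the weight space is fixed by the class idempotent of that weight, since it is killed by
  all the others and they sum to 1.
\<close>

lemma class_family_image:
  assumes w: "w \<in> weights q d n"
  shows "(\<lambda>y. class_family w \<otimes>\<^bsub>k.Y\<^esub> y) ` carrier k.Y = weight_space q \<xi> d n w"
proof (intro equalityI subsetI)
  fix x assume "x \<in> (\<lambda>y. class_family w \<otimes>\<^bsub>k.Y\<^esub> y) ` carrier k.Y"
  then obtain g where g: "g \<in> carrier k.A" "x = class_family w \<otimes>\<^bsub>k.Y\<^esub> k.cls g" by (auto simp: k.carrier_Y)
  show "x \<in> weight_space q \<xi> d n w"
    using w
  proof (cases rule: class_family_cases)
    case (1 T)
    then have "x = k.cls (E T * g)" using g by (simp add: k.cls_mult)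
    then show ?thesis using E_in_weight_space[OF 1(1) g(1)] 1(2) by simp
  next
    case 2
    then have "x = k.cls 0" using g by (simp flip: k.cls_mult)
    then show ?thesis by (simp add: in_weight_space_iff)
  qed
next
  fix x assume x: "x \<in> weight_space q \<xi> d n w"
  then have "x \<in> carrier k.Y" by (auto simp: weight_space_def Let_def)
  then obtain f where f: "f \<in> carrier k.A" "x = k.cls f" by (auto simp: k.carrier_Y)
  have kill: "E T * f \<sim> (if res q \<xi> d n T = w then E T * f else 0)" if "T \<in> tableau_classes" for T
    using E_kills_other_weights[OF that f(1) w] x f that by auto
  have "f \<sim> (\<Sum>T\<in>tableau_classes. E T) * f"
    using k.eqv_sym[OF k.eqv_right[OF f(1) E_sum]] by simp
  also have "\<dots> = (\<Sum>T\<in>tableau_classes. E T * f)" by (rule sum_distrib_right)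
  also have "\<dots> \<sim> (\<Sum>T\<in>tableau_classes. if res q \<xi> d n T = w then E T * f else 0)"
    by (rule k.eqv_sum[OF kill])
  finally have sum: "f \<sim> (\<Sum>T\<in>tableau_classes. if res q \<xi> d n T = w then E T * f else 0)" .
  have "x = class_family w \<otimes>\<^bsub>k.Y\<^esub> x"
    using w
  proof (cases rule: class_family_cases)
    case (1 T)
    have "(\<Sum>T'\<in>tableau_classes. if res q \<xi> d n T' = w then E T' * f else 0) =
        (\<Sum>T'\<in>tableau_classes. if T' = T then E T * f else 0)"
      using 1 res_inj by (intro sum.cong) (auto dest: inj_onD)
    also have "\<dots> = E T * f" using 1 finite_tableau_classes by (subst sum.delta) auto
    finally have "k.cls f = k.cls (E T * f)" using sum by (simp add: k.eqv_def)
    then show ?thesis using 1 f by (simp add: k.cls_mult)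
  next
    case 2
    have "(\<Sum>T'\<in>tableau_classes. if res q \<xi> d n T' = w then E T' * f else 0) = 0"
      using 2 by (intro sum.neutral) auto
    then have "k.cls f = k.cls (0 * f)" using sum by (simp add: k.eqv_def)
    then show ?thesis using 2 f k.cls_mult[OF k.A_0 f(1)] by simp
  qed
  then show "x \<in> (\<lambda>y. class_family w \<otimes>\<^bsub>k.Y\<^esub> y) ` carrier k.Y" using \<open>x \<in> carrier k.Y\<close> by blast
qed

lemma class_family_sum:
  shows "finite {w \<in> weights q d n. class_family w \<noteq> \<zero>\<^bsub>k.Y\<^esub>}"
    and "finsum k.Y class_family {w \<in> weights q d n. class_family w \<noteq> \<zero>\<^bsub>k.Y\<^esub>} = \<one>\<^bsub>k.Y\<^esub>"
proof -
  let ?N = "{T \<in> tableau_classes. k.cls (E T) \<noteq> \<zero>\<^bsub>k.Y\<^esub>}"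
  have N: "{w \<in> weights q d n. class_family w \<noteq> \<zero>\<^bsub>k.Y\<^esub>} = res q \<xi> d n ` ?N"
  proof (intro equalityI subsetI)
    fix w assume w: "w \<in> {w \<in> weights q d n. class_family w \<noteq> \<zero>\<^bsub>k.Y\<^esub>}"
    then have "w \<in> weights q d n" by simp
    then show "w \<in> res q \<xi> d n ` ?N"
    proof (cases rule: class_family_cases)
      case (1 T)
      then have "T \<in> ?N" using w by simp
      then show ?thesis unfolding 1(2) by (rule imageI)
    next
      case 2
      then show ?thesis using w by (simp add: k.cls_0)
    qed
  next
    fix w assume "w \<in> res q \<xi> d n ` ?N"
    then obtain T where T: "T \<in> tableau_classes" "k.cls (E T) \<noteq> \<zero>\<^bsub>k.Y\<^esub>" "w = res q \<xi> d n T" by blast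
    then show "w \<in> {w \<in> weights q d n. class_family w \<noteq> \<zero>\<^bsub>k.Y\<^esub>}"
      using class_family_res[OF T(1)] res_class(1)[OF T(1)] by simp
  qed
  have fin: "finite ?N" using finite_tableau_classes by simp
  show "finite {w \<in> weights q d n. class_family w \<noteq> \<zero>\<^bsub>k.Y\<^esub>}" unfolding N using fin by simp
  have "finsum k.Y class_family (res q \<xi> d n ` ?N) = finsum k.Y (\<lambda>T. class_family (res q \<xi> d n T)) ?N"
    using class_family_closed res_class(1) inj_on_subset[OF res_inj] by (intro k.Y.finsum_reindex) auto
  also have "\<dots> = finsum k.Y (\<lambda>T. k.cls (E T)) ?N"
    by (intro k.Y.finsum_cong') (auto simp: class_family_res)
  also have "\<dots> = k.cls (\<Sum>T\<in>?N. E T)"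
    using fin by (intro k.cls_sum[symmetric]) auto
  also have "\<dots> = k.cls (\<Sum>T\<in>tableau_classes. E T)"
  proof -
    have "(\<Sum>T\<in>tableau_classes. E T) \<sim> (\<Sum>T\<in>tableau_classes. if T \<in> ?N then E T else 0)"
      by (intro k.eqv_sum) (auto simp: k.eqv_0_iff)
    also have "(\<Sum>T\<in>tableau_classes. if T \<in> ?N then E T else 0) = (\<Sum>T\<in>?N. E T)"
      using finite_tableau_classes by (subst sum.inter_restrict[symmetric]) (auto intro: sum.cong)
    finally show ?thesis by (simp add: k.eqv_def)
  qed
  also have "\<dots> = \<one>\<^bsub>k.Y\<^esub>" using E_sum by (simp add: k.eqv_def k.cls_1)
  finally show "finsum k.Y class_family {w \<in> weights q d n. class_family w \<noteq> \<zero>\<^bsub>k.Y\<^esub>} = \<one>\<^bsub>k.Y\<^esub>"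
    unfolding N .
qed

lemma class_family_orthogonal:
  assumes "w \<in> weights q d n" "w' \<in> weights q d n"
  shows "class_family w \<otimes>\<^bsub>k.Y\<^esub> class_family w' = (if w = w' then class_family w else \<zero>\<^bsub>k.Y\<^esub>)"
proof (cases "w \<in> res q \<xi> d n ` tableau_classes \<and> w' \<in> res q \<xi> d n ` tableau_classes")
  case True
  then obtain T T' where T: "T \<in> tableau_classes" "T' \<in> tableau_classes" and w: "w = res q \<xi> d n T" "w' = res q \<xi> d n T'"
    by blast
  have "w = w' \<longleftrightarrow> T = T'" using T w res_inj by (auto dest: inj_onD)
  then show ?thesis
    using E_orthogonal[OF T] T by (auto simp: w class_family_res k.eqv_def k.cls_0 simp flip: k.cls_mult split: if_splits)
next
  case False
  then have "class_family w = \<zero>\<^bsub>k.Y\<^esub> \<or> class_family w' = \<zero>\<^bsub>k.Y\<^esub>" using class_family_other assms by blast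
  then show ?thesis using class_family_closed assms by auto
qed

lemma class_family_weight_idempotents: "weight_idempotent_family q \<xi> d n class_family"
  unfolding weight_idempotent_family_def Let_def
  using class_family_orthogonal class_family_sum class_family_image class_family_closed
  by (auto simp: class_family_def[abs_def])

lemma weight_idempotent_eq: "weight_idempotent q \<xi> d n = class_family"
  unfolding weight_idempotent_def
proof (rule the_equality)
  show "weight_idempotent_family q \<xi> d n class_family" by (rule class_family_weight_idempotents)
next
  fix e assume e: "weight_idempotent_family q \<xi> d n e"
  show "e = class_family"
  proof (rule k.Y.idempotent_family_unique)
    show "e \<in> weights q d n \<rightarrow>\<^sub>E carrier k.Y" "class_family \<in> weights q d n \<rightarrow>\<^sub>E carrier k.Y"
      using e class_family_weight_idempotents by (auto simp: weight_idempotent_family_def Let_def)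
    show "(\<lambda>y. e w \<otimes>\<^bsub>k.Y\<^esub> y) ` carrier k.Y = (\<lambda>y. class_family w \<otimes>\<^bsub>k.Y\<^esub> y) ` carrier k.Y"
      if "w \<in> weights q d n" for w
      using e that class_family_image[OF that] by (simp add: weight_idempotent_family_def Let_def)
    show "e w \<otimes>\<^bsub>k.Y\<^esub> e w' = (if w = w' then e w else \<zero>\<^bsub>k.Y\<^esub>)"
      if "w \<in> weights q d n" "w' \<in> weights q d n" for w w'
      using e that by (simp add: weight_idempotent_family_def Let_def)
  qed (rule class_family_sum)+
qed

end

theorem theorem20:
  fixes q \<xi> :: "'k::field" and d n :: nat and T :: "multitableau set"
  assumes "0 < n" and "0 < d"
    and "CHAR('k) = 0 \<or> coprime d CHAR('k)"
    and "primitive_root_of_unity d \<xi>"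
    and "q \<noteq> 0" and "q \<noteq> 1"
    and "T \<in> Std d n // content_equiv q \<xi> d n"
  shows "class_idempotent q \<xi> d n T = weight_idempotent q \<xi> d n (res q \<xi> d n T)"
proof -
  interpret yh_reduction q \<xi> d n
    using assms by unfold_locales
  show ?thesis
    using assms(7) by (simp add: weight_idempotent_eq class_family_res class_idempotent_cls E_def)
qed

end
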